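(* Let $1\le p\le\infty$. There exists a constant $C=C(p)$ depending only on $p$ (in particular, independent of the geometry of the triangle), which satisfies, for every triangle $K\subset\mathbb{R}^2$ with $h_K:=\operatorname{diam}K$, $$\sup_{u\in\Phi_p(K)\setminus\{0\}}\frac{|u|_{0,p,K}}{|u|_{1,p,K}}\le C h_K,\qquad \sup_{u\in\mathcal{E}_p(K)\setminus\{0\}}\frac{|u|_{0,p,K}}{|u|_{1,p,K}}\le C h_K,$$ and such that, for every triangle $K\subset\mathbb{R}^2$, the Crouzeix--Raviart interpolation $\mathcal{I}_K^{CR}v$ satisfies the error estimates $$|v-\mathcal{I}_K^{CR}v|_{0,p,K}\le 2C h_K|v|_{1,p,K}\qquad\text{for all } v\in W^{1,p}(K),$$ $$|v-\mathcal{I}_K^{CR}v|_{0,p,K}\le C h_K|v-\mathcal{I}_K^{CR}v|_{1,p,K}\le C^2h_K^2|v|_{2,p,K}\qquad\text{for all } v\in W^{2,p}(K).$$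
   Context: For a triangle $K$ with edges $e_1,e_2,e_3$ and $v\in W^{1,1}(K)$, the Crouzeix--Raviart interpolation $\mathcal{I}_K^{CR}v$ is the unique polynomial of degree at most $1$ in two variables with $\int_{e_i}(v-\mathcal{I}_K^{CR}v)\,ds=0$ for $i=1,2,3$ (boundary values in the sense of traces). $\Phi_p(K):=\{v\in W^{1,p}(K):\int_Kv\,d\mathbf{x}=0\}$ and $\mathcal{E}_p(K):=\{v\in W^{1,p}(K):\int_{e_i}v\,ds=0,\ i=1,2,3\}$. Seminorms: $|v|_{0,p,K}=\|v\|_{L^p(K)}$; for integers $k\ge1$ and $1\le p<\infty$, $|v|_{k,p,K}=\bigl(\sum_{|\delta|=k}|\partial^\delta v|_{0,p,K}^p\bigr)^{1/p}$, the sum running over multi-indices $\delta\in\mathbb{N}_0^2$ with $|\delta|=k$; and $|v|_{k,\infty,K}=\max_{|\delta|=k}\operatorname{ess\,sup}_K|\partial^\delta v|$. *)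

theory Defs
  imports "HOL-Analysis.Analysis" "HOL-Probability.Essential_Supremum"
begin

subsection \<open>Classical partial derivatives and test functions\<close>

definition partial_deriv :: "2 \<Rightarrow> (real^2 \<Rightarrow> real) \<Rightarrow> real^2 \<Rightarrow> real" where
  "partial_deriv i f x = frechet_derivative f (at x) (axis i 1)"

primrec C_k :: "nat \<Rightarrow> (real^2 \<Rightarrow> real) \<Rightarrow> bool" where
  "C_k 0 f \<longleftrightarrow> continuous_on UNIV f"
| "C_k (Suc k) f \<longleftrightarrow> (\<forall>x. f differentiable (at x)) \<and> (\<forall>i. C_k k (partial_deriv i f))"

definition smooth :: "(real^2 \<Rightarrow> real) \<Rightarrow> bool" where
  "smooth f \<longleftrightarrow> (\<forall>k. C_k k f)"

definition test_functions :: "(real^2) set \<Rightarrow> (real^2 \<Rightarrow> real) set" where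
  "test_functions \<Omega> =
    {\<phi>. smooth \<phi> \<and> compact (closure {x. \<phi> x \<noteq> 0}) \<and> closure {x. \<phi> x \<noteq> 0} \<subseteq> \<Omega>}"

text \<open>A multi-index in two variables is a pair of naturals.\<close>

definition mi_order :: "nat \<times> nat \<Rightarrow> nat" where
  "mi_order \<delta> = fst \<delta> + snd \<delta>"

definition mi_deriv :: "nat \<times> nat \<Rightarrow> (real^2 \<Rightarrow> real) \<Rightarrow> real^2 \<Rightarrow> real" where
  "mi_deriv \<delta> f = (partial_deriv 1 ^^ fst \<delta>) ((partial_deriv 2 ^^ snd \<delta>) f)"

subsection \<open>Lebesgue and Sobolev spaces\<close>

text \<open>
  Exponents range over the interval from 1 to infinity, encoded as extended nonnegative reals
  with \<open>top\<close> for infinity.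
  Functions are representatives defined on the whole plane; only their values almost
  everywhere on the domain matter.
\<close>

definition epowr :: "ennreal \<Rightarrow> real \<Rightarrow> ennreal" where
  "epowr x r = (if x = top then top else ennreal (enn2real x powr r))"

definition Lp_norm :: "ennreal \<Rightarrow> (real^2) set \<Rightarrow> (real^2 \<Rightarrow> real) \<Rightarrow> ennreal" where
  "Lp_norm p \<Omega> f =
    (if p = top then esssup (lebesgue_on \<Omega>) (\<lambda>x. ennreal \<bar>f x\<bar>)
     else epowr (\<integral>\<^sup>+x. ennreal (\<bar>f x\<bar> powr enn2real p) \<partial>lebesgue_on \<Omega>) (1 / enn2real p))"

definition Lp_space :: "ennreal \<Rightarrow> (real^2) set \<Rightarrow> (real^2 \<Rightarrow> real) set" where
  "Lp_space p \<Omega> = {f \<in> borel_measurable (lebesgue_on \<Omega>). Lp_norm p \<Omega> f < top}"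

definition locally_integrable :: "(real^2) set \<Rightarrow> (real^2 \<Rightarrow> real) \<Rightarrow> bool" where
  "locally_integrable \<Omega> f \<longleftrightarrow> (\<forall>S. compact S \<and> S \<subseteq> \<Omega> \<longrightarrow> f absolutely_integrable_on S)"

definition is_weak_deriv ::
    "(real^2) set \<Rightarrow> nat \<times> nat \<Rightarrow> (real^2 \<Rightarrow> real) \<Rightarrow> (real^2 \<Rightarrow> real) \<Rightarrow> bool" where
  "is_weak_deriv \<Omega> \<delta> u w \<longleftrightarrow>
     locally_integrable \<Omega> u \<and> locally_integrable \<Omega> w \<and>
     (\<forall>\<phi>\<in>test_functions \<Omega>.
        (\<integral>x. u x * mi_deriv \<delta> \<phi> x \<partial>lebesgue_on \<Omega>) =
        (-1) ^ mi_order \<delta> * (\<integral>x. w x * \<phi> x \<partial>lebesgue_on \<Omega>))"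

text \<open>Weak derivatives are unique only almost everywhere; a representative is chosen.\<close>

definition weak_deriv :: "(real^2) set \<Rightarrow> nat \<times> nat \<Rightarrow> (real^2 \<Rightarrow> real) \<Rightarrow> real^2 \<Rightarrow> real" where
  "weak_deriv \<Omega> \<delta> u = (SOME w. is_weak_deriv \<Omega> \<delta> u w)"

definition sobolev :: "nat \<Rightarrow> ennreal \<Rightarrow> (real^2) set \<Rightarrow> (real^2 \<Rightarrow> real) set" where
  "sobolev k p \<Omega> =
    {u \<in> Lp_space p \<Omega>. \<forall>\<delta>. mi_order \<delta> \<le> k \<longrightarrow> (\<exists>w\<in>Lp_space p \<Omega>. is_weak_deriv \<Omega> \<delta> u w)}"

definition seminorm :: "nat \<Rightarrow> ennreal \<Rightarrow> (real^2) set \<Rightarrow> (real^2 \<Rightarrow> real) \<Rightarrow> ennreal" where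
  "seminorm k p \<Omega> v =
    (if k = 0 then Lp_norm p \<Omega> v
     else if p = top then (MAX \<delta>\<in>{\<delta>. mi_order \<delta> = k}. Lp_norm top \<Omega> (weak_deriv \<Omega> \<delta> v))
     else epowr (\<Sum>\<delta> | mi_order \<delta> = k. epowr (Lp_norm p \<Omega> (weak_deriv \<Omega> \<delta> v)) (enn2real p))
            (1 / enn2real p))"

subsection \<open>Triangles and traces\<close>

text \<open>
  A triangle is given by its vertices \<open>a\<close>, \<open>b\<close>, \<open>c\<close> (assumed not collinear). Its function spaces
  live on the interior, which differs from the closed triangle by a null set.
\<close>

definition closed_triangle :: "real^2 \<Rightarrow> real^2 \<Rightarrow> real^2 \<Rightarrow> (real^2) set" where
  "closed_triangle a b c = convex hull {a, b, c}"

abbreviation open_triangle :: "real^2 \<Rightarrow> real^2 \<Rightarrow> real^2 \<Rightarrow> (real^2) set" where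
  "open_triangle a b c \<equiv> interior (closed_triangle a b c)"

text \<open>An edge is represented by the pair of its endpoints.\<close>

definition edges :: "real^2 \<Rightarrow> real^2 \<Rightarrow> real^2 \<Rightarrow> ((real^2) \<times> (real^2)) set" where
  "edges a b c = {(a, b), (b, c), (c, a)}"

text \<open>Arc-length integrals, through the constant-speed parametrisation by \<open>{0..1}\<close>.\<close>

definition edge_integral :: "(real^2) \<times> (real^2) \<Rightarrow> (real^2 \<Rightarrow> real) \<Rightarrow> real" where
  "edge_integral e f =
     dist (fst e) (snd e) * (\<integral>t. f (linepath (fst e) (snd e) t) \<partial>lebesgue_on {0..1})"

definition edge_measurable :: "(real^2) \<times> (real^2) \<Rightarrow> (real^2 \<Rightarrow> real) \<Rightarrow> bool" where
  "edge_measurable e f \<longleftrightarrow>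
     (\<lambda>t. f (linepath (fst e) (snd e) t)) \<in> borel_measurable (lebesgue_on {0..1})"

definition edge_L1_norm :: "(real^2) \<times> (real^2) \<Rightarrow> (real^2 \<Rightarrow> real) \<Rightarrow> ennreal" where
  "edge_L1_norm e f =
     ennreal (dist (fst e) (snd e)) *
       (\<integral>\<^sup>+t. ennreal \<bar>f (linepath (fst e) (snd e) t)\<bar> \<partial>lebesgue_on {0..1})"

text \<open>
  The trace operator is the continuous extension to \<open>W\<^sup>1\<^sup>,\<^sup>1\<close> of the restriction to the boundary
  of functions smooth up to the boundary: \<open>g\<close> is the trace of \<open>v\<close> if some smooth functions
  converge to \<open>v\<close> in \<open>W\<^sup>1\<^sup>,\<^sup>1\<close> on the triangle and to \<open>g\<close> in \<open>L\<^sup>1\<close> on its edges. As triangles are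
  bounded, this also covers \<open>W\<^sup>1\<^sup>,\<^sup>p\<close> for all \<open>p \<ge> 1\<close>, including infinity, where smooth functions
  are not dense.
\<close>

definition is_trace ::
    "real^2 \<Rightarrow> real^2 \<Rightarrow> real^2 \<Rightarrow> (real^2 \<Rightarrow> real) \<Rightarrow> (real^2 \<Rightarrow> real) \<Rightarrow> bool" where
  "is_trace a b c v g \<longleftrightarrow>
     v \<in> sobolev 1 1 (open_triangle a b c) \<and> (\<forall>e\<in>edges a b c. edge_measurable e g) \<and>
     (\<exists>\<phi>::nat \<Rightarrow> real^2 \<Rightarrow> real. (\<forall>n. smooth (\<phi> n)) \<and>
        (\<lambda>n. seminorm 0 1 (open_triangle a b c) (\<lambda>x. \<phi> n x - v x)) \<longlonglongrightarrow> 0 \<and>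
        (\<lambda>n. seminorm 1 1 (open_triangle a b c) (\<lambda>x. \<phi> n x - v x)) \<longlonglongrightarrow> 0 \<and>
        (\<forall>e\<in>edges a b c. (\<lambda>n. edge_L1_norm e (\<lambda>x. \<phi> n x - g x)) \<longlonglongrightarrow> 0))"

text \<open>As with weak derivatives, a representative is chosen.\<close>

definition boundary_trace :: "real^2 \<Rightarrow> real^2 \<Rightarrow> real^2 \<Rightarrow> (real^2 \<Rightarrow> real) \<Rightarrow> real^2 \<Rightarrow> real" where
  "boundary_trace a b c v = (SOME g. is_trace a b c v g)"

subsection \<open>The spaces and the Crouzeix--Raviart interpolation\<close>

definition Phi_space :: "ennreal \<Rightarrow> real^2 \<Rightarrow> real^2 \<Rightarrow> real^2 \<Rightarrow> (real^2 \<Rightarrow> real) set" where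
  "Phi_space p a b c =
    {v \<in> sobolev 1 p (open_triangle a b c). (\<integral>x. v x \<partial>lebesgue_on (open_triangle a b c)) = 0}"

definition E_space :: "ennreal \<Rightarrow> real^2 \<Rightarrow> real^2 \<Rightarrow> real^2 \<Rightarrow> (real^2 \<Rightarrow> real) set" where
  "E_space p a b c =
    {v \<in> sobolev 1 p (open_triangle a b c).
       \<forall>e\<in>edges a b c. edge_integral e (boundary_trace a b c v) = 0}"

text \<open>The zero element of a function space, as the set of all its representatives.\<close>

definition ae_zero :: "real^2 \<Rightarrow> real^2 \<Rightarrow> real^2 \<Rightarrow> (real^2 \<Rightarrow> real) set" where
  "ae_zero a b c = {v. AE x in lebesgue_on (open_triangle a b c). v x = 0}"

definition affine_polys :: "(real^2 \<Rightarrow> real) set" where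
  "affine_polys = {q. \<exists>\<alpha> \<beta> \<gamma>. q = (\<lambda>x. \<alpha> + \<beta> * x $ 1 + \<gamma> * x $ 2)}"

definition CR_interp :: "real^2 \<Rightarrow> real^2 \<Rightarrow> real^2 \<Rightarrow> (real^2 \<Rightarrow> real) \<Rightarrow> real^2 \<Rightarrow> real" where
  "CR_interp a b c v =
    (THE q. q \<in> affine_polys \<and>
       (\<forall>e\<in>edges a b c. edge_integral e (boundary_trace a b c (\<lambda>x. v x - q x)) = 0))"

end

theory Submission
  imports Defs "HOL-Probability.Giry_Monad"
begin

text \<open>The Poincare inequality comes from the pointwise bound
  \<open>\<bar>u x - mean u\<bar> \<le> h * (average of \<bar>\<nabla>u\<bar> along the segments from x to the points of K)\<close>. The
  averaging operator on the right is bounded by 4 on \<open>L\<^sup>1\<close>, hence by Jensen's inequality on every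
  \<open>L\<^sup>p\<close>, whatever the shape of the convex set \<open>K\<close>. The pointwise bound holds for smooth functions and
  passes to \<open>L\<^sup>1\<close> limits; smooth functions are dense because a mollifier composed with a
  contraction of \<open>K\<close> into itself needs no values outside \<open>K\<close>.

  Integrating the derivative of \<open>s\<^sup>2 u(p + s v)\<close> along the rays from a vertex \<open>p\<close> to the opposite edge
  shows that the mean of \<open>u\<close> over this edge is the mean over \<open>K\<close> of \<open>u + \<nabla>u \<bullet> (x - p) / 2\<close>. This
  gives the trace inequality and hence existence and uniqueness of the edge integrals; it bounds the
  mean over \<open>K\<close> by the gradient if an edge mean vanishes, which reduces the second inequality to the
  first; and taking differences between vertices it shows that the gradient has mean zero if all
  three edge means vanish. So the gradient of the interpolation is the mean of \<open>\<nabla>v\<close>, and the error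
  estimates follow from the two inequalities.\<close>

subsection \<open>Bump functions and smooth kernels\<close>

text \<open>Scaling to a reference triangle would cost the norms of the affine map and of its
  inverse, which are unbounded over thin triangles. For this reason every estimate averages over K
  itself and uses only convexity, the diameter and the normalised measure on K. No estimate produces
  a factor that grows with the exponent: a norm bound \<open>c\<close> on L^1 becomes
  \<open>c powr (1 / p)\<close>, at most \<open>c\<close>, and the triangle inequality is used with
  the factor 2 for all exponents. The final constant is therefore a number.

  A second obstacle is that the notions are given by choice: \<open>weak_deriv\<close> and
  \<open>boundary_trace\<close> pick some representative, \<open>CR_interp\<close> is a definite
  description, and functions are only Lebesgue measurable on K. Fubini and push-forwards are carried
  out for Borel functions, so a Sobolev function is replaced by a Borel pair \<open>u\<close>,
  \<open>w\<close> of a function and its gradient, and the edge integral by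
  \<open>edge_mean\<close>, an expression in \<open>u\<close> and \<open>w\<close> in which no trace
  occurs. Once weak derivatives are unique almost everywhere and edge integrals are seen to depend
  on \<open>u\<close> and \<open>w\<close> alone, the choices are harmless.\<close>

definition flat :: "real poly \<Rightarrow> real \<Rightarrow> real" where
  "flat P x = (if 0 < x then poly P (1 / x) * exp (- (1 / x)) else 0)"

lemma poly_mult_exp_minus_tendsto_0:
  "((\<lambda>y::real. poly P y * exp (- y)) \<longlongrightarrow> 0) at_top"
proof -
  have "((\<lambda>y::real. \<Sum>i\<le>degree P. coeff P i * (y ^ i / exp y)) \<longlongrightarrow> (\<Sum>i\<le>degree P. coeff P i * 0)) at_top"
    by (intro tendsto_intros tendsto_power_div_exp_0)
  moreover have "poly P y * exp (- y) = (\<Sum>i\<le>degree P. coeff P i * (y ^ i / exp y))" for y :: real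
    by (simp add: poly_altdef sum_distrib_right sum_distrib_left exp_minus divide_inverse mult_ac)
  ultimately show ?thesis
    by simp
qed

lemma flat_tendsto_0: "(flat P \<longlongrightarrow> 0) (at 0)"
proof -
  have "((\<lambda>x. poly P (inverse x) * exp (- inverse x)) \<longlongrightarrow> 0) (at_right 0)"
    by (rule filterlim_compose[OF poly_mult_exp_minus_tendsto_0 filterlim_inverse_at_top_right])
  then have "(flat P \<longlongrightarrow> 0) (at_right 0)"
    by (rule tendsto_cong[THEN iffD1, rotated])
       (auto simp: flat_def eventually_at_filter divide_inverse)
  moreover have "(flat P \<longlongrightarrow> 0) (at_left 0)"
    by (rule tendsto_eventually) (auto simp: flat_def eventually_at_filter)
  ultimately show ?thesis
    by (simp add: filterlim_split_at)
qed

text \<open>For \<open>x > 0\<close> the product rule gives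
  \<open>(P - P')(1 / x) * (1 / x)^2 * exp (- 1 / x)\<close>, again of the same shape. At 0 the
  difference quotient is \<open>flat\<close> of \<open>X * P\<close>, which tends to 0. Polynomials
  in \<open>1 / x\<close> are thus what makes the family closed under differentiation.\<close>

lemma flat_has_derivative:
  "(flat P has_real_derivative flat ([:0, 0, 1:] * (P - pderiv P)) x) (at x)"
proof -
  consider "x > 0" | "x < 0" | "x = 0" by linarith
  then show ?thesis
  proof cases
    case 1
    have "((\<lambda>x. poly P (1 / x) * exp (- (1 / x))) has_real_derivative
            flat ([:0, 0, 1:] * (P - pderiv P)) x) (at x)"
      using 1 by (auto intro!: derivative_eq_intros simp: flat_def field_simps power2_eq_square)
    then show ?thesis
      by (rule has_field_derivative_transform_within_open[where S = "{0<..}"])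
         (use 1 in \<open>auto simp: flat_def\<close>)
  next
    case 2
    have "((\<lambda>x. 0) has_real_derivative flat ([:0, 0, 1:] * (P - pderiv P)) x) (at x)"
      using 2 by (auto simp: flat_def)
    then show ?thesis
      by (rule has_field_derivative_transform_within_open[where S = "{..<0}"])
         (use 2 in \<open>auto simp: flat_def\<close>)
  next
    case 3
    have "flat P h / h = flat ([:0, 1:] * P) h" for h
      by (simp add: flat_def)
    moreover have "flat P 0 = 0"
      by (simp add: flat_def)
    ultimately have "((\<lambda>h. (flat P (0 + h) - flat P 0) / h) \<longlongrightarrow> 0) (at 0)"
      using flat_tendsto_0[of "[:0, 1:] * P"] by simp
    then show ?thesis
      using 3 by (simp add: DERIV_def flat_def)
  qed
qed

text \<open>Sums are needed only to close the class under differentiation.\<close>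

inductive bump_fun :: "(real \<Rightarrow> real) \<Rightarrow> bool" where
  flat_mult: "bump_fun (\<lambda>x. flat P x * flat Q (1 - x))"
| add: "bump_fun f \<Longrightarrow> bump_fun g \<Longrightarrow> bump_fun (\<lambda>x. f x + g x)"

lemma bump_fun_derivative:
  assumes "bump_fun f"
  obtains f' where "bump_fun f'" "\<And>x. (f has_real_derivative f' x) (at x)"
proof -
  have "\<exists>f'. bump_fun f' \<and> (\<forall>x. (f has_real_derivative f' x) (at x))"
    using assms
  proof induction
    case (flat_mult P Q)
    define P' where "P' = [:0, 0, 1:] * (P - pderiv P)"
    define Q' where "Q' = [:0, 0, 1:] * (Q - pderiv Q)"
    have "flat (- Q') x = - flat Q' x" for x
      by (simp add: flat_def)
    moreover have "((\<lambda>x. flat Q (1 - x)) has_real_derivative - flat Q' (1 - x)) (at x)" for x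
    proof -
      have "((\<lambda>x. 1 - x) has_real_derivative - 1) (at x)"
        by (auto intro!: derivative_eq_intros)
      from DERIV_chain2[of "flat Q" "flat Q' (1 - x)" "\<lambda>x. 1 - x", OF _ this] show ?thesis
        using flat_has_derivative[of Q "1 - x"] by (simp add: Q'_def)
    qed
    ultimately have "((\<lambda>x. flat P x * flat Q (1 - x)) has_real_derivative
        flat P' x * flat Q (1 - x) + flat P x * flat (- Q') (1 - x)) (at x)" for x
      using DERIV_mult[OF flat_has_derivative[of P x, folded P'_def], of "\<lambda>x. flat Q (1 - x)" "- flat Q' (1 - x)"]
      by (simp add: mult.commute)
    then show ?case
      by (intro exI[of _ "\<lambda>x. flat P' x * flat Q (1 - x) + flat P x * flat (- Q') (1 - x)"])
         (auto intro: bump_fun.intros)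
  next
    case (add f g)
    then obtain f' g' where "bump_fun f'" "bump_fun g'"
      "\<And>x. (f has_real_derivative f' x) (at x)" "\<And>x. (g has_real_derivative g' x) (at x)"
      by auto
    then show ?case
      by (intro exI[of _ "\<lambda>x. f' x + g' x"] conjI allI DERIV_add bump_fun.add)
  qed
  then show ?thesis using that by blast
qed

lemma bump_fun_outside: "bump_fun f \<Longrightarrow> x \<notin> {0<..<1} \<Longrightarrow> f x = 0"
  by (induction rule: bump_fun.induct) (auto simp: flat_def)

lemma continuous_on_bump_fun: "bump_fun f \<Longrightarrow> continuous_on S f"
  by (erule bump_fun_derivative) (auto intro!: continuous_at_imp_continuous_on DERIV_isCont)

lemma bump_fun_bounded:
  assumes "bump_fun f"
  obtains M where "M \<ge> 0" "\<And>x. \<bar>f x\<bar> \<le> M"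
proof -
  have "bounded (f ` {0..1})"
    by (intro compact_imp_bounded compact_continuous_image continuous_on_bump_fun assms compact_Icc)
  then obtain M where M: "M > 0" "\<forall>x\<in>{0..1}. \<bar>f x\<bar> \<le> M"
    by (auto simp: bounded_pos)
  have "\<bar>f x\<bar> \<le> M" for x
    using M bump_fun_outside[OF assms, of x] by (cases "x \<in> {0<..<1}") auto
  with M(1) that[of M] show ?thesis by auto
qed

section \<open>Taylor estimates with remainders uniform in the base point\<close>

lemma deriv_bound_lipschitz:
  fixes f :: "real \<Rightarrow> real"
  assumes "\<And>x. (f has_real_derivative f' x) (at x)" "\<And>x. \<bar>f' x\<bar> \<le> M"
  shows "\<bar>f y - f x\<bar> \<le> M * \<bar>y - x\<bar>"
  using field_differentiable_bound[of UNIV f f' M y x] assms by auto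

text \<open>Mean value inequality for \<open>f (x + t) - t * f' x\<close>, whose derivative is at
  most \<open>M * \<bar>h\<bar>\<close> for \<open>\<bar>t\<bar> \<le> \<bar>h\<bar>\<close>. The
  constant \<open>M\<close> instead of \<open>M / 2\<close> is enough, since only its uniformity in
  \<open>x\<close> matters.\<close>

lemma second_deriv_bound_taylor:
  fixes f :: "real \<Rightarrow> real"
  assumes f: "\<And>x. (f has_real_derivative f' x) (at x)" "\<And>x. (f' has_real_derivative f'' x) (at x)"
    and "\<And>x. \<bar>f'' x\<bar> \<le> M"
  shows "\<bar>f (x + h) - f x - h * f' x\<bar> \<le> M * h\<^sup>2"
proof -
  have M: "0 \<le> M" using assms(3)[of 0] by linarith
  have "((\<lambda>t. f (x + t) - t * f' x) has_real_derivative f' (x + t) - f' x) (at t)" for t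
    by (auto intro!: derivative_eq_intros DERIV_chain2[OF f(1)])
  moreover have "\<bar>f' (x + t) - f' x\<bar> \<le> M * \<bar>h\<bar>" if "t \<in> cball 0 \<bar>h\<bar>" for t
  proof -
    have "\<bar>f' (x + t) - f' x\<bar> \<le> M * \<bar>t\<bar>"
      using deriv_bound_lipschitz[of f' f'' M "x + t" x] f(2) assms(3) by simp
    also have "\<dots> \<le> M * \<bar>h\<bar>"
      using that M by (intro mult_left_mono) auto
    finally show ?thesis .
  qed
  ultimately have "\<bar>(f (x + h) - h * f' x) - (f (x + 0) - 0 * f' x)\<bar> \<le> M * \<bar>h\<bar> * \<bar>h - 0\<bar>"
    using field_differentiable_bound[of "cball 0 \<bar>h\<bar>" "\<lambda>t. f (x + t) - t * f' x" "\<lambda>t. f' (x + t) - f' x" "M * \<bar>h\<bar>" h 0]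
    by (auto intro: has_field_derivative_at_within)
  then show ?thesis
    by (simp add: power2_eq_square mult.assoc abs_mult_self algebra_simps)
qed

definition tensor :: "(real \<Rightarrow> real) \<Rightarrow> (real \<Rightarrow> real) \<Rightarrow> real^2 \<Rightarrow> real" where
  "tensor \<alpha> \<beta> x = \<alpha> (x $ 1) * \<beta> (x $ 2)"

text \<open>Because \<open>C\<close> depends neither on \<open>x\<close> nor on \<open>h\<close>,
  the expansion can be integrated against any integrable density; this is differentiation under the
  integral sign.\<close>

lemma tensor_taylor:
  assumes "bump_fun \<alpha>" "bump_fun \<beta>"
    and \<alpha>': "bump_fun \<alpha>'" "\<And>x. (\<alpha> has_real_derivative \<alpha>' x) (at x)"
    and \<beta>': "bump_fun \<beta>'" "\<And>x. (\<beta> has_real_derivative \<beta>' x) (at x)"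
  obtains C where "C \<ge> 0"
    "\<And>x h. \<bar>tensor \<alpha> \<beta> (x + h) - tensor \<alpha> \<beta> x - (h $ 1 * tensor \<alpha>' \<beta> x + h $ 2 * tensor \<alpha> \<beta>' x)\<bar>
        \<le> C * (norm h)\<^sup>2"
proof -
  obtain \<alpha>'' where \<alpha>'': "bump_fun \<alpha>''" "\<And>x. (\<alpha>' has_real_derivative \<alpha>'' x) (at x)"
    using bump_fun_derivative[OF \<alpha>'(1)] by blast
  obtain \<beta>'' where \<beta>'': "bump_fun \<beta>''" "\<And>x. (\<beta>' has_real_derivative \<beta>'' x) (at x)"
    using bump_fun_derivative[OF \<beta>'(1)] by blast
  obtain A where A: "A \<ge> 0" "\<And>x. \<bar>\<alpha> x\<bar> \<le> A" by (metis bump_fun_bounded assms(1))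
  obtain A1 where A1: "A1 \<ge> 0" "\<And>x. \<bar>\<alpha>' x\<bar> \<le> A1" by (metis bump_fun_bounded \<alpha>'(1))
  obtain A2 where A2: "A2 \<ge> 0" "\<And>x. \<bar>\<alpha>'' x\<bar> \<le> A2" by (metis bump_fun_bounded \<alpha>''(1))
  obtain B where B: "B \<ge> 0" "\<And>x. \<bar>\<beta> x\<bar> \<le> B" by (metis bump_fun_bounded assms(2))
  obtain B1 where B1: "B1 \<ge> 0" "\<And>x. \<bar>\<beta>' x\<bar> \<le> B1" by (metis bump_fun_bounded \<beta>'(1))
  obtain B2 where B2: "B2 \<ge> 0" "\<And>x. \<bar>\<beta>'' x\<bar> \<le> B2" by (metis bump_fun_bounded \<beta>''(1))
  have "\<bar>tensor \<alpha> \<beta> (x + h) - tensor \<alpha> \<beta> x - (h $ 1 * tensor \<alpha>' \<beta> x + h $ 2 * tensor \<alpha> \<beta>' x)\<bar>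
        \<le> (A1 * B1 + A2 * B + A * B2) * (norm h)\<^sup>2" for x h :: "real^2"
  proof -
    let ?n = "norm h"
    have h: "\<bar>h $ 1\<bar> \<le> ?n" "\<bar>h $ 2\<bar> \<le> ?n" by (auto intro: component_le_norm_cart)
    then have h2: "(h $ 1)\<^sup>2 \<le> ?n\<^sup>2" "(h $ 2)\<^sup>2 \<le> ?n\<^sup>2"
      by (metis abs_ge_zero power2_abs power_mono)+
    have 1: "\<bar>\<alpha> (x $ 1 + h $ 1) - \<alpha> (x $ 1)\<bar> \<le> A1 * ?n"
      using deriv_bound_lipschitz[OF \<alpha>'(2) A1(2), of "x $ 1 + h $ 1" "x $ 1"] mult_left_mono[OF h(1) A1(1)]
      by simp
    have 2: "\<bar>\<beta> (x $ 2 + h $ 2) - \<beta> (x $ 2)\<bar> \<le> B1 * ?n"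
      using deriv_bound_lipschitz[OF \<beta>'(2) B1(2), of "x $ 2 + h $ 2" "x $ 2"] mult_left_mono[OF h(2) B1(1)]
      by simp
    have 3: "\<bar>\<alpha> (x $ 1 + h $ 1) - \<alpha> (x $ 1) - h $ 1 * \<alpha>' (x $ 1)\<bar> \<le> A2 * ?n\<^sup>2"
      using second_deriv_bound_taylor[OF \<alpha>'(2) \<alpha>''(2) A2(2), of "x $ 1" "h $ 1"] mult_left_mono[OF h2(1) A2(1)]
      by simp
    have 4: "\<bar>\<beta> (x $ 2 + h $ 2) - \<beta> (x $ 2) - h $ 2 * \<beta>' (x $ 2)\<bar> \<le> B2 * ?n\<^sup>2"
      using second_deriv_bound_taylor[OF \<beta>'(2) \<beta>''(2) B2(2), of "x $ 2" "h $ 2"] mult_left_mono[OF h2(2) B2(1)]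
      by simp
    \<comment> \<open>The remainder of a product is the product of the two increments plus each
      one-variable remainder times a value of the other factor; all three terms are of second
      order.\<close>
    have "tensor \<alpha> \<beta> (x + h) - tensor \<alpha> \<beta> x - (h $ 1 * tensor \<alpha>' \<beta> x + h $ 2 * tensor \<alpha> \<beta>' x)
      = (\<alpha> (x $ 1 + h $ 1) - \<alpha> (x $ 1)) * (\<beta> (x $ 2 + h $ 2) - \<beta> (x $ 2))
        + (\<alpha> (x $ 1 + h $ 1) - \<alpha> (x $ 1) - h $ 1 * \<alpha>' (x $ 1)) * \<beta> (x $ 2)
        + \<alpha> (x $ 1) * (\<beta> (x $ 2 + h $ 2) - \<beta> (x $ 2) - h $ 2 * \<beta>' (x $ 2))"
      by (simp add: tensor_def algebra_simps)
    also have "\<bar>\<dots>\<bar> \<le> (A1 * ?n) * (B1 * ?n) + (A2 * ?n\<^sup>2) * B + A * (B2 * ?n\<^sup>2)"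
      by (intro order_trans[OF abs_triangle_ineq] add_mono)
         (auto simp: abs_mult intro!: mult_mono 1 2 3 4 A B mult_nonneg_nonneg A1 A2)
    finally show ?thesis
      by (simp add: algebra_simps power2_eq_square)
  qed
  then show ?thesis
    using that[of "A1 * B1 + A2 * B + A * B2"] A(1) A1(1) A2(1) B(1) B1(1) B2(1) by auto
qed

lemma continuous_on_tensor [continuous_intros]:
  assumes "bump_fun \<alpha>" "bump_fun \<beta>" "continuous_on S f"
  shows "continuous_on S (\<lambda>x. tensor \<alpha> \<beta> (f x))"
proof -
  have "continuous_on UNIV (tensor \<alpha> \<beta>)"
    unfolding tensor_def
    by (intro continuous_intros continuous_on_compose2[OF continuous_on_bump_fun[OF assms(1)]]
        continuous_on_compose2[OF continuous_on_bump_fun[OF assms(2)]]) auto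
  then show ?thesis
    using continuous_on_compose2[OF _ assms(3)] by blast
qed

lemma tensor_bounded:
  assumes "bump_fun \<alpha>" "bump_fun \<beta>"
  obtains M where "M \<ge> 0" "\<And>x. \<bar>tensor \<alpha> \<beta> x\<bar> \<le> M"
proof -
  obtain A where A: "A \<ge> 0" "\<And>x. \<bar>\<alpha> x\<bar> \<le> A" by (metis bump_fun_bounded assms(1))
  obtain B where B: "B \<ge> 0" "\<And>x. \<bar>\<beta> x\<bar> \<le> B" by (metis bump_fun_bounded assms(2))
  have "\<bar>tensor \<alpha> \<beta> x\<bar> \<le> A * B" for x
    unfolding tensor_def abs_mult by (intro mult_mono A B) auto
  then show ?thesis using that[of "A * B"] A(1) B(1) by auto
qed

text \<open>The kernel is kept in the general form with separate scalings of \<open>x\<close> and \<open>z\<close>, so that a point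
  mass \<open>\<nu>\<close> also yields the smoothness of the kernel as a function of either variable.\<close>

definition smear :: "(real^2) measure \<Rightarrow> (real^2 \<Rightarrow> real) \<Rightarrow> (real \<Rightarrow> real) \<Rightarrow> (real \<Rightarrow> real) \<Rightarrow>
    real^2 \<Rightarrow> real \<Rightarrow> real \<Rightarrow> real^2 \<Rightarrow> real" where
  "smear \<nu> f \<alpha> \<beta> q s r x = (\<integral>z. f z * tensor \<alpha> \<beta> (q + s *\<^sub>R z - r *\<^sub>R x) \<partial>\<nu>)"

lemma integrable_mult_bounded:
  fixes f g :: "'a \<Rightarrow> real"
  assumes "integrable M f" "g \<in> borel_measurable M" "\<And>x. \<bar>g x\<bar> \<le> B"
  shows "integrable M (\<lambda>x. f x * g x)"
proof (rule Bochner_Integration.integrable_bound)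
  show "integrable M (\<lambda>x. B * f x)"
    using assms(1) by simp
  show "(\<lambda>x. f x * g x) \<in> borel_measurable M"
    using assms by auto
  have "\<bar>f x * g x\<bar> \<le> \<bar>B * f x\<bar>" for x
    using assms(3)[of x] mult_right_mono[OF assms(3)[of x], of "\<bar>f x\<bar>"] by (simp add: abs_mult mult.commute)
  then show "AE x in M. norm (f x * g x) \<le> norm (B * f x)"
    by simp
qed

lemma integrable_mult_tensor:
  assumes "integrable \<nu> f" "sets \<nu> = sets borel" "bump_fun \<alpha>" "bump_fun \<beta>"
  shows "integrable \<nu> (\<lambda>z. f z * tensor \<alpha> \<beta> (q + s *\<^sub>R z - x))"
proof -
  obtain M where M: "\<And>x. \<bar>tensor \<alpha> \<beta> x\<bar> \<le> M" by (metis tensor_bounded assms(3,4))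
  have "(\<lambda>z. tensor \<alpha> \<beta> (q + s *\<^sub>R z - x)) \<in> borel_measurable borel"
    by (intro borel_measurable_continuous_onI continuous_intros assms)
  then show ?thesis
    using assms M by (intro integrable_mult_bounded[where B=M]) (auto cong: measurable_cong_sets)
qed

lemma integral_combination:
  fixes g\<^sub>0 g\<^sub>1 g\<^sub>2 g\<^sub>3 :: "'a \<Rightarrow> real"
  assumes "integrable M g\<^sub>0" "integrable M g\<^sub>1" "integrable M g\<^sub>2" "integrable M g\<^sub>3"
  shows "(\<integral>z. g\<^sub>0 z - g\<^sub>1 z - (a * g\<^sub>2 z + b * g\<^sub>3 z) \<partial>M) =
    integral\<^sup>L M g\<^sub>0 - integral\<^sup>L M g\<^sub>1 - (a * integral\<^sup>L M g\<^sub>2 + b * integral\<^sup>L M g\<^sub>3)"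
  using assms by simp

text \<open>The second-order remainder of the kernel is bounded uniformly in \<open>z\<close>, so
  integration against \<open>\<bar>f\<bar>\<close> leaves an error \<open>K * (norm h)^2\<close>.
  The chain rule for the argument contributes the factor \<open>- r\<close>.\<close>

lemma smear_has_derivative:
  assumes \<nu>: "integrable \<nu> f" "sets \<nu> = sets borel"
    and "bump_fun \<alpha>" "bump_fun \<beta>"
    and \<alpha>': "bump_fun \<alpha>'" "\<And>x. (\<alpha> has_real_derivative \<alpha>' x) (at x)"
    and \<beta>': "bump_fun \<beta>'" "\<And>x. (\<beta> has_real_derivative \<beta>' x) (at x)"
  shows "(smear \<nu> f \<alpha> \<beta> q s r has_derivative
     (\<lambda>h. h $ 1 * (- r * smear \<nu> f \<alpha>' \<beta> q s r x) + h $ 2 * (- r * smear \<nu> f \<alpha> \<beta>' q s r x))) (at x)"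
proof -
  obtain C where C: "C \<ge> 0"
    "\<And>x h. \<bar>tensor \<alpha> \<beta> (x + h) - tensor \<alpha> \<beta> x - (h $ 1 * tensor \<alpha>' \<beta> x + h $ 2 * tensor \<alpha> \<beta>' x)\<bar>
        \<le> C * (norm h)\<^sup>2"
    by (rule tensor_taylor[where \<alpha>=\<alpha> and \<beta>=\<beta> and \<alpha>'=\<alpha>' and \<beta>'=\<beta>']) (use assms in auto)
  let ?F = "smear \<nu> f \<alpha> \<beta> q s r"
  let ?D = "\<lambda>h::real^2. h $ 1 * (- r * smear \<nu> f \<alpha>' \<beta> q s r x) + h $ 2 * (- r * smear \<nu> f \<alpha> \<beta>' q s r x)"
  define K where "K = C * r\<^sup>2 * (\<integral>z. \<bar>f z\<bar> \<partial>\<nu>)"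
  note int = integrable_mult_tensor[OF \<nu>]
  have bound: "\<bar>?F (x + h) - ?F x - ?D h\<bar> \<le> K * (norm h)\<^sup>2" for h
  proof -
    let ?R = "\<lambda>z. tensor \<alpha> \<beta> (q + s *\<^sub>R z - r *\<^sub>R (x + h)) - tensor \<alpha> \<beta> (q + s *\<^sub>R z - r *\<^sub>R x)
       - (- r * h $ 1 * tensor \<alpha>' \<beta> (q + s *\<^sub>R z - r *\<^sub>R x) - r * h $ 2 * tensor \<alpha> \<beta>' (q + s *\<^sub>R z - r *\<^sub>R x))"
    have eq: "f z * ?R z = f z * tensor \<alpha> \<beta> (q + s *\<^sub>R z - r *\<^sub>R (x + h)) - f z * tensor \<alpha> \<beta> (q + s *\<^sub>R z - r *\<^sub>R x)
       - ((- r * h $ 1) * (f z * tensor \<alpha>' \<beta> (q + s *\<^sub>R z - r *\<^sub>R x))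
          + (- r * h $ 2) * (f z * tensor \<alpha> \<beta>' (q + s *\<^sub>R z - r *\<^sub>R x)))" for z
      by (simp add: algebra_simps)
    have intR: "integrable \<nu> (\<lambda>z. f z * ?R z)"
      unfolding eq by (intro Bochner_Integration.integrable_diff Bochner_Integration.integrable_add
          integrable_mult_right int assms)
    have "?F (x + h) - ?F x - ?D h = ?F (x + h) - ?F x
        - ((- r * h $ 1) * smear \<nu> f \<alpha>' \<beta> q s r x + (- r * h $ 2) * smear \<nu> f \<alpha> \<beta>' q s r x)"
      by simp
    also have "\<dots> = (\<integral>z. f z * ?R z \<partial>\<nu>)"
      unfolding smear_def eq by (rule integral_combination[symmetric]) (intro int assms)+
    finally have "\<bar>?F (x + h) - ?F x - ?D h\<bar> \<le> (\<integral>z. \<bar>f z * ?R z\<bar> \<partial>\<nu>)"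
      by (simp only: integral_abs_bound)
    also have "\<dots> \<le> (\<integral>z. (C * (norm (r *\<^sub>R h))\<^sup>2) * \<bar>f z\<bar> \<partial>\<nu>)"
    proof (rule integral_mono)
      fix z
      have "q + s *\<^sub>R z - r *\<^sub>R (x + h) = (q + s *\<^sub>R z - r *\<^sub>R x) + - (r *\<^sub>R h)"
        by (simp add: scaleR_add_right)
      then have "\<bar>?R z\<bar> \<le> C * (norm (r *\<^sub>R h))\<^sup>2"
        using C(2)[of "q + s *\<^sub>R z - r *\<^sub>R x" "- (r *\<^sub>R h)"] by (simp only:) simp
      then show "\<bar>f z * ?R z\<bar> \<le> (C * (norm (r *\<^sub>R h))\<^sup>2) * \<bar>f z\<bar>"
        unfolding abs_mult by (subst mult.commute) (rule mult_right_mono, simp_all)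
    qed (use intR \<nu> in auto)
    also have "\<dots> = K * (norm h)\<^sup>2"
      by (simp add: K_def power_mult_distrib)
    finally show ?thesis .
  qed
  have "bounded_linear ?D"
    by (intro bounded_linear_intros bounded_linear_vec_nth)
  moreover have "((\<lambda>h. norm (?F (x + h) - ?F x - ?D h) / norm h) \<longlongrightarrow> 0) (at 0)"
  proof (rule Lim_null_comparison)
    show "\<forall>\<^sub>F h in at 0. norm (norm (?F (x + h) - ?F x - ?D h) / norm h) \<le> K * norm h"
      using bound by (auto intro!: always_eventually simp: divide_le_eq power2_eq_square mult.assoc)
    show "((\<lambda>h::real^2. K * norm h) \<longlongrightarrow> 0) (at 0)"
      by (intro tendsto_mult_right_zero tendsto_norm_zero tendsto_ident_at)
  qed
  ultimately show ?thesis
    unfolding has_derivative_at by simp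
qed

lemma partial_deriv_eq:
  assumes "(f has_derivative f') (at x)"
  shows "partial_deriv i f x = f' (axis i 1)"
  unfolding partial_deriv_def using frechet_derivative_at[OF assms] by simp

text \<open>Both partial derivatives are smears again, with one factor of the tensor differentiated
  and the scalar multiplied by \<open>- r\<close>. Hence the induction runs over all
  \<open>c\<close>, \<open>\<alpha>\<close> and \<open>\<beta>\<close> at once.\<close>

lemma C_k_smear:
  assumes \<nu>: "integrable \<nu> f" "sets \<nu> = sets borel"
    and "bump_fun \<alpha>" "bump_fun \<beta>"
  shows "C_k k (\<lambda>x. c * smear \<nu> f \<alpha> \<beta> q s r x)"
  using assms(3,4)
proof (induction k arbitrary: c \<alpha> \<beta>)
  case (0 c \<alpha> \<beta>)
  obtain \<alpha>' where \<alpha>': "bump_fun \<alpha>'" "\<And>x. (\<alpha> has_real_derivative \<alpha>' x) (at x)"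
    using bump_fun_derivative 0(1) by blast
  obtain \<beta>' where \<beta>': "bump_fun \<beta>'" "\<And>x. (\<beta> has_real_derivative \<beta>' x) (at x)"
    using bump_fun_derivative 0(2) by blast
  have "continuous_on UNIV (smear \<nu> f \<alpha> \<beta> q s r)"
    using has_derivative_continuous[OF smear_has_derivative[OF \<nu> 0 \<alpha>' \<beta>']]
    by (auto intro: continuous_at_imp_continuous_on)
  then show ?case
    by (auto intro!: continuous_intros)
next
  case (Suc k c \<alpha> \<beta>)
  obtain \<alpha>' where \<alpha>': "bump_fun \<alpha>'" "\<And>x. (\<alpha> has_real_derivative \<alpha>' x) (at x)"
    using bump_fun_derivative Suc.prems(1) by blast
  obtain \<beta>' where \<beta>': "bump_fun \<beta>'" "\<And>x. (\<beta> has_real_derivative \<beta>' x) (at x)"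
    using bump_fun_derivative Suc.prems(2) by blast
  let ?f = "\<lambda>x. c * smear \<nu> f \<alpha> \<beta> q s r x"
  have D: "(?f has_derivative (\<lambda>h. c * (h $ 1 * (- r * smear \<nu> f \<alpha>' \<beta> q s r x)
      + h $ 2 * (- r * smear \<nu> f \<alpha> \<beta>' q s r x)))) (at x)" for x
    by (intro has_derivative_mult_right smear_has_derivative \<nu> Suc.prems \<alpha>' \<beta>')
  have "partial_deriv 1 ?f = (\<lambda>x. (- r * c) * smear \<nu> f \<alpha>' \<beta> q s r x)"
    unfolding partial_deriv_eq[OF D, abs_def] by (simp add: axis_def mult_ac)
  then have 1: "C_k k (partial_deriv 1 ?f)"
    using Suc.IH[OF \<alpha>'(1) Suc.prems(2), of "- r * c"] by (simp only:)
  have "partial_deriv 2 ?f = (\<lambda>x. (- r * c) * smear \<nu> f \<alpha> \<beta>' q s r x)"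
    unfolding partial_deriv_eq[OF D, abs_def] by (simp add: axis_def mult_ac)
  then have 2: "C_k k (partial_deriv 2 ?f)"
    using Suc.IH[OF Suc.prems(1) \<beta>'(1), of "- r * c"] by (simp only:)
  show ?case
    unfolding C_k.simps forall_2 using 1 2 D by (blast intro: differentiableI)
qed

lemma smooth_smear:
  assumes "integrable \<nu> f" "sets \<nu> = sets borel" "bump_fun \<alpha>" "bump_fun \<beta>"
  shows "smooth (\<lambda>x. c * smear \<nu> f \<alpha> \<beta> q s r x)"
  using C_k_smear[OF assms] by (simp add: smooth_def)

lemma smear_return: "smear (return borel 0) (\<lambda>_. 1) \<alpha> \<beta> q s r x = tensor \<alpha> \<beta> (q - r *\<^sub>R x)"
  if "bump_fun \<alpha>" "bump_fun \<beta>"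
proof -
  have [measurable]: "(\<lambda>z. tensor \<alpha> \<beta> (q + s *\<^sub>R z - r *\<^sub>R x)) \<in> borel_measurable borel"
    by (intro borel_measurable_continuous_onI continuous_intros that)
  show ?thesis
    by (simp add: smear_def integral_return)
qed

lemma smooth_tensor:
  assumes "bump_fun \<alpha>" "bump_fun \<beta>"
  shows "smooth (\<lambda>z. c * tensor \<alpha> \<beta> (s *\<^sub>R z - q))"
proof -
  have "integrable (return borel (0::real^2)) (\<lambda>_. 1::real)"
    using prob_space.emeasure_space_1[OF prob_space_return[of "0::real^2" borel]]
    by (intro finite_measure.integrable_const prob_space.finite_measure prob_space_return) auto
  \<comment> \<open>Under the point mass at 0 the integration variable is 0, so its scaling factor
    is irrelevant, and \<open>- s\<close> in the place of \<open>r\<close> restores the sign in the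
    argument.\<close>
  then show ?thesis
    using smooth_smear[of "return borel 0" "\<lambda>_. 1" \<alpha> \<beta> c "- q" 0 "- s"] assms
    by (simp add: smear_return)
qed

lemma tensor_has_derivative:
  assumes "bump_fun \<alpha>" "bump_fun \<beta>"
    and \<alpha>': "bump_fun \<alpha>'" "\<And>x. (\<alpha> has_real_derivative \<alpha>' x) (at x)"
    and \<beta>': "bump_fun \<beta>'" "\<And>x. (\<beta> has_real_derivative \<beta>' x) (at x)"
  shows "((\<lambda>z. tensor \<alpha> \<beta> (s *\<^sub>R z - q)) has_derivative
     (\<lambda>h. h $ 1 * (s * tensor \<alpha>' \<beta> (s *\<^sub>R x - q)) + h $ 2 * (s * tensor \<alpha> \<beta>' (s *\<^sub>R x - q)))) (at x)"
proof -
  have "integrable (return borel (0::real^2)) (\<lambda>_. 1::real)"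
    using prob_space.emeasure_space_1[OF prob_space_return[of "0::real^2" borel]]
    by (intro finite_measure.integrable_const prob_space.finite_measure prob_space_return) auto
  from smear_has_derivative[OF this _ assms, of "- q" 0 "- s" x]
  show ?thesis
    by (simp add: smear_return[OF assms(1,2), abs_def] smear_return[OF assms(1) \<beta>'(1)] smear_return[OF \<alpha>'(1) assms(2)])
qed

subsection \<open>Test functions and integration by parts\<close>

text \<open>By translation invariance the integral of \<open>G\<close> equals its average over the
  translates by \<open>t *\<^sub>R e\<close> with \<open>t\<close> in the unit interval. Fubini and
  the fundamental theorem turn this into the integral of \<open>F (x + e) - F x\<close>, which is 0
  by translation invariance again.\<close>

lemma integral_directional_derivative_eq_0:
  fixes F G :: "'a::euclidean_space \<Rightarrow> real"
  assumes D: "\<And>x t. ((\<lambda>t. F (x + t *\<^sub>R e)) has_real_derivative G (x + t *\<^sub>R e)) (at t)"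
    and contF: "continuous_on UNIV F" and contG: "continuous_on UNIV G"
    and S: "compact S" "\<And>x. x \<notin> S \<Longrightarrow> F x = 0" "\<And>x. x \<notin> S \<Longrightarrow> G x = 0"
  shows "(\<integral>x. G x \<partial>lborel) = 0"
proof -
  have [measurable]: "F \<in> borel_measurable borel" "G \<in> borel_measurable borel"
    using contF contG by (auto intro: borel_measurable_continuous_onI)
  have intF: "integrable lborel F"
  proof -
    have "(\<lambda>x. indicator S x *\<^sub>R F x) = F"
      using S(2) by (auto simp: fun_eq_iff indicator_def)
    then show ?thesis
      using borel_integrable_compact[OF S(1), of F] continuous_on_subset[OF contF] by simp
  qed
  \<comment> \<open>All \<open>x\<close> for which some \<open>x + t *\<^sub>R e\<close> with
    \<open>t\<close> in the unit interval meets \<open>S\<close> lie in this compact set; this gives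
    the joint integrability required by Fubini.\<close>
  define S' where "S' = (\<lambda>(x, t). x - t *\<^sub>R e) ` (S \<times> {0..1::real})"
  have S': "compact S'"
    unfolding S'_def by (intro compact_continuous_image compact_Times S compact_Icc)
       (auto simp: case_prod_unfold intro!: continuous_intros)
  let ?H = "\<lambda>p. indicator {0..1} (snd p) * G (fst p + snd p *\<^sub>R e)"
  have "?H p = indicator (S' \<times> {0..1}) p *\<^sub>R G (fst p + snd p *\<^sub>R e)" for p
  proof (cases "fst p + snd p *\<^sub>R e \<in> S \<and> snd p \<in> {0..1}")
    case True
    then have "fst p \<in> S'"
      unfolding S'_def by (intro image_eqI[of _ _ "(fst p + snd p *\<^sub>R e, snd p)"]) auto
    with True show ?thesis
      by (cases p) (auto simp: indicator_def)
  next
    case False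
    then show ?thesis
      using S(3)[of "fst p + snd p *\<^sub>R e"] by (cases p) (auto simp: indicator_def)
  qed
  moreover have "integrable lborel (\<lambda>p. indicator (S' \<times> {0..1}) p *\<^sub>R G (fst p + snd p *\<^sub>R e))"
    by (intro borel_integrable_compact compact_Times S' compact_Icc continuous_on_compose2[OF contG])
       (auto intro!: continuous_intros)
  ultimately have int: "integrable (lborel \<Otimes>\<^sub>M lborel) ?H"
    by (simp only: lborel_prod)
  have translate: "(\<integral>x. f (x + v) \<partial>lborel) = (\<integral>x. f x \<partial>lborel)"
    if "f \<in> borel_measurable borel" for f :: "'a \<Rightarrow> real" and v
    using that integral_distr[of "(+) v" lborel borel f] by (simp add: lborel_distr_plus add.commute)
  have "(\<integral>x. G x \<partial>lborel) = (\<integral>t. indicator {0..1::real} t * (\<integral>x. G x \<partial>lborel) \<partial>lborel)"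
    by simp
  also have "\<dots> = (\<integral>t. (\<integral>x. ?H (x, t) \<partial>lborel) \<partial>lborel)"
    by (simp add: translate)
  also have "\<dots> = (\<integral>x. (\<integral>t. ?H (x, t) \<partial>lborel) \<partial>lborel)"
    by (rule lborel_pair.Fubini_integral) (use int in \<open>simp only: case_prod_unfold prod.collapse\<close>)
  also have "\<dots> = (\<integral>x. F (x + e) - F x \<partial>lborel)"
  proof (rule Bochner_Integration.integral_cong[OF refl])
    fix x
    have "isCont (\<lambda>t. G (x + t *\<^sub>R e)) t" for t
      using continuous_on_compose2[OF contG, of UNIV "\<lambda>t::real. x + t *\<^sub>R e"]
      by (auto simp: continuous_on_eq_continuous_at intro!: continuous_intros)
    then have "(\<integral>t. G (x + t *\<^sub>R e) * indicator {0..1} t \<partial>lborel) = F (x + 1 *\<^sub>R e) - F (x + 0 *\<^sub>R e)"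
      by (intro integral_FTC_Icc_real D) auto
    then show "(\<integral>t. ?H (x, t) \<partial>lborel) = F (x + e) - F x"
      by (simp add: mult.commute)
  qed
  also have "\<dots> = (\<integral>x. F (x + e) \<partial>lborel) - (\<integral>x. F x \<partial>lborel)"
  proof (rule Bochner_Integration.integral_diff[OF _ intF])
    show "integrable lborel (\<lambda>x. F (x + e))"
      using intF integrable_distr[of "(+) e" lborel borel F] by (simp add: lborel_distr_plus add.commute)
  qed
  also have "\<dots> = 0"
    by (simp add: translate)
  finally show ?thesis .
qed

section \<open>Smooth functions, test functions and integration by parts\<close>

lemma smooth_has_derivative:
  assumes "smooth \<phi>"
  shows "(\<phi> has_derivative (\<lambda>h. h $ 1 * partial_deriv 1 \<phi> x + h $ 2 * partial_deriv 2 \<phi> x)) (at x)"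
proof -
  have "C_k 1 \<phi>" using assms by (simp add: smooth_def)
  then have d: "(\<phi> has_derivative frechet_derivative \<phi> (at x)) (at x)"
    by (simp add: frechet_derivative_works[symmetric])
  interpret linear "frechet_derivative \<phi> (at x)"
    using d by (rule has_derivative_linear)
  have "frechet_derivative \<phi> (at x) h = h $ 1 * partial_deriv 1 \<phi> x + h $ 2 * partial_deriv 2 \<phi> x" for h
  proof -
    have "h = h $ 1 *\<^sub>R axis 1 1 + h $ 2 *\<^sub>R axis 2 (1::real)"
      by (simp add: vec_eq_iff forall_2 axis_def)
    then have "frechet_derivative \<phi> (at x) h = frechet_derivative \<phi> (at x) (h $ 1 *\<^sub>R axis 1 1 + h $ 2 *\<^sub>R axis 2 1)"
      by simp
    then show ?thesis
      by (simp add: add scale partial_deriv_def)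
  qed
  then have "frechet_derivative \<phi> (at x) = (\<lambda>h. h $ 1 * partial_deriv 1 \<phi> x + h $ 2 * partial_deriv 2 \<phi> x)"
    by auto
  with d show ?thesis by simp
qed

lemma smooth_partial_deriv: "smooth \<phi> \<Longrightarrow> smooth (partial_deriv i \<phi>)"
  unfolding smooth_def by (meson C_k.simps(2))

lemma smooth_continuous_on: "smooth \<phi> \<Longrightarrow> continuous_on S \<phi>"
  unfolding smooth_def by (metis C_k.simps(1) continuous_on_subset subset_UNIV)

lemma smooth_measurable: "smooth \<phi> \<Longrightarrow> \<phi> \<in> borel_measurable borel"
  by (intro borel_measurable_continuous_onI smooth_continuous_on)

lemma smooth_has_real_derivative_axis:
  assumes "smooth \<phi>"
  shows "((\<lambda>t. \<phi> (x + t *\<^sub>R axis i 1)) has_real_derivative partial_deriv i \<phi> (x + t *\<^sub>R axis i 1)) (at t)"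
proof -
  have "((\<lambda>t. x + t *\<^sub>R axis i 1) has_derivative (\<lambda>s. s *\<^sub>R axis i 1)) (at t)"
    by (auto intro!: derivative_eq_intros)
  from has_derivative_compose[OF this smooth_has_derivative[OF assms]]
  have "((\<lambda>t. \<phi> (x + t *\<^sub>R axis i 1)) has_derivative
     (\<lambda>s. s * partial_deriv i \<phi> (x + t *\<^sub>R axis i 1))) (at t)"
    using exhaust_2[of i] by (auto simp: axis_def)
  then show ?thesis
    by (simp add: has_field_derivative_def mult_commute_abs)
qed

text \<open>Two applications of the mean value theorem, first in direction \<open>i\<close> and then
  in direction \<open>j\<close>. The left side is symmetric in \<open>i\<close> and
  \<open>j\<close>, which is the source of the symmetry of second derivatives.\<close>

lemma partial_deriv_mixed_difference:
  assumes "smooth \<phi>" "0 < h"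
  obtains s t where "0 < s" "s < h" "0 < t" "t < h"
    "\<phi> (x + h *\<^sub>R axis i 1 + h *\<^sub>R axis j 1) - \<phi> (x + h *\<^sub>R axis i 1) - \<phi> (x + h *\<^sub>R axis j 1) + \<phi> x
     = h\<^sup>2 * partial_deriv j (partial_deriv i \<phi>) (x + s *\<^sub>R axis i 1 + t *\<^sub>R axis j 1)"
proof -
  let ?i = "axis i (1::real)" and ?j = "axis j (1::real)"
  let ?p = "\<lambda>s. \<phi> (x + h *\<^sub>R ?j + s *\<^sub>R ?i) - \<phi> (x + s *\<^sub>R ?i)"
  have "\<exists>s. 0 < s \<and> s < h \<and> ?p h - ?p 0 = (h - 0) *
      (partial_deriv i \<phi> (x + h *\<^sub>R ?j + s *\<^sub>R ?i) - partial_deriv i \<phi> (x + s *\<^sub>R ?i))"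
    by (rule MVT2) (use assms in \<open>auto intro!: DERIV_diff smooth_has_real_derivative_axis\<close>)
  then obtain s where s: "0 < s" "s < h" "?p h - ?p 0 = h *
      (partial_deriv i \<phi> (x + h *\<^sub>R ?j + s *\<^sub>R ?i) - partial_deriv i \<phi> (x + s *\<^sub>R ?i))"
    by auto
  let ?q = "\<lambda>t. partial_deriv i \<phi> (x + s *\<^sub>R ?i + t *\<^sub>R ?j)"
  have "\<exists>t. 0 < t \<and> t < h \<and> ?q h - ?q 0 = (h - 0) *
      partial_deriv j (partial_deriv i \<phi>) (x + s *\<^sub>R ?i + t *\<^sub>R ?j)"
    by (rule MVT2) (use assms in \<open>auto intro!: smooth_has_real_derivative_axis smooth_partial_deriv\<close>)
  then obtain t where t: "0 < t" "t < h" "?q h - ?q 0 = h *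
      partial_deriv j (partial_deriv i \<phi>) (x + s *\<^sub>R ?i + t *\<^sub>R ?j)"
    by auto
  have "x + h *\<^sub>R ?j + s *\<^sub>R ?i = x + s *\<^sub>R ?i + h *\<^sub>R ?j" "x + h *\<^sub>R ?j + h *\<^sub>R ?i = x + h *\<^sub>R ?i + h *\<^sub>R ?j"
    by simp_all
  with s(3) t(3) have "\<phi> (x + h *\<^sub>R ?i + h *\<^sub>R ?j) - \<phi> (x + h *\<^sub>R ?i) - \<phi> (x + h *\<^sub>R ?j) + \<phi> x
     = h\<^sup>2 * partial_deriv j (partial_deriv i \<phi>) (x + s *\<^sub>R ?i + t *\<^sub>R ?j)"
    by (simp add: power2_eq_square)
  with s t that show ?thesis by blast
qed

text \<open>The same second difference is evaluated in both orders with steps tending to 0, and the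
  second derivatives are continuous. The symmetry is needed because a multi-index fixes the order of
  differentiation, while derivatives of a weak gradient arise in either order.\<close>

lemma partial_deriv_commute:
  assumes "smooth \<phi>"
  shows "partial_deriv i (partial_deriv j \<phi>) x = partial_deriv j (partial_deriv i \<phi>) x"
proof -
  let ?i = "axis i (1::real)" and ?j = "axis j (1::real)"
  define d where "d n = 1 / real (Suc n)" for n
  have d: "d n > 0" for n by (simp add: d_def)
  have d0: "d \<longlonglongrightarrow> 0"
    unfolding d_def using LIMSEQ_inverse_real_of_nat by (simp add: inverse_eq_divide)
  have "\<exists>s t s' t'. (0 < s \<and> s < d n) \<and> (0 < t \<and> t < d n) \<and> (0 < s' \<and> s' < d n) \<and> (0 < t' \<and> t' < d n) \<and>
     partial_deriv j (partial_deriv i \<phi>) (x + s *\<^sub>R ?i + t *\<^sub>R ?j) =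
     partial_deriv i (partial_deriv j \<phi>) (x + s' *\<^sub>R ?j + t' *\<^sub>R ?i)" for n
  proof -
    obtain s t where st: "0 < s" "s < d n" "0 < t" "t < d n"
      "\<phi> (x + d n *\<^sub>R ?i + d n *\<^sub>R ?j) - \<phi> (x + d n *\<^sub>R ?i) - \<phi> (x + d n *\<^sub>R ?j) + \<phi> x
        = (d n)\<^sup>2 * partial_deriv j (partial_deriv i \<phi>) (x + s *\<^sub>R ?i + t *\<^sub>R ?j)"
      using partial_deriv_mixed_difference[OF assms d] .
    obtain s' t' where st': "0 < s'" "s' < d n" "0 < t'" "t' < d n"
      "\<phi> (x + d n *\<^sub>R ?j + d n *\<^sub>R ?i) - \<phi> (x + d n *\<^sub>R ?j) - \<phi> (x + d n *\<^sub>R ?i) + \<phi> x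
        = (d n)\<^sup>2 * partial_deriv i (partial_deriv j \<phi>) (x + s' *\<^sub>R ?j + t' *\<^sub>R ?i)"
      using partial_deriv_mixed_difference[OF assms d] .
    have "\<phi> (x + d n *\<^sub>R ?j + d n *\<^sub>R ?i) = \<phi> (x + d n *\<^sub>R ?i + d n *\<^sub>R ?j)"
      by (simp add: add.assoc add.commute[of "d n *\<^sub>R ?i"])
    with st(5) st'(5) have "(d n)\<^sup>2 * partial_deriv j (partial_deriv i \<phi>) (x + s *\<^sub>R ?i + t *\<^sub>R ?j)
        = (d n)\<^sup>2 * partial_deriv i (partial_deriv j \<phi>) (x + s' *\<^sub>R ?j + t' *\<^sub>R ?i)"
      by linarith
    then show ?thesis
      using st st' d[of n] by auto
  qed
  then obtain s t s' t' where st: "\<And>n. 0 < s n \<and> s n < d n" "\<And>n. 0 < t n \<and> t n < d n"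
      "\<And>n. 0 < s' n \<and> s' n < d n" "\<And>n. 0 < t' n \<and> t' n < d n"
    and eq: "\<And>n. partial_deriv j (partial_deriv i \<phi>) (x + s n *\<^sub>R ?i + t n *\<^sub>R ?j) =
     partial_deriv i (partial_deriv j \<phi>) (x + s' n *\<^sub>R ?j + t' n *\<^sub>R ?i)"
    by metis
  have lim0: "r \<longlonglongrightarrow> 0" if "\<And>n. 0 < r n \<and> r n < d n" for r
    by (rule tendsto_sandwich[OF _ _ tendsto_const d0])
       (use that in \<open>auto intro!: always_eventually less_imp_le\<close>)
  have "(\<lambda>n. partial_deriv j (partial_deriv i \<phi>) (x + s n *\<^sub>R ?i + t n *\<^sub>R ?j))
      \<longlonglongrightarrow> partial_deriv j (partial_deriv i \<phi>) (x + 0 *\<^sub>R ?i + 0 *\<^sub>R ?j)"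
    by (rule continuous_on_tendsto_compose[OF smooth_continuous_on[where S=UNIV]])
       (auto intro!: smooth_partial_deriv assms tendsto_add[OF tendsto_add[OF tendsto_const]] tendsto_scaleR lim0 st tendsto_const simp del: scaleR_zero_left add_0_right)
  moreover have "(\<lambda>n. partial_deriv i (partial_deriv j \<phi>) (x + s' n *\<^sub>R ?j + t' n *\<^sub>R ?i))
      \<longlonglongrightarrow> partial_deriv i (partial_deriv j \<phi>) (x + 0 *\<^sub>R ?j + 0 *\<^sub>R ?i)"
    by (rule continuous_on_tendsto_compose[OF smooth_continuous_on[where S=UNIV]])
       (auto intro!: smooth_partial_deriv assms tendsto_add[OF tendsto_add[OF tendsto_const]] tendsto_scaleR lim0 st tendsto_const simp del: scaleR_zero_left add_0_right)
  ultimately show ?thesis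
    using eq by (simp add: LIMSEQ_unique)
qed

lemma test_functionsE:
  assumes "\<phi> \<in> test_functions K"
  obtains S where "smooth \<phi>" "compact S" "S \<subseteq> K" "\<And>x. x \<notin> S \<Longrightarrow> \<phi> x = 0"
    "\<And>x i. x \<notin> S \<Longrightarrow> partial_deriv i \<phi> x = 0"
proof -
  let ?S = "closure {x. \<phi> x \<noteq> 0}"
  have *: "smooth \<phi>" "compact ?S" "?S \<subseteq> K"
    using assms by (auto simp: test_functions_def)
  have "partial_deriv i \<phi> x = 0" if "x \<notin> ?S" for x i
  proof -
    have "((\<lambda>x. 0) has_derivative (\<lambda>x. 0)) (at x)"
      by simp
    then have "(\<phi> has_derivative (\<lambda>x. 0)) (at x)"
      by (rule has_derivative_transform_within_open[where s="- ?S"])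
         (use that closure_subset[of "{x. \<phi> x \<noteq> 0}"] in auto)
    then show ?thesis
      by (rule partial_deriv_eq)
  qed
  moreover have "\<phi> x = 0" if "x \<notin> ?S" for x
    using that closure_subset[of "{x. \<phi> x \<noteq> 0}"] by auto
  ultimately show ?thesis
    using that * by blast
qed

lemma test_functionsI:
  assumes "smooth \<phi>" "compact S" "S \<subseteq> K" "\<And>x. x \<notin> S \<Longrightarrow> \<phi> x = 0"
  shows "\<phi> \<in> test_functions K"
proof -
  have "closure {x. \<phi> x \<noteq> 0} \<subseteq> S"
    using assms(2,4) by (intro closure_minimal) (auto simp: compact_imp_closed)
  then show ?thesis
    using assms compact_Int_closed[OF assms(2) closed_closure, of "{x. \<phi> x \<noteq> 0}"]
    by (auto simp: test_functions_def Int_absorb1 simp del: compact_closure)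
qed

lemma partial_deriv_test_functions:
  assumes "\<phi> \<in> test_functions K"
  shows "partial_deriv i \<phi> \<in> test_functions K"
  using assms by (elim test_functionsE) (rule test_functionsI[OF smooth_partial_deriv])

lemma test_functions_mono: "K \<subseteq> L \<Longrightarrow> test_functions K \<subseteq> test_functions L"
  by (auto simp: test_functions_def)

text \<open>The vanishing integral of a directional derivative, applied to
  \<open>f * \<phi>\<close>, which inherits compact support from \<open>\<phi>\<close>.\<close>

lemma integral_by_parts_test_function:
  assumes "smooth f" "\<phi> \<in> test_functions K"
  shows "(\<integral>x. f x * partial_deriv i \<phi> x \<partial>lborel) = - (\<integral>x. partial_deriv i f x * \<phi> x \<partial>lborel)"
proof -
  obtain S where \<phi>: "smooth \<phi>" "compact S" "\<And>x. x \<notin> S \<Longrightarrow> \<phi> x = 0"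
    "\<And>x i. x \<notin> S \<Longrightarrow> partial_deriv i \<phi> x = 0"
    using test_functionsE[OF assms(2)] by metis
  have int: "integrable lborel (\<lambda>x. g x * h x)"
    if "smooth g" "smooth h" "\<And>x. x \<notin> S \<Longrightarrow> h x = 0" for g h :: "real^2 \<Rightarrow> real"
  proof -
    have "(\<lambda>x. indicator S x *\<^sub>R (g x * h x)) = (\<lambda>x. g x * h x)"
      using that(3) by (auto simp: fun_eq_iff indicator_def)
    then show ?thesis
      using borel_integrable_compact[OF \<phi>(2), of "\<lambda>x. g x * h x"] that
      by (auto intro: continuous_intros smooth_continuous_on)
  qed
  have "(\<integral>x. f x * partial_deriv i \<phi> x + partial_deriv i f x * \<phi> x \<partial>lborel) = 0"
  proof (rule integral_directional_derivative_eq_0[where F="\<lambda>x. f x * \<phi> x" and e="axis i 1" and S=S])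
    show "((\<lambda>t. f (x + t *\<^sub>R axis i 1) * \<phi> (x + t *\<^sub>R axis i 1)) has_real_derivative
       f (x + t *\<^sub>R axis i 1) * partial_deriv i \<phi> (x + t *\<^sub>R axis i 1)
       + partial_deriv i f (x + t *\<^sub>R axis i 1) * \<phi> (x + t *\<^sub>R axis i 1)) (at t)" for x t
      using DERIV_mult[OF smooth_has_real_derivative_axis[OF assms(1), of x i t] smooth_has_real_derivative_axis[OF \<phi>(1), of x i t]]
      by (simp add: algebra_simps)
    show "continuous_on UNIV (\<lambda>x. f x * \<phi> x)"
      by (intro continuous_on_mult smooth_continuous_on assms \<phi>(1))
    show "continuous_on UNIV (\<lambda>x. f x * partial_deriv i \<phi> x + partial_deriv i f x * \<phi> x)"
      by (intro continuous_on_add continuous_on_mult smooth_continuous_on smooth_partial_deriv assms \<phi>(1))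
  qed (use \<phi> in auto)
  moreover have "integrable lborel (\<lambda>x. f x * partial_deriv i \<phi> x)" "integrable lborel (\<lambda>x. partial_deriv i f x * \<phi> x)"
    by (rule int; use \<phi> assms(1) in \<open>auto intro: smooth_partial_deriv\<close>)+
  ultimately show ?thesis
    by simp
qed

subsection \<open>Averages over a bounded convex domain\<close>

lemma nn_integral_lborel_affine:
  fixes t :: "'a::euclidean_space"
  assumes "c \<noteq> 0" and [measurable]: "f \<in> borel_measurable borel"
  shows "(\<integral>\<^sup>+x. f x \<partial>lborel) = ennreal (\<bar>c\<bar> ^ DIM('a)) * (\<integral>\<^sup>+x. f (t + c *\<^sub>R x) \<partial>lborel)"
  by (subst lborel_affine[OF assms(1), of t])
     (simp add: nn_integral_density nn_integral_distr nn_integral_cmult)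

lemma integral_lborel_affine:
  fixes t :: "'a::euclidean_space" and f :: "'a \<Rightarrow> real"
  assumes "c \<noteq> 0" and [measurable]: "f \<in> borel_measurable borel"
  shows "(\<integral>x. f x \<partial>lborel) = \<bar>c\<bar> ^ DIM('a) * (\<integral>x. f (t + c *\<^sub>R x) \<partial>lborel)"
  by (subst lborel_affine[OF assms(1), of t])
     (simp add: integral_density integral_distr)

lemma ennreal_le_plus:
  "x \<le> a + (b + c) \<Longrightarrow> 0 \<le> a \<Longrightarrow> 0 \<le> b \<Longrightarrow> 0 \<le> c \<Longrightarrow> ennreal x \<le> ennreal a + (ennreal b + ennreal c)"
  by (simp flip: ennreal_plus)

text \<open>Stated for convex domains since, besides triangles, the boxes contained in a domain
  serve as instances. The normalised measure \<open>\<mu>\<close> keeps means and averages free of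
  the volume and is a probability space, as Jensen's inequality requires.\<close>

locale convex_domain =
  fixes K :: "(real^2) set"
  assumes open_K: "open K" and convex_K: "convex K" and bounded_K: "bounded K" and nonempty_K: "K \<noteq> {}"
begin

abbreviation \<mu> :: "(real^2) measure" where "\<mu> \<equiv> uniform_measure lborel K"

lemma sets_K [measurable]: "K \<in> sets borel" "K \<in> sets lborel"
  using open_K by auto

lemma emeasure_K: "emeasure lborel K \<noteq> 0" "emeasure lborel K < \<infinity>" "emeasure lborel K \<noteq> \<infinity>"
proof -
  have "\<not> negligible K"
    using open_not_negligible[OF open_K nonempty_K] .
  then have "K \<notin> null_sets lebesgue"
    by (simp add: negligible_iff_null_sets)
  then show "emeasure lborel K \<noteq> 0"
    by (simp add: null_sets_completion_iff null_sets_def)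
  show "emeasure lborel K < \<infinity>"
    using emeasure_bounded_finite[OF bounded_K] .
  then show "emeasure lborel K \<noteq> \<infinity>" by simp
qed

lemma emeasure_K_div [simp]: "emeasure lborel K / emeasure lborel K = 1"
  using emeasure_K by (simp add: ennreal_divide_self)

definition vol :: real where "vol = measure lborel K"

lemma vol_pos: "vol > 0" and emeasure_K_eq: "emeasure lborel K = ennreal vol"
  using emeasure_K emeasure_eq_ennreal_measure[of lborel K]
  by (auto simp: vol_def measure_nonneg less_le top_unique)

sublocale prob_space \<mu>
  by (rule prob_space_uniform_measure) (use emeasure_K in auto)

lemma sets_\<mu> [measurable_cong]: "sets \<mu> = sets borel"
  by simp

lemma AE_\<mu>_iff: "(AE x in \<mu>. P x) \<longleftrightarrow> (AE x in lborel. x \<in> K \<longrightarrow> P x)"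
  by (rule AE_uniform_measure) (use emeasure_K in auto)

lemma AE_in_K: "AE x in \<mu>. x \<in> K"
  by (simp add: AE_\<mu>_iff)

lemma nn_integral_\<mu>:
  assumes [measurable]: "f \<in> borel_measurable borel"
  shows "(\<integral>\<^sup>+x. f x \<partial>\<mu>) = (\<integral>\<^sup>+x. f x * indicator K x \<partial>lborel) / ennreal vol"
  by (simp add: nn_integral_uniform_measure emeasure_K_eq)

lemma \<mu>_eq_density: "\<mu> = density lborel (\<lambda>x. ennreal (indicator K x / vol))"
  unfolding uniform_measure_def emeasure_K_eq
  using vol_pos by (intro density_cong) (auto simp: indicator_def divide_ennreal[symmetric])

abbreviation L1 :: "(real^2 \<Rightarrow> real) \<Rightarrow> ennreal" where
  "L1 f \<equiv> \<integral>\<^sup>+x. ennreal \<bar>f x\<bar> \<partial>\<mu>"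

lemma integral_\<mu>:
  fixes f :: "real^2 \<Rightarrow> real"
  assumes [measurable]: "f \<in> borel_measurable borel"
  shows "(\<integral>x. f x \<partial>\<mu>) = (\<integral>x. indicator K x * f x \<partial>lborel) / vol"
  unfolding \<mu>_eq_density using vol_pos by (simp add: integral_density)

lemma integrable_\<mu>_iff:
  fixes f :: "real^2 \<Rightarrow> real"
  assumes [measurable]: "f \<in> borel_measurable borel"
  shows "integrable \<mu> f \<longleftrightarrow> integrable lborel (\<lambda>x. indicator K x * f x)"
  unfolding \<mu>_eq_density using vol_pos
  using integrable_mult_right_iff[where c="1 / vol" and f="\<lambda>x. indicator K x * f x" and M=lborel]
  by (subst integrable_density) auto

lemma integrable_\<mu>_continuous:
  fixes f :: "real^2 \<Rightarrow> real"
  assumes "continuous_on UNIV f"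
  shows "integrable \<mu> f"
proof -
  have "compact (f ` closure K)"
    by (intro compact_continuous_image continuous_on_subset[OF assms] subset_UNIV)
       (simp add: compact_closure bounded_K)
  then obtain B where B: "\<forall>x\<in>closure K. \<bar>f x\<bar> \<le> B"
    using compact_imp_bounded by (force simp: bounded_iff)
  show ?thesis
  proof (rule integrable_const_bound[where B=B])
    show "AE x in \<mu>. norm (f x) \<le> B"
      using AE_in_K by eventually_elim (use B closure_subset in auto)
  qed (use borel_measurable_continuous_onI[OF assms] in simp)
qed

lemma segment_in_K: "x \<in> K \<Longrightarrow> z \<in> K \<Longrightarrow> 0 \<le> s \<Longrightarrow> s \<le> 1 \<Longrightarrow> (1 - s) *\<^sub>R x + s *\<^sub>R z \<in> K"
  using convex_K by (simp add: convex_alt)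

text \<open>Substitution with Jacobian \<open>(1 - s)^2\<close> in the plane. By convexity the
  contraction maps K into K, so inserting the indicator at the image point loses nothing.\<close>

lemma nn_integral_contraction_le:
  assumes [measurable]: "q \<in> borel_measurable borel" and "z \<in> K" "0 \<le> s" "s < 1"
  shows "(\<integral>\<^sup>+x. q ((1 - s) *\<^sub>R x + s *\<^sub>R z) \<partial>\<mu>) \<le> ennreal (1 / (1 - s)\<^sup>2) * (\<integral>\<^sup>+x. q x \<partial>\<mu>)"
proof -
  have "(\<integral>\<^sup>+x. q ((1 - s) *\<^sub>R x + s *\<^sub>R z) * indicator K x \<partial>lborel)
      \<le> (\<integral>\<^sup>+x. q (s *\<^sub>R z + (1 - s) *\<^sub>R x) * indicator K (s *\<^sub>R z + (1 - s) *\<^sub>R x) \<partial>lborel)"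
    using segment_in_K[OF _ assms(2), of _ s] assms
    by (intro nn_integral_mono) (auto simp: indicator_def add.commute)
  also have "\<dots> = ennreal (1 / (1 - s)\<^sup>2) * (\<integral>\<^sup>+x. q x * indicator K x \<partial>lborel)"
    using assms
    by (subst nn_integral_lborel_affine[where f="\<lambda>x. q x * indicator K x" and c="1 - s" and t="s *\<^sub>R z"])
       (auto simp: mult.assoc[symmetric] ennreal_mult'[symmetric] power2_eq_square)
  finally show ?thesis
    by (simp add: nn_integral_\<mu> divide_ennreal_def mult.assoc[symmetric] mult_right_mono)
qed

text \<open>The law of a random point \<open>(y, t)\<close>, read as the point at parameter \<open>t\<close> on the segment from a fixed
  \<open>x\<close> to \<open>y\<close>.\<close>

definition segments :: "((real^2) \<times> real) measure" where
  "segments = \<mu> \<Otimes>\<^sub>M uniform_measure lborel {0..1}"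

lemma prob_space_unit: "prob_space (uniform_measure lborel {0..1::real})"
  by (rule prob_space_uniform_measure) auto

lemma prob_space_segments: "prob_space segments"
  unfolding segments_def
  by (intro prob_space_pair prob_space_unit prob_space_axioms)

lemma sets_segments [measurable_cong]: "sets segments = sets (borel \<Otimes>\<^sub>M borel)"
  unfolding segments_def by (rule sets_pair_measure_cong) auto

text \<open>For \<open>t \<le> 1 / 2\<close> and fixed \<open>y\<close>, the map from
  \<open>x\<close> to the point at parameter \<open>t\<close> is a contraction of K with Jacobian at
  least 1/4; this is the origin of the 4. For \<open>t > 1 / 2\<close> the end points exchange their
  roles. No singular kernel appears, and only convexity is used.\<close>

lemma nn_integral_segments_le:
  assumes [measurable]: "q \<in> borel_measurable borel"
  shows "(\<integral>\<^sup>+x. \<integral>\<^sup>+p. q ((1 - snd p) *\<^sub>R x + snd p *\<^sub>R fst p) \<partial>segments \<partial>\<mu>) \<le> 4 * (\<integral>\<^sup>+x. q x \<partial>\<mu>)"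
proof -
  let ?U = "uniform_measure lborel {0..1::real}"
  interpret U: prob_space ?U by (rule prob_space_unit)
  interpret KU: pair_sigma_finite \<mu> ?U ..
  interpret KK: pair_sigma_finite \<mu> \<mu> ..
  have half: "(\<integral>\<^sup>+x. \<integral>\<^sup>+y. q ((1 - t) *\<^sub>R x + t *\<^sub>R y) \<partial>\<mu> \<partial>\<mu>) \<le> 4 * (\<integral>\<^sup>+x. q x \<partial>\<mu>)"
    if "0 \<le> t" "t \<le> 1 / 2" for t
  proof -
    have "(\<integral>\<^sup>+x. \<integral>\<^sup>+y. q ((1 - t) *\<^sub>R x + t *\<^sub>R y) \<partial>\<mu> \<partial>\<mu>) = (\<integral>\<^sup>+y. \<integral>\<^sup>+x. q ((1 - t) *\<^sub>R x + t *\<^sub>R y) \<partial>\<mu> \<partial>\<mu>)"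
      by (subst KK.Fubini') auto
    also have "\<dots> \<le> (\<integral>\<^sup>+y. 4 * (\<integral>\<^sup>+x. q x \<partial>\<mu>) \<partial>\<mu>)"
    proof (rule nn_integral_mono_AE)
      show "AE y in \<mu>. (\<integral>\<^sup>+x. q ((1 - t) *\<^sub>R x + t *\<^sub>R y) \<partial>\<mu>) \<le> 4 * (\<integral>\<^sup>+x. q x \<partial>\<mu>)"
        using AE_in_K
      proof eventually_elim
        case (elim y)
        have "(1 / 2)\<^sup>2 \<le> (1 - t)\<^sup>2"
          using that by (intro power_mono) auto
        then have "1 / (1 - t)\<^sup>2 \<le> 4"
          using that by (simp add: field_simps power2_eq_square)
        then have "ennreal (1 / (1 - t)\<^sup>2) \<le> 4"
          by (metis ennreal_leI ennreal_numeral zero_le_numeral)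
        then show ?case
          using that by (intro order_trans[OF nn_integral_contraction_le[OF assms elim, of t] mult_right_mono]) auto
      qed
    qed
    also have "\<dots> = 4 * (\<integral>\<^sup>+x. q x \<partial>\<mu>)"
      by (simp add: emeasure_space_1)
    finally show ?thesis .
  qed
  have all: "(\<integral>\<^sup>+x. \<integral>\<^sup>+y. q ((1 - t) *\<^sub>R x + t *\<^sub>R y) \<partial>\<mu> \<partial>\<mu>) \<le> 4 * (\<integral>\<^sup>+x. q x \<partial>\<mu>)"
    if "t \<in> {0..1}" for t
  proof (cases "t \<le> 1 / 2")
    case True
    with half[of t] that show ?thesis by auto
  next
    case False
    have "(\<integral>\<^sup>+x. \<integral>\<^sup>+y. q ((1 - t) *\<^sub>R x + t *\<^sub>R y) \<partial>\<mu> \<partial>\<mu>) = (\<integral>\<^sup>+y. \<integral>\<^sup>+x. q ((1 - (1 - t)) *\<^sub>R y + (1 - t) *\<^sub>R x) \<partial>\<mu> \<partial>\<mu>)"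
      by (subst KK.Fubini') (auto simp: add.commute)
    also have "\<dots> \<le> 4 * (\<integral>\<^sup>+x. q x \<partial>\<mu>)"
      by (rule half) (use that False in auto)
    finally show ?thesis .
  qed
  have "(\<integral>\<^sup>+x. \<integral>\<^sup>+p. q ((1 - snd p) *\<^sub>R x + snd p *\<^sub>R fst p) \<partial>segments \<partial>\<mu>)
      = (\<integral>\<^sup>+x. \<integral>\<^sup>+t. \<integral>\<^sup>+y. q ((1 - t) *\<^sub>R x + t *\<^sub>R y) \<partial>\<mu> \<partial>?U \<partial>\<mu>)"
    unfolding segments_def by (subst KU.nn_integral_snd[symmetric]) auto
  also have "\<dots> = (\<integral>\<^sup>+t. \<integral>\<^sup>+x. \<integral>\<^sup>+y. q ((1 - t) *\<^sub>R x + t *\<^sub>R y) \<partial>\<mu> \<partial>\<mu> \<partial>?U)"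
    by (subst KU.Fubini') auto
  also have "\<dots> \<le> (\<integral>\<^sup>+t. 4 * (\<integral>\<^sup>+x. q x \<partial>\<mu>) \<partial>?U)"
    by (intro nn_integral_mono_AE AE_uniform_measureI) (use all in auto)
  also have "\<dots> = 4 * (\<integral>\<^sup>+x. q x \<partial>\<mu>)"
    using U.emeasure_space_1 by simp
  finally show ?thesis .
qed

section \<open>Continuity of contractions in L^1\<close>

lemma L1_approx_continuous:
  fixes f :: "real^2 \<Rightarrow> real"
  assumes f: "integrable \<mu> f" and "e > 0"
  obtains g where "continuous_on UNIV g" "(\<integral>x. \<bar>f x - g x\<bar> \<partial>\<mu>) < e"
proof -
  have [measurable]: "f \<in> borel_measurable borel"
    using borel_measurable_integrable[OF f] by simp
  \<comment> \<open>Measurability supplies continuous functions that converge only almost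
    everywhere. Truncating \<open>f\<close> and the approximants at the same level makes dominated
    convergence applicable, and integrability of \<open>f\<close> makes its truncation error
    small.\<close>
  let ?c = "\<lambda>M y::real. max (- real M) (min (real M) y)"
  have "(\<lambda>M. \<integral>x. \<bar>f x - ?c M (f x)\<bar> \<partial>\<mu>) \<longlonglongrightarrow> (\<integral>x. 0 \<partial>\<mu>)"
  proof (rule integral_dominated_convergence)
    show "integrable \<mu> (\<lambda>x. \<bar>f x\<bar>)" using f by simp
    show "AE x in \<mu>. (\<lambda>M. \<bar>f x - ?c M (f x)\<bar>) \<longlonglongrightarrow> 0"
    proof (rule AE_I2)
      fix x
      obtain M where "\<bar>f x\<bar> \<le> real M" using real_arch_simple by blast
      then have "\<forall>\<^sub>F n in sequentially. \<bar>f x - ?c n (f x)\<bar> = 0"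
        by (intro eventually_sequentiallyI[of M]) auto
      then show "(\<lambda>M. \<bar>f x - ?c M (f x)\<bar>) \<longlonglongrightarrow> 0"
        by (rule tendsto_eventually)
    qed
    show "AE x in \<mu>. norm \<bar>f x - ?c M (f x)\<bar> \<le> \<bar>f x\<bar>" for M
      by (rule AE_I2) auto
  qed auto
  then have "\<forall>\<^sub>F M in sequentially. (\<integral>x. \<bar>f x - ?c M (f x)\<bar> \<partial>\<mu>) < e / 2"
    by (rule order_tendstoD(2)) (use \<open>e > 0\<close> in simp)
  then obtain M where M: "(\<integral>x. \<bar>f x - ?c M (f x)\<bar> \<partial>\<mu>) < e / 2"
    by (auto simp: eventually_sequentially)
  have "f \<in> borel_measurable lebesgue"
    by (simp add: measurable_completion)
  then have "f measurable_on UNIV"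
    by (simp add: measurable_on_iff_borel_measurable)
  then obtain N F where N: "negligible N" and F: "\<And>n. continuous_on UNIV (F n)"
    "\<And>x. x \<notin> N \<Longrightarrow> (\<lambda>n. F n x) \<longlonglongrightarrow> f x"
    by (auto simp: measurable_on_def)
  have [measurable]: "F n \<in> borel_measurable borel" for n
    using F by (intro borel_measurable_continuous_onI)
  have "AE x in lebesgue. x \<notin> N"
    using N by (simp add: negligible_iff_null_sets AE_not_in)
  then have "AE x in lborel. x \<notin> N"
    by (simp add: AE_completion_iff)
  then have N': "AE x in \<mu>. x \<notin> N"
    by (auto simp: AE_\<mu>_iff)
  have intM: "integrable \<mu> (\<lambda>x. ?c M (h x))" if [measurable]: "h \<in> borel_measurable borel" for h
    by (rule integrable_const_bound[where B="real M"]) auto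
  have "(\<lambda>n. \<integral>x. \<bar>?c M (f x) - ?c M (F n x)\<bar> \<partial>\<mu>) \<longlonglongrightarrow> (\<integral>x. \<bar>?c M (f x) - ?c M (f x)\<bar> \<partial>\<mu>)"
  proof (rule integral_dominated_convergence)
    show "integrable \<mu> (\<lambda>x. 2 * real M)" by simp
    show "AE x in \<mu>. (\<lambda>n. \<bar>?c M (f x) - ?c M (F n x)\<bar>) \<longlonglongrightarrow> \<bar>?c M (f x) - ?c M (f x)\<bar>"
      using N' by eventually_elim (intro tendsto_intros F)
    show "AE x in \<mu>. norm \<bar>?c M (f x) - ?c M (F n x)\<bar> \<le> 2 * real M" for n
      by (rule AE_I2) auto
  qed auto
  then have "\<forall>\<^sub>F n in sequentially. (\<integral>x. \<bar>?c M (f x) - ?c M (F n x)\<bar> \<partial>\<mu>) < e / 2"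
    by (rule order_tendstoD(2)) (use \<open>e > 0\<close> in simp)
  then obtain n where n: "(\<integral>x. \<bar>?c M (f x) - ?c M (F n x)\<bar> \<partial>\<mu>) < e / 2"
    by (auto simp: eventually_sequentially)
  have i1: "integrable \<mu> (\<lambda>x. \<bar>f x - ?c M (f x)\<bar>)"
    by (intro integrable_abs Bochner_Integration.integrable_diff f intM) simp
  have i2: "integrable \<mu> (\<lambda>x. \<bar>?c M (f x) - ?c M (F n x)\<bar>)"
    by (intro integrable_abs Bochner_Integration.integrable_diff intM) simp_all
  have i3: "integrable \<mu> (\<lambda>x. \<bar>f x - ?c M (F n x)\<bar>)"
    by (intro integrable_abs Bochner_Integration.integrable_diff f intM) simp
  have triangle: "\<bar>a - c\<bar> \<le> \<bar>a - b\<bar> + \<bar>b - c\<bar>" for a b c :: real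
    by linarith
  have "(\<integral>x. \<bar>f x - ?c M (F n x)\<bar> \<partial>\<mu>) \<le> (\<integral>x. \<bar>f x - ?c M (f x)\<bar> + \<bar>?c M (f x) - ?c M (F n x)\<bar> \<partial>\<mu>)"
    by (rule integral_mono[OF i3 Bochner_Integration.integrable_add[OF i1 i2] triangle])
  also have "\<dots> = (\<integral>x. \<bar>f x - ?c M (f x)\<bar> \<partial>\<mu>) + (\<integral>x. \<bar>?c M (f x) - ?c M (F n x)\<bar> \<partial>\<mu>)"
    by (rule Bochner_Integration.integral_add[OF i1 i2])
  finally have "(\<integral>x. \<bar>f x - ?c M (F n x)\<bar> \<partial>\<mu>) < e"
    using M n by linarith
  moreover have "continuous_on UNIV (\<lambda>x. ?c M (F n x))"
    by (intro continuous_intros F)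
  ultimately show ?thesis
    using that by blast
qed

text \<open>For continuous functions this is uniform continuity on the compact closure, and density
  does the rest. The bound is uniform in the centre \<open>w\<close>, over which the mollifier
  averages. In the budget of six parts the approximation error after contraction takes four, by the
  Jacobian bound for \<open>s < 1 / 2\<close>; the other two errors take one each.\<close>

lemma L1_contraction_continuous:
  fixes f :: "real^2 \<Rightarrow> real"
  assumes f: "integrable \<mu> f" and "e > 0"
  obtains d where "0 < d" "d \<le> 1 / 2"
    "\<And>s w. 0 \<le> s \<Longrightarrow> s < d \<Longrightarrow> w \<in> K \<Longrightarrow> L1 (\<lambda>x. f ((1 - s) *\<^sub>R x + s *\<^sub>R w) - f x) \<le> ennreal e"
proof -
  have [measurable]: "f \<in> borel_measurable borel"
    using borel_measurable_integrable[OF f] by simp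
  obtain g where g: "continuous_on UNIV g" "(\<integral>x. \<bar>f x - g x\<bar> \<partial>\<mu>) < e / 6"
    using L1_approx_continuous[OF f, of "e / 6"] \<open>e > 0\<close> by auto
  have [measurable]: "g \<in> borel_measurable borel"
    using g(1) by (rule borel_measurable_continuous_onI)
  have "integrable \<mu> (\<lambda>x. \<bar>f x - g x\<bar>)"
    using f integrable_\<mu>_continuous[OF g(1)] by simp
  then have fg: "L1 (\<lambda>x. f x - g x) \<le> ennreal (e / 6)"
    using g(2) by (simp add: nn_integral_eq_integral ennreal_leI)
  have "uniformly_continuous_on (closure K) g"
    by (intro compact_uniformly_continuous continuous_on_subset[OF g(1)]) (auto simp: compact_closure bounded_K)
  then obtain \<eta> where \<eta>: "\<eta> > 0" "\<And>x y. x \<in> closure K \<Longrightarrow> y \<in> closure K \<Longrightarrow> dist y x < \<eta> \<Longrightarrow> dist (g y) (g x) < e / 6"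
    unfolding uniformly_continuous_on_def using \<open>e > 0\<close>
    by (metis divide_pos_pos zero_less_numeral)
  \<comment> \<open>The summand 1 makes the divisor in \<open>\<eta> / D\<close> positive.\<close>
  define D where "D = diameter K + 1"
  have D: "D > 0" "\<And>x y. x \<in> K \<Longrightarrow> y \<in> K \<Longrightarrow> norm (x - y) \<le> D"
    using diameter_ge_0[OF bounded_K] diameter_bounded_bound[OF bounded_K]
    by (force simp: D_def dist_norm)+
  define d where "d = min (1 / 2) (\<eta> / D)"
  show ?thesis
  proof (rule that[of d])
    show "0 < d"
      using \<eta>(1) D(1) by (simp add: d_def)
    show "d \<le> 1 / 2"
      by (simp only: d_def min.cobounded1)
    fix s w assume s: "0 \<le> s" "s < d" and w: "w \<in> K"
    have s1: "s < 1 / 2" and sD: "s * D < \<eta>"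
      using s D(1) by (auto simp: d_def field_simps)
    let ?A = "\<lambda>x. (1 - s) *\<^sub>R x + s *\<^sub>R w"
    have "L1 (\<lambda>x. f (?A x) - f x)
      \<le> (\<integral>\<^sup>+x. ennreal \<bar>f (?A x) - g (?A x)\<bar> + (ennreal (e / 6) + ennreal \<bar>f x - g x\<bar>) \<partial>\<mu>)"
    proof (rule nn_integral_mono_AE)
      show "AE x in \<mu>. ennreal \<bar>f (?A x) - f x\<bar>
          \<le> ennreal \<bar>f (?A x) - g (?A x)\<bar> + (ennreal (e / 6) + ennreal \<bar>f x - g x\<bar>)"
        using AE_in_K
      proof eventually_elim
        case (elim x)
        have "?A x - x = s *\<^sub>R (w - x)"
          by (simp add: algebra_simps)
        then have "dist (?A x) x \<le> s * D"
          using D(2)[OF w elim] s by (simp add: dist_norm mult_left_mono)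
        then have "dist (g (?A x)) (g x) < e / 6"
          using segment_in_K[OF elim w, of s] s s1 sD closure_subset[of K] elim
          by (intro \<eta>(2)) auto
        then show ?case
          using \<open>e > 0\<close> unfolding dist_real_def
          by (intro ennreal_le_plus) linarith+
      qed
    qed
    also have "\<dots> = L1 (\<lambda>x. f (?A x) - g (?A x)) + (ennreal (e / 6) + L1 (\<lambda>x. f x - g x))"
      by (simp add: nn_integral_add emeasure_space_1)
    also have "\<dots> \<le> 4 * ennreal (e / 6) + (ennreal (e / 6) + ennreal (e / 6))"
    proof (intro add_mono fg order_refl)
      have "(1 / 2)\<^sup>2 \<le> (1 - s)\<^sup>2"
        using s s1 by (intro power_mono) auto
      then have "1 / (1 - s)\<^sup>2 \<le> 4"
        using s1 by (simp add: field_simps power2_eq_square)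
      then have "ennreal (1 / (1 - s)\<^sup>2) \<le> 4"
        by (metis ennreal_leI ennreal_numeral zero_le_numeral)
      then have "ennreal (1 / (1 - s)\<^sup>2) * L1 (\<lambda>x. f x - g x) \<le> 4 * ennreal (e / 6)"
        by (intro mult_mono fg) auto
      then show "L1 (\<lambda>x. f (?A x) - g (?A x)) \<le> 4 * ennreal (e / 6)"
        using w s s1
        by (intro order_trans[OF nn_integral_contraction_le[of "\<lambda>x. ennreal \<bar>f x - g x\<bar>" w s]]) auto
    qed
    also have "\<dots> = ennreal e"
      using \<open>e > 0\<close>
      by (simp add: ennreal_plus[symmetric] ennreal_numeral[symmetric] ennreal_mult[symmetric] del: ennreal_plus ennreal_numeral)
    finally show "L1 (\<lambda>x. f (?A x) - f x) \<le> ennreal e" .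
  qed
qed

end

lemma ennreal_tendsto_0I:
  assumes "\<And>e::real. e > 0 \<Longrightarrow> \<forall>\<^sub>F n in F. X n \<le> ennreal e"
  shows "(X \<longlongrightarrow> (0::ennreal)) F"
proof (rule order_tendstoI)
  fix a :: ennreal
  show "a < 0 \<Longrightarrow> \<forall>\<^sub>F n in F. a < X n"
    by simp
  assume "0 < a"
  then obtain b where b: "0 < b" "b < a"
    using dense by blast
  then obtain e where e: "b = ennreal e" "e > 0"
    by (cases b) auto
  show "\<forall>\<^sub>F n in F. X n < a"
    using assms[OF e(2)] by eventually_elim (use b e in auto)
qed

context convex_domain
begin

text \<open>Integrability over \<open>\<mu>\<close> makes \<open>u\<close> and \<open>w\<close>
  Borel functions, and the normalisation of \<open>\<mu>\<close> cancels between the two sides.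
  Integrability is demanded over all of K, stronger than the local integrability in
  \<open>is_weak_deriv\<close>.\<close>

definition weak_grad :: "(real^2 \<Rightarrow> real) \<Rightarrow> (2 \<Rightarrow> real^2 \<Rightarrow> real) \<Rightarrow> bool" where
  "weak_grad u w \<longleftrightarrow> integrable \<mu> u \<and> (\<forall>i. integrable \<mu> (w i)) \<and>
     (\<forall>\<phi>\<in>test_functions K. \<forall>i. (\<integral>x. u x * partial_deriv i \<phi> x \<partial>\<mu>) = - (\<integral>x. w i x * \<phi> x \<partial>\<mu>))"

lemma nn_integral_const_\<mu>: "(\<integral>\<^sup>+x. c \<partial>\<mu>) = c"
  by simp

end

subsection \<open>Mollification after contraction\<close>

definition bump :: "real \<Rightarrow> real" where
  "bump x = flat 1 x * flat 1 (1 - x)"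

lemma bump_fun_bump: "bump_fun bump"
  unfolding bump_def by (rule bump_fun.flat_mult)

lemma bump_nonneg: "bump x \<ge> 0" and bump_pos: "0 < x \<Longrightarrow> x < 1 \<Longrightarrow> bump x > 0"
  by (auto simp: bump_def flat_def)

text \<open>The kernel lives on a square inside K with corner \<open>p\<close> and side
  \<open>r\<close>. Averaging over the points \<open>(1 - s) x + s w\<close> with \<open>w\<close>
  in this square never leaves K, in contrast to convolution near the boundary.\<close>

locale mollifier = convex_domain +
  fixes p :: "real^2" and r :: real
  assumes r_pos: "r > 0" and box_in_K: "\<And>y. (\<And>i. p $ i \<le> y $ i \<and> y $ i \<le> p $ i + r) \<Longrightarrow> y \<in> K"
begin

definition mass :: real where
  "mass = (\<integral>w. tensor bump bump ((1 / r) *\<^sub>R (w - p)) \<partial>lborel)"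

definition \<rho> :: "real^2 \<Rightarrow> real" where
  "\<rho> w = tensor bump bump ((1 / r) *\<^sub>R (w - p)) / mass"

lemma tensor_support:
  assumes "tensor \<alpha> \<beta> ((1 / r) *\<^sub>R (w - p)) \<noteq> 0" "bump_fun \<alpha>" "bump_fun \<beta>"
  shows "w \<in> cbox p (p + r *\<^sub>R 1)"
proof -
  have "(1 / r) * (w $ i - p $ i) \<in> {0<..<1}" for i
    using assms bump_fun_outside[of \<alpha> "(1 / r) * (w $ 1 - p $ 1)"] bump_fun_outside[of \<beta> "(1 / r) * (w $ 2 - p $ 2)"]
      exhaust_2[of i] unfolding tensor_def by auto
  then show ?thesis
    using r_pos by (auto simp: mem_box_cart field_simps less_imp_le)
qed

lemma cbox_subset_K: "cbox p (p + r *\<^sub>R 1) \<subseteq> K"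
  using box_in_K by (auto simp: mem_box_cart)

lemma continuous_kernel: "continuous_on S (\<lambda>w. tensor bump bump ((1 / r) *\<^sub>R (w - p)))"
  by (intro continuous_intros bump_fun_bump)

lemma \<rho>_measurable [measurable]: "\<rho> \<in> borel_measurable borel"
  unfolding \<rho>_def
  by (intro borel_measurable_divide borel_measurable_continuous_onI continuous_kernel borel_measurable_const)

lemma integrable_kernel: "integrable lborel (\<lambda>w. tensor bump bump ((1 / r) *\<^sub>R (w - p)))"
proof -
  have "(\<lambda>w. indicator (cbox p (p + r *\<^sub>R 1)) w *\<^sub>R tensor bump bump ((1 / r) *\<^sub>R (w - p)))
      = (\<lambda>w. tensor bump bump ((1 / r) *\<^sub>R (w - p)))"
    using tensor_support[OF _ bump_fun_bump bump_fun_bump] by (auto simp: fun_eq_iff indicator_def)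
  then show ?thesis
    using borel_integrable_compact[OF compact_cbox[of p "p + r *\<^sub>R 1"] continuous_kernel] by simp
qed

lemma kernel_nonneg: "tensor bump bump x \<ge> 0"
  by (simp add: tensor_def bump_nonneg)

lemma mass_pos: "mass > 0"
proof -
  let ?k = "\<lambda>w. tensor bump bump ((1 / r) *\<^sub>R (w - p))"
  have "\<not> (AE w in lborel. ?k w = 0)"
  proof
    assume "AE w in lborel. ?k w = 0"
    moreover have "?k w \<noteq> 0" if "w \<in> box p (p + r *\<^sub>R 1)" for w
    proof -
      have "bump ((1 / r) * (w $ i - p $ i)) > 0" for i
        using that r_pos by (intro bump_pos) (auto simp: mem_box_cart field_simps)
      then show ?thesis
        by (simp add: tensor_def less_imp_neq[symmetric])
    qed
    ultimately have "AE w in lborel. w \<notin> box p (p + r *\<^sub>R 1)"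
      by (auto elim: eventually_mono)
    then have "box p (p + r *\<^sub>R 1) \<in> null_sets lborel"
      by (simp add: AE_iff_null_sets)
    then have "negligible (box p (p + r *\<^sub>R 1))"
      by (simp add: negligible_iff_null_sets null_sets_completionI)
    moreover have "box p (p + r *\<^sub>R 1) \<noteq> {}"
      using r_pos by (simp add: interval_ne_empty_cart)
    ultimately show False
      using open_not_negligible open_box by blast
  qed
  then have "mass \<noteq> 0"
    unfolding mass_def using integrable_kernel kernel_nonneg
    by (subst integral_nonneg_eq_0_iff_AE) auto
  moreover have "mass \<ge> 0"
    unfolding mass_def by (intro integral_nonneg_AE AE_I2 kernel_nonneg)
  ultimately show ?thesis by simp
qed

lemma \<rho>_nonneg: "\<rho> w \<ge> 0"
  using mass_pos by (simp add: \<rho>_def kernel_nonneg)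

lemma \<rho>_outside: "w \<notin> K \<Longrightarrow> \<rho> w = 0"
  using tensor_support[OF _ bump_fun_bump bump_fun_bump, of w] cbox_subset_K by (auto simp: \<rho>_def)

lemma integrable_\<rho>: "integrable lborel \<rho>" and integral_\<rho>: "(\<integral>w. \<rho> w \<partial>lborel) = 1"
  unfolding \<rho>_def using integrable_kernel mass_pos by (auto simp: mass_def)

lemma nn_integral_\<rho>: "(\<integral>\<^sup>+w. ennreal (\<rho> w) \<partial>lborel) = 1"
  using integral_\<rho> by (simp add: nn_integral_eq_integral integrable_\<rho> \<rho>_nonneg)

text \<open>After the substitution \<open>z = (1 - s) x + s w\<close> this is the average of
  \<open>f ((1 - s) x + s w)\<close> with density \<open>\<rho>\<close>: \<open>vol\<close> undoes
  the normalisation of \<open>\<mu>\<close>, and \<open>s^2\<close> is the Jacobian in the plane. In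
  the form of a smear the variable \<open>x\<close> occurs only in the kernel, whence
  smoothness.\<close>

definition moll :: "real \<Rightarrow> (real^2 \<Rightarrow> real) \<Rightarrow> real^2 \<Rightarrow> real" where
  "moll s f x = vol / (mass * s\<^sup>2) *
     smear \<mu> f bump bump (- (1 / r) *\<^sub>R p) (1 / (s * r)) ((1 - s) / (s * r)) x"

lemma smooth_moll: "integrable \<mu> f \<Longrightarrow> smooth (moll s f)"
  unfolding moll_def[abs_def] by (intro smooth_smear bump_fun_bump) auto

lemma kernel_arg:
  assumes "s > 0"
  shows "- (1 / r) *\<^sub>R p + (1 / (s * r)) *\<^sub>R z - ((1 - s) / (s * r)) *\<^sub>R x
    = (1 / r) *\<^sub>R ((1 / s) *\<^sub>R (z - (1 - s) *\<^sub>R x) - p)"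
  using assms r_pos by (simp add: vec_eq_iff field_simps)

text \<open>For fixed \<open>x\<close> in K the support in \<open>z\<close> lies in the image of the
  square under a contraction towards \<open>x\<close>, which is compact and contained in K. So the
  kernel may be inserted directly into the definition of a weak derivative.\<close>

lemma kernel_test_function:
  assumes "bump_fun \<alpha>" "bump_fun \<beta>" and s: "0 < s" "s < 1" and x: "x \<in> K"
  shows "(\<lambda>z. tensor \<alpha> \<beta> (- (1 / r) *\<^sub>R p + (1 / (s * r)) *\<^sub>R z - ((1 - s) / (s * r)) *\<^sub>R x))
    \<in> test_functions K"
proof (rule test_functionsI)
  let ?S = "(\<lambda>w. (1 - s) *\<^sub>R x + s *\<^sub>R w) ` cbox p (p + r *\<^sub>R 1)"
  show "smooth (\<lambda>z. tensor \<alpha> \<beta> (- (1 / r) *\<^sub>R p + (1 / (s * r)) *\<^sub>R z - ((1 - s) / (s * r)) *\<^sub>R x))"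
    using smooth_tensor[OF assms(1,2), of 1 "1 / (s * r)" "(1 / r) *\<^sub>R p + ((1 - s) / (s * r)) *\<^sub>R x"]
    by (simp add: algebra_simps)
  show "compact ?S"
    by (intro compact_continuous_image compact_cbox continuous_intros)
  show "?S \<subseteq> K"
    using segment_in_K[OF x] cbox_subset_K s by auto
  fix z assume z: "z \<notin> ?S"
  have "(1 / s) *\<^sub>R (z - (1 - s) *\<^sub>R x) \<notin> cbox p (p + r *\<^sub>R 1)"
  proof
    assume "(1 / s) *\<^sub>R (z - (1 - s) *\<^sub>R x) \<in> cbox p (p + r *\<^sub>R 1)"
    then have "(1 - s) *\<^sub>R x + s *\<^sub>R ((1 / s) *\<^sub>R (z - (1 - s) *\<^sub>R x)) \<in> ?S"
      by (rule imageI)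
    with z s show False by simp
  qed
  then show "tensor \<alpha> \<beta> (- (1 / r) *\<^sub>R p + (1 / (s * r)) *\<^sub>R z - ((1 - s) / (s * r)) *\<^sub>R x) = 0"
    using tensor_support[OF _ assms(1,2)] unfolding kernel_arg[OF s(1)] by blast
qed

lemma moll_eq:
  assumes s: "0 < s" "s < 1" and x: "x \<in> K" and [measurable]: "f \<in> borel_measurable borel"
  shows "moll s f x = (\<integral>w. f ((1 - s) *\<^sub>R x + s *\<^sub>R w) * \<rho> w \<partial>lborel)"
proof -
  let ?k = "\<lambda>z. tensor bump bump (- (1 / r) *\<^sub>R p + (1 / (s * r)) *\<^sub>R z - ((1 - s) / (s * r)) *\<^sub>R x)"
  have [measurable]: "?k \<in> borel_measurable borel"
    by (intro borel_measurable_continuous_onI continuous_intros bump_fun_bump)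
  have "smear \<mu> f bump bump (- (1 / r) *\<^sub>R p) (1 / (s * r)) ((1 - s) / (s * r)) x
      = (\<integral>z. indicator K z * (f z * ?k z) \<partial>lborel) / vol"
    unfolding smear_def by (rule integral_\<mu>) measurable
  then have "moll s f x = 1 / (mass * s\<^sup>2) * (\<integral>z. indicator K z * (f z * ?k z) \<partial>lborel)"
    unfolding moll_def using vol_pos by (simp only:) simp
  also have "(\<integral>z. indicator K z * (f z * ?k z) \<partial>lborel)
      = s\<^sup>2 * (\<integral>w. indicator K ((1 - s) *\<^sub>R x + s *\<^sub>R w) *
          (f ((1 - s) *\<^sub>R x + s *\<^sub>R w) * ?k ((1 - s) *\<^sub>R x + s *\<^sub>R w)) \<partial>lborel)"
  proof -
    define H where "H z = indicator K z * (f z * ?k z)" for z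
    have "H \<in> borel_measurable borel"
      unfolding H_def by measurable
    from integral_lborel_affine[OF _ this, of s "(1 - s) *\<^sub>R x"] s
    have "(\<integral>z. H z \<partial>lborel) = s\<^sup>2 * (\<integral>w. H ((1 - s) *\<^sub>R x + s *\<^sub>R w) \<partial>lborel)"
      by simp
    then show ?thesis
      unfolding H_def .
  qed
  also have "(\<lambda>w. indicator K ((1 - s) *\<^sub>R x + s *\<^sub>R w) *
          (f ((1 - s) *\<^sub>R x + s *\<^sub>R w) * ?k ((1 - s) *\<^sub>R x + s *\<^sub>R w)))
      = (\<lambda>w. mass * (f ((1 - s) *\<^sub>R x + s *\<^sub>R w) * \<rho> w))"
  proof
    fix w
    have "?k ((1 - s) *\<^sub>R x + s *\<^sub>R w) = mass * \<rho> w"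
      unfolding kernel_arg[OF s(1)] \<rho>_def using s mass_pos by simp
    moreover have "\<rho> w = 0" if "(1 - s) *\<^sub>R x + s *\<^sub>R w \<notin> K"
      using that segment_in_K[OF x, of w s] s \<rho>_outside[of w] by auto
    ultimately show "indicator K ((1 - s) *\<^sub>R x + s *\<^sub>R w) *
          (f ((1 - s) *\<^sub>R x + s *\<^sub>R w) * ?k ((1 - s) *\<^sub>R x + s *\<^sub>R w))
        = mass * (f ((1 - s) *\<^sub>R x + s *\<^sub>R w) * \<rho> w)"
      by (auto simp: indicator_def)
  qed
  finally show ?thesis
    using s mass_pos by simp
qed

lemma moll_eq_0:
  assumes "0 < s" "s < 1" "x \<in> K"
    and "\<And>\<phi>. \<phi> \<in> test_functions K \<Longrightarrow> (\<integral>x. f x * \<phi> x \<partial>\<mu>) = 0"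
  shows "moll s f x = 0"
  using assms(4)[OF kernel_test_function[OF bump_fun_bump bump_fun_bump assms(1-3)]]
  by (simp add: moll_def smear_def)

text \<open>The kernel depends on \<open>(z - (1 - s) x) / s\<close> only, so differentiating in
  \<open>x\<close> amounts to differentiating in \<open>z\<close> and multiplying by
  \<open>- (1 - s)\<close>. The weak derivative then moves the derivative from the kernel to
  \<open>u\<close>.\<close>

lemma partial_deriv_moll:
  assumes s: "0 < s" "s < 1" and x: "x \<in> K" and "weak_grad u w"
  shows "partial_deriv i (moll s u) x = (1 - s) * moll s (w i) x"
proof -
  obtain bump' where bump': "bump_fun bump'" "\<And>x. (bump has_real_derivative bump' x) (at x)"
    using bump_fun_derivative[OF bump_fun_bump] by blast
  have u: "integrable \<mu> u"
    and weak: "\<And>\<phi> i. \<phi> \<in> test_functions K \<Longrightarrow>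
      (\<integral>x. u x * partial_deriv i \<phi> x \<partial>\<mu>) = - (\<integral>x. w i x * \<phi> x \<partial>\<mu>)"
    using assms(4) by (auto simp: weak_grad_def)
  let ?q = "- (1 / r) *\<^sub>R p" and ?a = "1 / (s * r)" and ?b = "(1 - s) / (s * r)"
  let ?C = "vol / (mass * s\<^sup>2)"
  let ?k = "\<lambda>z. tensor bump bump (?q + ?a *\<^sub>R z - ?b *\<^sub>R x)"
  have shift: "?a *\<^sub>R z - (?b *\<^sub>R x - ?q) = ?q + ?a *\<^sub>R z - ?b *\<^sub>R x" for z
    by simp
  have k: "partial_deriv 1 ?k z = ?a * tensor bump' bump (?q + ?a *\<^sub>R z - ?b *\<^sub>R x)"
    "partial_deriv 2 ?k z = ?a * tensor bump bump' (?q + ?a *\<^sub>R z - ?b *\<^sub>R x)" for z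
    using partial_deriv_eq[OF tensor_has_derivative[OF bump_fun_bump bump_fun_bump bump' bump',
          of ?a "?b *\<^sub>R x - ?q" z]]
    unfolding shift by (simp_all add: axis_def)
  have 1: "?a * smear \<mu> u bump' bump ?q ?a ?b x = - smear \<mu> (w 1) bump bump ?q ?a ?b x"
    using weak[OF kernel_test_function[OF bump_fun_bump bump_fun_bump s x], of 1]
    unfolding k smear_def by (simp add: mult.left_commute[of _ ?a])
  have 2: "?a * smear \<mu> u bump bump' ?q ?a ?b x = - smear \<mu> (w 2) bump bump ?q ?a ?b x"
    using weak[OF kernel_test_function[OF bump_fun_bump bump_fun_bump s x], of 2]
    unfolding k smear_def by (simp add: mult.left_commute[of _ ?a])
  have b: "C * (- ?b * X) = - (1 - s) * C * (?a * X)" for C X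
    by (simp add: divide_inverse algebra_simps)
  have D: "partial_deriv i (moll s u) x = ?C * (axis i 1 $ 1 * (- ?b * smear \<mu> u bump' bump ?q ?a ?b x)
      + axis i 1 $ 2 * (- ?b * smear \<mu> u bump bump' ?q ?a ?b x))" for i
    unfolding moll_def[abs_def]
    by (intro partial_deriv_eq has_derivative_mult_right smear_has_derivative u sets_\<mu> bump_fun_bump bump')
  have "partial_deriv 1 (moll s u) x = ?C * (- ?b * smear \<mu> u bump' bump ?q ?a ?b x)"
    using D[of 1] by (simp add: axis_def)
  also have "\<dots> = - (1 - s) * ?C * (?a * smear \<mu> u bump' bump ?q ?a ?b x)"
    by (rule b)
  finally have d1: "partial_deriv 1 (moll s u) x = (1 - s) * moll s (w 1) x"
    unfolding 1 moll_def[of s "w 1"] by (simp only: minus_mult_minus mult.assoc)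
  have "partial_deriv 2 (moll s u) x = ?C * (- ?b * smear \<mu> u bump bump' ?q ?a ?b x)"
    using D[of 2] by (simp add: axis_def)
  also have "\<dots> = - (1 - s) * ?C * (?a * smear \<mu> u bump bump' ?q ?a ?b x)"
    by (rule b)
  finally have d2: "partial_deriv 2 (moll s u) x = (1 - s) * moll s (w 2) x"
    unfolding 2 moll_def[of s "w 2"] by (simp only: minus_mult_minus mult.assoc)
  show ?thesis
    using exhaust_2[of i] d1 d2 by auto
qed

lemma moll_diff_le:
  assumes s: "0 < s" "s < 1" and x: "x \<in> K" and [measurable]: "f \<in> borel_measurable borel"
  shows "ennreal \<bar>moll s f x - f x\<bar> \<le> (\<integral>\<^sup>+w. ennreal \<bar>f ((1 - s) *\<^sub>R x + s *\<^sub>R w) - f x\<bar> * ennreal (\<rho> w) \<partial>lborel)"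
proof -
  let ?d = "\<lambda>w. (f ((1 - s) *\<^sub>R x + s *\<^sub>R w) - f x) * \<rho> w"
  have eq: "ennreal (norm (?d w)) = ennreal \<bar>f ((1 - s) *\<^sub>R x + s *\<^sub>R w) - f x\<bar> * ennreal (\<rho> w)" for w
    by (simp add: abs_mult ennreal_mult \<rho>_nonneg)
  show ?thesis
  proof (cases "integrable lborel ?d")
    case True
    have "moll s f x = (\<integral>w. ?d w + f x * \<rho> w \<partial>lborel)"
      by (simp add: moll_eq[OF s x] algebra_simps)
    also have "\<dots> = (\<integral>w. ?d w \<partial>lborel) + f x"
      using True integrable_\<rho> by (subst Bochner_Integration.integral_add) (auto simp: integral_\<rho>)
    finally show ?thesis
      using integral_norm_bound_ennreal[OF True] unfolding eq by simp
  next
    \<comment> \<open>Without integrability the right-hand side is infinite.\<close>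
    case False
    then have "(\<integral>\<^sup>+w. ennreal (norm (?d w)) \<partial>lborel) = \<infinity>"
      by (simp add: integrable_iff_bounded less_top[symmetric])
    then show ?thesis
      unfolding eq by simp
  qed
qed

text \<open>The error is dominated by an average over \<open>w\<close> in K of contraction
  differences. These are small in L^1 uniformly in \<open>w\<close>, and \<open>\<rho>\<close> has
  mass 1, so Tonelli suffices.\<close>

lemma moll_L1:
  assumes f: "integrable \<mu> f" and "e > 0"
  obtains d where "0 < d" "d \<le> 1 / 2"
    "\<And>s. 0 < s \<Longrightarrow> s < d \<Longrightarrow> L1 (\<lambda>x. moll s f x - f x) \<le> ennreal e"
proof -
  have [measurable]: "f \<in> borel_measurable borel"
    using borel_measurable_integrable[OF f] by simp
  obtain d where d: "0 < d" "d \<le> 1 / 2"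
    "\<And>s w. 0 \<le> s \<Longrightarrow> s < d \<Longrightarrow> w \<in> K \<Longrightarrow> L1 (\<lambda>x. f ((1 - s) *\<^sub>R x + s *\<^sub>R w) - f x) \<le> ennreal e"
    using L1_contraction_continuous[OF assms] by blast
  interpret P: pair_sigma_finite \<mu> "lborel :: (real^2) measure" ..
  show ?thesis
  proof (rule that[OF d(1,2)])
    fix s assume s: "0 < s" "s < d"
    then have s1: "s < 1" using d by simp
    have "L1 (\<lambda>x. moll s f x - f x)
      \<le> (\<integral>\<^sup>+x. \<integral>\<^sup>+w. ennreal \<bar>f ((1 - s) *\<^sub>R x + s *\<^sub>R w) - f x\<bar> * ennreal (\<rho> w) \<partial>lborel \<partial>\<mu>)"
      by (intro nn_integral_mono_AE eventually_mono[OF AE_in_K] moll_diff_le s s1) auto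
    also have "\<dots> = (\<integral>\<^sup>+w. \<integral>\<^sup>+x. ennreal \<bar>f ((1 - s) *\<^sub>R x + s *\<^sub>R w) - f x\<bar> * ennreal (\<rho> w) \<partial>\<mu> \<partial>lborel)"
      by (subst P.Fubini') auto
    also have "\<dots> \<le> (\<integral>\<^sup>+w. ennreal e * ennreal (\<rho> w) \<partial>lborel)"
    proof (rule nn_integral_mono)
      fix w
      show "(\<integral>\<^sup>+x. ennreal \<bar>f ((1 - s) *\<^sub>R x + s *\<^sub>R w) - f x\<bar> * ennreal (\<rho> w) \<partial>\<mu>) \<le> ennreal e * ennreal (\<rho> w)"
      proof (cases "w \<in> K")
        case True
        have "(\<integral>\<^sup>+x. ennreal \<bar>f ((1 - s) *\<^sub>R x + s *\<^sub>R w) - f x\<bar> * ennreal (\<rho> w) \<partial>\<mu>)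
          = L1 (\<lambda>x. f ((1 - s) *\<^sub>R x + s *\<^sub>R w) - f x) * ennreal (\<rho> w)"
          by (rule nn_integral_multc) simp
        also have "\<dots> \<le> ennreal e * ennreal (\<rho> w)"
          using d(3)[OF _ s(2) True] s by (intro mult_right_mono) auto
        finally show ?thesis .
      next
        case False
        then show ?thesis by (simp add: \<rho>_outside)
      qed
    qed
    also have "\<dots> = ennreal e"
      by (simp add: nn_integral_cmult nn_integral_\<rho>)
    finally show "L1 (\<lambda>x. moll s f x - f x) \<le> ennreal e" .
  qed
qed

text \<open>The offset 2 keeps the parameter strictly between 0 and 1 for every
  \<open>n\<close>.\<close>

lemma moll_tendsto:
  assumes f: "integrable \<mu> f"
  shows "(\<lambda>n. L1 (\<lambda>x. moll (1 / real (n + 2)) f x - f x)) \<longlonglongrightarrow> 0"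
proof (rule ennreal_tendsto_0I)
  fix e :: real assume "e > 0"
  obtain d where d: "0 < d" "\<And>s. 0 < s \<Longrightarrow> s < d \<Longrightarrow> L1 (\<lambda>x. moll s f x - f x) \<le> ennreal e"
    using moll_L1[OF f \<open>e > 0\<close>] by metis
  have "(\<lambda>n. 1 / real (n + 2)) \<longlonglongrightarrow> 0"
    using LIMSEQ_ignore_initial_segment[OF lim_inverse_n', of 2] by simp
  then have "\<forall>\<^sub>F n in sequentially. 1 / real (n + 2) < d"
    by (rule order_tendstoD(2)) (use d in simp)
  then show "\<forall>\<^sub>F n in sequentially. L1 (\<lambda>x. moll (1 / real (n + 2)) f x - f x) \<le> ennreal e"
    by eventually_elim (rule d(2), auto)
qed

end

context convex_domain
begin

lemma mollifier_exists:
  obtains p r where "mollifier K p r"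
proof -
  obtain x where "x \<in> K" using nonempty_K by auto
  then obtain e where e: "e > 0" "ball x e \<subseteq> K"
    using open_K open_contains_ball by blast
  \<comment> \<open>With side \<open>e / 3\<close> the sum of the two coordinate differences is at
    most \<open>2 * e / 3\<close>, hence the norm is below \<open>e\<close>.\<close>
  have "y \<in> K" if "\<And>i. x $ i \<le> y $ i \<and> y $ i \<le> x $ i + e / 3" for y :: "real^2"
  proof -
    have "norm (y - x) \<le> (\<Sum>i\<in>UNIV. \<bar>(y - x) $ i\<bar>)"
      by (rule norm_le_l1_cart)
    also have "\<dots> \<le> (\<Sum>i\<in>(UNIV::2 set). e / 3)"
    proof (rule sum_mono)
      fix i
      show "\<bar>(y - x) $ i\<bar> \<le> e / 3"
        using that[of i] e by (auto simp: abs_le_iff)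
    qed
    also have "\<dots> < e"
      using e by simp
    finally show ?thesis
      using e(2) by (auto simp: dist_norm norm_minus_commute subset_iff)
  qed
  then have "mollifier K x (e / 3)"
    using e by unfold_locales auto
  then show ?thesis using that by blast
qed

text \<open>The mollification kernels are test functions, so all mollifications of \<open>f\<close>
  vanish on K; they also converge to \<open>f\<close> in L^1.\<close>

lemma AE_eq_0_if_test_integrals_0:
  assumes f: "integrable \<mu> f" and "\<And>\<phi>. \<phi> \<in> test_functions K \<Longrightarrow> (\<integral>x. f x * \<phi> x \<partial>\<mu>) = 0"
  shows "AE x in \<mu>. f x = 0"
proof -
  obtain p r where "mollifier K p r" by (rule mollifier_exists)
  then interpret mollifier K p r .
  have "L1 (\<lambda>x. moll (1 / real (n + 2)) f x - f x) = L1 f" for n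
    by (intro nn_integral_cong_AE eventually_mono[OF AE_in_K])
       (subst moll_eq_0, use assms(2) in auto)
  then have "L1 f = 0"
    using moll_tendsto[OF f] by (simp add: LIMSEQ_const_iff)
  then show ?thesis
    using borel_measurable_integrable[OF f] by (subst (asm) nn_integral_0_iff_AE) auto
qed

lemma weak_grad_approx:
  assumes "weak_grad u w"
  obtains \<phi> :: "nat \<Rightarrow> real^2 \<Rightarrow> real" where "\<And>n. smooth (\<phi> n)"
    "(\<lambda>n. L1 (\<lambda>x. \<phi> n x - u x)) \<longlonglongrightarrow> 0"
    "\<And>i. (\<lambda>n. L1 (\<lambda>x. partial_deriv i (\<phi> n) x - w i x)) \<longlonglongrightarrow> 0"
proof -
  obtain p r where "mollifier K p r" by (rule mollifier_exists)
  then interpret mollifier K p r .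
  have u: "integrable \<mu> u" and w: "\<And>i. integrable \<mu> (w i)"
    using assms by (auto simp: weak_grad_def)
  let ?s = "\<lambda>n. 1 / real (n + 2)"
  show ?thesis
  proof (rule that[of "\<lambda>n. moll (?s n) u"])
    show "smooth (moll (?s n) u)" for n
      by (rule smooth_moll[OF u])
    show "(\<lambda>n. L1 (\<lambda>x. moll (?s n) u x - u x)) \<longlonglongrightarrow> 0"
      by (rule moll_tendsto[OF u])
    fix i
    have [measurable]: "w i \<in> borel_measurable borel" "moll s (w i) \<in> borel_measurable borel" for s
      using borel_measurable_integrable[OF w] smooth_measurable[OF smooth_moll[OF w]] by auto
    have fin: "L1 (w i) < \<infinity>"
      using w[of i] by (simp add: integrable_iff_bounded)
    have "?s \<longlonglongrightarrow> 0"
      using LIMSEQ_ignore_initial_segment[OF lim_inverse_n', of 2] by simp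
    then have "(\<lambda>n. ennreal (?s n)) \<longlonglongrightarrow> ennreal 0"
      by (rule tendsto_ennrealI)
    then have "(\<lambda>n. L1 (\<lambda>x. moll (?s n) (w i) x - w i x) + ennreal (?s n) * L1 (w i))
       \<longlonglongrightarrow> 0 + 0 * L1 (w i)"
      using fin by (intro tendsto_add moll_tendsto[OF w] tendsto_mult_ennreal) auto
    then have lim: "(\<lambda>n. L1 (\<lambda>x. moll (?s n) (w i) x - w i x) + ennreal (?s n) * L1 (w i))
       \<longlonglongrightarrow> 0"
      by simp
    \<comment> \<open>The second term pays for the factor \<open>1 - s\<close> by which the
      derivative of the mollification differs from the mollified derivative.\<close>
    have "L1 (\<lambda>x. partial_deriv i (moll (?s n) u) x - w i x)
      \<le> L1 (\<lambda>x. moll (?s n) (w i) x - w i x) + ennreal (?s n) * L1 (w i)" for n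
    proof -
      have "\<bar>(1 - ?s n) * m - v\<bar> \<le> \<bar>m - v\<bar> + ?s n * \<bar>v\<bar>" for m v :: real
      proof -
        have "(1 - ?s n) * m - v = (1 - ?s n) * (m - v) - ?s n * v"
          by (simp only: algebra_simps)
        also have "\<bar>\<dots>\<bar> \<le> (1 - ?s n) * \<bar>m - v\<bar> + ?s n * \<bar>v\<bar>"
          by (rule order_trans[OF abs_triangle_ineq4]) (auto simp: abs_mult)
        also have "\<dots> \<le> 1 * \<bar>m - v\<bar> + ?s n * \<bar>v\<bar>"
          by (intro add_mono mult_right_mono) auto
        finally show ?thesis by simp
      qed
      then have "ennreal \<bar>(1 - ?s n) * m - v\<bar> \<le> ennreal \<bar>m - v\<bar> + ennreal (?s n) * ennreal \<bar>v\<bar>" for m v :: real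
        by (simp add: ennreal_mult[symmetric] ennreal_plus[symmetric] ennreal_leI del: ennreal_plus)
      then have "L1 (\<lambda>x. partial_deriv i (moll (?s n) u) x - w i x)
        \<le> (\<integral>\<^sup>+x. ennreal \<bar>moll (?s n) (w i) x - w i x\<bar> + ennreal (?s n) * ennreal \<bar>w i x\<bar> \<partial>\<mu>)"
        by (intro nn_integral_mono_AE eventually_mono[OF AE_in_K]) (subst partial_deriv_moll[OF _ _ _ assms], auto)
      then show ?thesis
        by (simp add: nn_integral_add nn_integral_cmult)
    qed
    then show "(\<lambda>n. L1 (\<lambda>x. partial_deriv i (moll (?s n) u) x - w i x)) \<longlonglongrightarrow> 0"
      by (intro tendsto_sandwich[OF _ _ tendsto_const lim]) auto
  qed
qed

end

subsection \<open>The seminorms and averaging operators\<close>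

lemma epowr_mono: "x \<le> y \<Longrightarrow> 0 \<le> s \<Longrightarrow> epowr x s \<le> epowr y s"
  unfolding epowr_def
  by (auto simp: top_unique intro!: ennreal_leI powr_mono2 enn2real_mono simp: less_top)

lemma epowr_ennreal: "0 \<le> x \<Longrightarrow> epowr (ennreal x) s = ennreal (x powr s)"
  by (simp add: epowr_def)

lemma epowr_mult:
  assumes "0 \<le> a" "0 < s"
  shows "epowr (ennreal a * x) s = ennreal (a powr s) * epowr x s"
proof (cases x)
  case (real y)
  then show ?thesis
    using assms by (simp add: epowr_ennreal ennreal_mult[symmetric] powr_mult)
next
  case top
  then show ?thesis
    using assms by (cases "a = 0") (auto simp: epowr_def ennreal_mult_top)
qed

lemma epowr_epowr: "0 < r \<Longrightarrow> epowr (epowr x r) (1 / r) = x"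
  by (cases x) (auto simp: epowr_def powr_powr)

lemma epowr_eq_top_iff: "epowr x s = top \<longleftrightarrow> x = top"
  by (simp add: epowr_def)

text \<open>After division by \<open>a + b\<close> both fractions lie in the unit interval, where a
  number is at most its power with exponent \<open>s \<le> 1\<close>.\<close>

lemma powr_add_le_add_powr:
  fixes a b s :: real
  assumes "0 \<le> a" "0 \<le> b" "0 < s" "s \<le> 1"
  shows "(a + b) powr s \<le> a powr s + b powr s"
proof (cases "a + b = 0")
  case False
  then have ab: "a + b > 0" using assms by simp
  have le: "c / (a + b) \<le> (c / (a + b)) powr s" if "0 \<le> c" "c \<le> a + b" for c
    using powr_mono'[of s 1 "c / (a + b)"] that ab assms by simp
  have "1 = a / (a + b) + b / (a + b)"
    using ab by (simp add: add_divide_distrib[symmetric])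
  also have "\<dots> \<le> (a / (a + b)) powr s + (b / (a + b)) powr s"
    using assms by (intro add_mono le) auto
  also have "\<dots> = (a powr s + b powr s) / (a + b) powr s"
    using assms by (simp add: powr_divide add_divide_distrib)
  finally show ?thesis
    using ab by (simp add: field_simps)
qed (use assms in auto)

lemma epowr_add_le:
  assumes "0 < s" "s \<le> 1"
  shows "epowr (x + y) s \<le> epowr x s + epowr y s"
proof (cases "x = top \<or> y = top")
  case False
  then obtain a b where "x = ennreal a" "y = ennreal b" "0 \<le> a" "0 \<le> b"
    by (cases x; cases y) auto
  then show ?thesis
    using powr_add_le_add_powr[of a b s] assms
    by (simp add: epowr_ennreal ennreal_leI flip: ennreal_plus)
qed (auto simp: epowr_def)

lemma epowr_sum_le:
  assumes "0 < s" "s \<le> 1" "finite A"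
  shows "epowr (\<Sum>i\<in>A. x i) s \<le> (\<Sum>i\<in>A. epowr (x i) s)"
  using assms(3)
proof induction
  case empty
  then show ?case using assms by (simp add: epowr_def)
next
  case (insert i A)
  then show ?case
    using order_trans[OF epowr_add_le[OF assms(1,2)] add_left_mono] by simp
qed

lemma finite_mi_order: "finite {\<delta>. mi_order \<delta> = k}"
  by (rule finite_subset[of _ "{..k} \<times> {..k}"]) (auto simp: mi_order_def)

lemma enn2real_ge_1: "1 \<le> p \<Longrightarrow> p \<noteq> top \<Longrightarrow> 1 \<le> enn2real p"
  by (cases p) auto

lemma Lp_norm_le_seminorm:
  assumes "1 \<le> p" "mi_order \<delta> = k" "0 < k"
  shows "Lp_norm p \<Omega> (weak_deriv \<Omega> \<delta> v) \<le> seminorm k p \<Omega> v"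
proof (cases "p = top")
  case True
  then show ?thesis
    using assms finite_mi_order[of k] by (auto simp: seminorm_def intro!: Max_ge)
next
  case False
  let ?r = "enn2real p" and ?N = "\<lambda>\<delta>. Lp_norm p \<Omega> (weak_deriv \<Omega> \<delta> v)"
  have r: "?r \<ge> 1" using enn2real_ge_1 assms False by blast
  have "?N \<delta> = epowr (epowr (?N \<delta>) ?r) (1 / ?r)"
    using r by (simp add: epowr_epowr)
  also have "\<dots> \<le> epowr (\<Sum>\<delta> | mi_order \<delta> = k. epowr (?N \<delta>) ?r) (1 / ?r)"
    using r assms finite_mi_order[of k] by (intro epowr_mono member_le_sum) auto
  finally show ?thesis
    using False assms by (simp add: seminorm_def)
qed

text \<open>Together with the preceding bound this places the seminorm between each single
  derivative norm and the sum of all of them, with constant 1 for every exponent. Later estimates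
  can thus treat the derivatives one by one.\<close>

lemma seminorm_le_sum_Lp_norm:
  assumes "1 \<le> p" "0 < k"
  shows "seminorm k p \<Omega> v \<le> (\<Sum>\<delta> | mi_order \<delta> = k. Lp_norm p \<Omega> (weak_deriv \<Omega> \<delta> v))"
proof (cases "p = top")
  case True
  have "(k, 0) \<in> {\<delta>. mi_order \<delta> = k}"
    by (simp add: mi_order_def)
  then have "{\<delta>. mi_order \<delta> = k} \<noteq> {}" by blast
  then show ?thesis
    using assms True finite_mi_order[of k] by (auto simp: seminorm_def intro!: Max.boundedI member_le_sum)
next
  case False
  let ?r = "enn2real p" and ?N = "\<lambda>\<delta>. Lp_norm p \<Omega> (weak_deriv \<Omega> \<delta> v)"
  have r: "?r \<ge> 1" using enn2real_ge_1 assms False by blast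
  have "seminorm k p \<Omega> v = epowr (\<Sum>\<delta> | mi_order \<delta> = k. epowr (?N \<delta>) ?r) (1 / ?r)"
    using False assms by (simp add: seminorm_def)
  also have "\<dots> \<le> (\<Sum>\<delta> | mi_order \<delta> = k. epowr (epowr (?N \<delta>) ?r) (1 / ?r))"
    using r by (intro epowr_sum_le finite_mi_order) auto
  finally show ?thesis
    using r by (simp add: epowr_epowr)
qed

text \<open>Jensen's inequality for the power \<open>r\<close>, phrased with nonnegative integrals
  so that only measurability of \<open>G\<close> is assumed; an infinite right-hand side is harmless
  since \<open>h > 0\<close> in the remaining case.\<close>

lemma (in prob_space) powr_le_nn_integral_powr:
  fixes G :: "'a \<Rightarrow> real"
  assumes [measurable]: "G \<in> borel_measurable M" and "1 \<le> r" "0 \<le> y" "0 \<le> h"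
    and y: "ennreal y \<le> ennreal h * (\<integral>\<^sup>+\<omega>. ennreal \<bar>G \<omega>\<bar> \<partial>M)"
  shows "ennreal (y powr r) \<le> ennreal (h powr r) * (\<integral>\<^sup>+\<omega>. ennreal (\<bar>G \<omega>\<bar> powr r) \<partial>M)"
proof (cases "h = 0 \<or> y = 0")
  case True
  then have "y = 0" using assms by auto
  then show ?thesis by simp
next
  case False
  then have h: "h > 0" using assms by simp
  show ?thesis
  proof (cases "(\<integral>\<^sup>+\<omega>. ennreal (\<bar>G \<omega>\<bar> powr r) \<partial>M) = \<infinity>")
    case True
    then show ?thesis using h by (simp add: ennreal_mult_top)
  next
    case False
    then have iP: "integrable M (\<lambda>\<omega>. \<bar>G \<omega>\<bar> powr r)"
      by (simp add: integrable_iff_bounded less_top)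
    have iG: "integrable M (\<lambda>\<omega>. \<bar>G \<omega>\<bar>)"
    proof (rule Bochner_Integration.integrable_bound)
      show "integrable M (\<lambda>\<omega>. 1 + \<bar>G \<omega>\<bar> powr r)"
        using iP by simp
      have "t \<le> 1 + t powr r" if "t \<ge> 0" for t :: real
        using powr_mono[of 1 r t] \<open>1 \<le> r\<close> that by (cases "t \<le> 1") (auto intro: add_increasing2)
      then show "AE \<omega> in M. norm \<bar>G \<omega>\<bar> \<le> norm (1 + \<bar>G \<omega>\<bar> powr r)"
        by (auto intro: AE_I2)
    qed simp
    define I where "I = expectation (\<lambda>\<omega>. \<bar>G \<omega>\<bar>)"
    have I0: "I \<ge> 0"
      by (simp add: I_def)
    have yI: "y \<le> h * I"
      using y h iG by (simp add: nn_integral_eq_integral I_def ennreal_mult[symmetric] I0[unfolded I_def])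
    have "I powr r \<le> expectation (\<lambda>\<omega>. \<bar>G \<omega>\<bar> powr r)"
    proof (cases "r = 1")
      case True
      then show ?thesis using I0 by (simp add: I_def)
    next
      case r: False
      then have r: "r > 1" using assms by simp
      define q where "q = r / (r - 1)"
      have q: "q > 1" "1 / r + 1 / q = 1"
        using r by (auto simp: q_def field_simps)
      \<comment> \<open>With the second factor fixed at a power of the mean \<open>I\<close>,
        Young's inequality is the tangent line inequality of the power function at \<open>I\<close>.
        Taking expectations and absorbing \<open>I powr r * (1 - 1 / r)\<close> on the left yields
        Jensen.\<close>
      have young: "\<bar>G \<omega>\<bar> * I powr (r - 1) \<le> \<bar>G \<omega>\<bar> powr r / r + I powr r * (1 - 1 / r)" for \<omega>
      proof -
        have "(I powr (r - 1)) powr q = I powr r"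
          using r by (simp add: powr_powr q_def)
        moreover have "1 / q = 1 - 1 / r"
          using q by simp
        ultimately show ?thesis
          using Youngs_inequality[OF r q(1) q(2), of "\<bar>G \<omega>\<bar>" "I powr (r - 1)"]
          by (metis abs_ge_zero powr_ge_zero divide_inverse inverse_eq_divide)
      qed
      have "I * I powr (r - 1) = expectation (\<lambda>\<omega>. \<bar>G \<omega>\<bar> * I powr (r - 1))"
        by (simp add: I_def)
      also have "\<dots> \<le> expectation (\<lambda>\<omega>. \<bar>G \<omega>\<bar> powr r / r + I powr r * (1 - 1 / r))"
        by (rule integral_mono[OF _ _ young]) (use iG iP in auto)
      also have "\<dots> = expectation (\<lambda>\<omega>. \<bar>G \<omega>\<bar> powr r) / r + I powr r * (1 - 1 / r)"
        using iP by (simp add: prob_space)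
      also have "I * I powr (r - 1) = I powr r"
        using I0 r powr_mult_base[of I "r - 1"] by simp
      finally show ?thesis
        using r by (simp add: field_simps)
    qed
    then have "h powr r * I powr r \<le> h powr r * expectation (\<lambda>\<omega>. \<bar>G \<omega>\<bar> powr r)"
      by (intro mult_left_mono) auto
    moreover have "y powr r \<le> (h * I) powr r"
      using yI assms by (intro powr_mono2) auto
    moreover have "(h * I) powr r = h powr r * I powr r"
      using h I0 by (simp add: powr_mult)
    ultimately have "y powr r \<le> h powr r * expectation (\<lambda>\<omega>. \<bar>G \<omega>\<bar> powr r)"
      by linarith
    then show ?thesis
      using iP by (simp add: nn_integral_eq_integral ennreal_mult[symmetric] ennreal_leI)
  qed
qed

section \<open>Borel representatives, L^p norms and averaging\<close>

context convex_domain
begin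

lemma AE_lebesgue_on_K: "(AE x in lebesgue_on K. P x) \<longleftrightarrow> (AE x in \<mu>. P x)"
  by (subst AE_restrict_space_iff) (auto simp: AE_completion_iff AE_\<mu>_iff)

lemma nn_integral_lebesgue_on_K:
  assumes [measurable]: "f \<in> borel_measurable borel"
  shows "(\<integral>\<^sup>+x. f x \<partial>lebesgue_on K) = ennreal vol * (\<integral>\<^sup>+x. f x \<partial>\<mu>)"
proof -
  have "ennreal vol * (X / ennreal vol) = X" for X
    using vol_pos by (metis ennreal_mult_divide_eq ennreal_neq_top ennreal_eq_0_iff mult.commute
        ennreal_times_divide not_le)
  then show ?thesis
    by (simp add: nn_integral_restrict_space nn_integral_completion nn_integral_\<mu>)
qed

lemma integral_lebesgue_on_K:
  fixes f :: "real^2 \<Rightarrow> real"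
  assumes [measurable]: "f \<in> borel_measurable borel"
  shows "(\<integral>x. f x \<partial>lebesgue_on K) = vol * (\<integral>x. f x \<partial>\<mu>)"
  using vol_pos by (simp add: integral_restrict_space integral_completion integral_\<mu>)

text \<open>The function spaces are defined over completed Lebesgue measure, whereas composition
  with segment and polar maps calls for Borel functions. This is the passage between the
  two.\<close>

lemma borel_representative:
  fixes f :: "real^2 \<Rightarrow> real"
  assumes "f \<in> borel_measurable (lebesgue_on K)"
  obtains f' where "f' \<in> borel_measurable borel" "AE x in \<mu>. f x = f' x"
proof -
  have "(\<lambda>x. if x \<in> K then f x else 0) \<in> borel_measurable lebesgue"
    using assms by (intro borel_measurable_if_I) auto
  then obtain f' where f': "f' \<in> borel_measurable lborel" "AE x in lborel. (if x \<in> K then f x else 0) = f' x"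
    using completion_ex_borel_measurable_real by blast
  have "AE x in \<mu>. f x = f' x"
    unfolding AE_\<mu>_iff using f'(2) by eventually_elim auto
  then show ?thesis using that f'(1) by simp
qed

lemma measurable_lebesgue_on_AE:
  fixes f g :: "real^2 \<Rightarrow> real"
  assumes "g \<in> borel_measurable borel" "AE x in \<mu>. f x = g x"
  shows "f \<in> borel_measurable (lebesgue_on K)"
proof (rule borel_measurable_if_D)
  have "(\<lambda>x. if x \<in> K then g x else 0) \<in> borel_measurable borel"
    using assms(1) by measurable
  then have "(\<lambda>x. if x \<in> K then g x else 0) \<in> borel_measurable lebesgue"
    by (simp add: measurable_completion)
  moreover have "AE x in lebesgue. (if x \<in> K then g x else 0) = (if x \<in> K then f x else 0)"
    using assms(2) by (auto simp: AE_completion_iff AE_\<mu>_iff elim: eventually_mono)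
  ultimately show "(\<lambda>x. if x \<in> K then f x else 0) \<in> borel_measurable lebesgue"
    by (rule borel_measurable_AE)
qed

lemma Lp_norm_AE_cong:
  assumes "g \<in> borel_measurable borel" "AE x in \<mu>. f x = g x"
  shows "Lp_norm p K f = Lp_norm p K g"
proof -
  have [measurable]: "f \<in> borel_measurable (lebesgue_on K)" "g \<in> borel_measurable (lebesgue_on K)"
    using measurable_lebesgue_on_AE[OF assms] measurable_lebesgue_on_AE[OF assms(1), of g] by auto
  have ae: "AE x in lebesgue_on K. f x = g x"
    using assms(2) by (simp add: AE_lebesgue_on_K)
  have "esssup (lebesgue_on K) (\<lambda>x. ennreal \<bar>f x\<bar>) = esssup (lebesgue_on K) (\<lambda>x. ennreal \<bar>g x\<bar>)"
    using ae by (intro esssup_AE_cong) auto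
  moreover have "(\<integral>\<^sup>+x. ennreal (\<bar>f x\<bar> powr enn2real p) \<partial>lebesgue_on K) = (\<integral>\<^sup>+x. ennreal (\<bar>g x\<bar> powr enn2real p) \<partial>lebesgue_on K)"
    using ae by (intro nn_integral_cong_AE) auto
  ultimately show ?thesis
    unfolding Lp_norm_def by simp
qed

lemma Lp_norm_finite:
  assumes [measurable]: "f \<in> borel_measurable borel" and "p \<noteq> top"
  shows "Lp_norm p K f = epowr (ennreal vol * (\<integral>\<^sup>+x. ennreal (\<bar>f x\<bar> powr enn2real p) \<partial>\<mu>)) (1 / enn2real p)"
  using assms(2) by (simp add: Lp_norm_def nn_integral_lebesgue_on_K)

lemma Lp_norm_1:
  assumes [measurable]: "f \<in> borel_measurable borel"
  shows "Lp_norm 1 K f = ennreal vol * L1 f"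
  by (simp add: Lp_norm_finite epowr_def ennreal_enn2real_if)

lemma Lp_norm_topI:
  assumes [measurable]: "f \<in> borel_measurable borel" and "AE x in \<mu>. ennreal \<bar>f x\<bar> \<le> c"
  shows "Lp_norm top K f \<le> c"
proof -
  have [measurable]: "f \<in> borel_measurable (lebesgue_on K)"
    by (rule measurable_lebesgue_on_AE[OF assms(1)]) simp
  show ?thesis
    using assms(2) by (auto simp: Lp_norm_def AE_lebesgue_on_K intro!: esssup_I)
qed

lemma Lp_norm_top_AE: "AE x in \<mu>. ennreal \<bar>f x\<bar> \<le> Lp_norm top K f"
  using esssup_AE[of "\<lambda>x. ennreal \<bar>f x\<bar>" "lebesgue_on K"] by (simp add: Lp_norm_def AE_lebesgue_on_K)

lemma integrable_if_Lp_norm_finite: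
  assumes [measurable]: "f \<in> borel_measurable borel" and "1 \<le> p" "Lp_norm p K f < top"
  shows "integrable \<mu> f"
proof (cases "p = top")
  case True
  then obtain B where B: "Lp_norm top K f = ennreal B" "B \<ge> 0"
    using assms(3) by (cases "Lp_norm top K f") auto
  show ?thesis
  proof (rule integrable_const_bound[where B=B])
    show "AE x in \<mu>. norm (f x) \<le> B"
      using Lp_norm_top_AE[of f] unfolding B(1) by eventually_elim (use B(2) in simp)
  qed simp
next
  case False
  let ?r = "enn2real p"
  have r: "1 \<le> ?r" using enn2real_ge_1 assms False by blast
  have "(\<integral>\<^sup>+x. ennreal (\<bar>f x\<bar> powr ?r) \<partial>\<mu>) < \<infinity>"
    using assms(3) vol_pos False
    by (auto simp: Lp_norm_finite less_top[symmetric] epowr_eq_top_iff ennreal_mult_eq_top_iff)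
  then have "integrable \<mu> (\<lambda>x. \<bar>f x\<bar> powr ?r)"
    by (simp add: integrable_iff_bounded)
  then have i: "integrable \<mu> (\<lambda>x. 1 + \<bar>f x\<bar> powr ?r)"
    by simp
  have "t \<le> 1 + t powr ?r" if "t \<ge> 0" for t :: real
    using powr_mono[of 1 ?r t] r that by (cases "t \<le> 1") (auto intro: add_increasing2)
  then show ?thesis
    by (intro Bochner_Integration.integrable_bound[OF i]) (auto intro!: AE_I2)
qed

text \<open>Operators \<open>q \<mapsto> (\<lambda>x. \<integral> q (A x \<omega>) dN)\<close> of norm at most \<open>c\<close> on \<open>L\<^sup>1(\<mu>)\<close>. The requirement \<open>1 \<le> c\<close>
  makes \<open>c\<close> also a bound of the norm on every \<open>L\<^sup>p\<close>.\<close>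

definition averaging :: "'b measure \<Rightarrow> (real^2 \<Rightarrow> 'b \<Rightarrow> real^2) \<Rightarrow> real \<Rightarrow> bool" where
  "averaging N A c \<longleftrightarrow> prob_space N \<and> case_prod A \<in> borel \<Otimes>\<^sub>M N \<rightarrow>\<^sub>M borel \<and> 1 \<le> c \<and>
     (\<forall>q\<in>borel_measurable borel. (\<integral>\<^sup>+x. \<integral>\<^sup>+\<omega>. q (A x \<omega>) \<partial>N \<partial>\<mu>) \<le> ennreal c * (\<integral>\<^sup>+x. q x \<partial>\<mu>))"

text \<open>For finite \<open>p\<close>, Jensen is applied at each \<open>x\<close> and the L^1
  bound to the power of \<open>\<bar>g\<bar>\<close>; the resulting \<open>c powr (1 / p)\<close> is
  at most \<open>c\<close> because \<open>1 \<le> c\<close>. For \<open>p = top\<close> the L^1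
  bound is applied to the indicator of the null set where \<open>\<bar>g\<bar>\<close> exceeds its
  essential supremum: for almost every \<open>x\<close> the average does not see that set.\<close>

lemma Lp_norm_averaging_le:
  assumes "averaging N A c" and p: "1 \<le> p" and "0 \<le> h"
    and [measurable]: "F \<in> borel_measurable borel" "g \<in> borel_measurable borel"
    and le: "AE x in \<mu>. ennreal \<bar>F x\<bar> \<le> ennreal h * (\<integral>\<^sup>+\<omega>. ennreal \<bar>g (A x \<omega>)\<bar> \<partial>N)"
  shows "Lp_norm p K F \<le> ennreal (h * c) * Lp_norm p K g"
proof -
  interpret N: prob_space N using assms(1) by (simp add: averaging_def)
  have A[measurable]: "case_prod A \<in> borel \<Otimes>\<^sub>M N \<rightarrow>\<^sub>M borel" and c: "1 \<le> c"
    and avg: "\<And>q. q \<in> borel_measurable borel \<Longrightarrow> (\<integral>\<^sup>+x. \<integral>\<^sup>+\<omega>. q (A x \<omega>) \<partial>N \<partial>\<mu>) \<le> ennreal c * (\<integral>\<^sup>+x. q x \<partial>\<mu>)"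
    using assms(1) by (auto simp: averaging_def)
  have Ax[measurable]: "A x \<in> N \<rightarrow>\<^sub>M borel" for x
    using measurable_compose[OF measurable_Pair1' A, of x] by simp
  show ?thesis
  proof (cases "p = top")
    case True
    define M where "M = Lp_norm top K g"
    define B where "B = {x. \<not> ennreal \<bar>g x\<bar> \<le> M}"
    have [measurable]: "B \<in> sets borel"
      unfolding B_def by measurable
    have B0: "(\<integral>\<^sup>+x. indicator B x \<partial>\<mu>) = 0"
      using Lp_norm_top_AE[of g] by (subst nn_integral_0_iff_AE) (auto simp: B_def M_def indicator_def)
    then have "(\<integral>\<^sup>+x. \<integral>\<^sup>+\<omega>. indicator B (A x \<omega>) \<partial>N \<partial>\<mu>) = 0"
      using avg[of "indicator B"] unfolding B0 by (simp add: \<open>B \<in> sets borel\<close> borel_measurable_indicator)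
    then have "AE x in \<mu>. (\<integral>\<^sup>+\<omega>. indicator B (A x \<omega>) \<partial>N) = 0"
      by (subst (asm) nn_integral_0_iff_AE) auto
    with le have "AE x in \<mu>. ennreal \<bar>F x\<bar> \<le> ennreal h * M"
    proof eventually_elim
      case (elim x)
      have "AE \<omega> in N. indicator B (A x \<omega>) = (0 :: ennreal)"
        using elim(2) by (subst (asm) nn_integral_0_iff_AE) auto
      then have "AE \<omega> in N. ennreal \<bar>g (A x \<omega>)\<bar> \<le> M"
        by eventually_elim (auto simp: B_def indicator_def split: if_splits)
      then have "(\<integral>\<^sup>+\<omega>. ennreal \<bar>g (A x \<omega>)\<bar> \<partial>N) \<le> (\<integral>\<^sup>+\<omega>. M \<partial>N)"
        by (rule nn_integral_mono_AE)
      then have "ennreal h * (\<integral>\<^sup>+\<omega>. ennreal \<bar>g (A x \<omega>)\<bar> \<partial>N) \<le> ennreal h * M"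
        by (intro mult_left_mono) (simp_all add: N.emeasure_space_1)
      with elim(1) show ?case by (rule order_trans)
    qed
    then have "Lp_norm p K F \<le> ennreal h * M"
      unfolding True by (intro Lp_norm_topI) auto
    also have "\<dots> \<le> ennreal (h * c) * M"
      using c \<open>0 \<le> h\<close> mult_left_mono[of 1 c h] by (intro mult_right_mono ennreal_leI) auto
    finally show ?thesis by (simp add: M_def True)
  next
    case False
    let ?r = "enn2real p"
    have r: "1 \<le> ?r" using enn2real_ge_1 p False by blast
    have "(\<integral>\<^sup>+x. ennreal (\<bar>F x\<bar> powr ?r) \<partial>\<mu>)
        \<le> (\<integral>\<^sup>+x. ennreal (h powr ?r) * (\<integral>\<^sup>+\<omega>. ennreal (\<bar>g (A x \<omega>)\<bar> powr ?r) \<partial>N) \<partial>\<mu>)"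
      using le by (intro nn_integral_mono_AE, elim eventually_mono)
        (intro N.powr_le_nn_integral_powr r \<open>0 \<le> h\<close>; simp)
    also have "\<dots> = ennreal (h powr ?r) * (\<integral>\<^sup>+x. \<integral>\<^sup>+\<omega>. ennreal (\<bar>g (A x \<omega>)\<bar> powr ?r) \<partial>N \<partial>\<mu>)"
      by (rule nn_integral_cmult) measurable
    also have "\<dots> \<le> ennreal (h powr ?r) * (ennreal c * (\<integral>\<^sup>+x. ennreal (\<bar>g x\<bar> powr ?r) \<partial>\<mu>))"
      by (intro mult_left_mono avg) auto
    finally have "ennreal vol * (\<integral>\<^sup>+x. ennreal (\<bar>F x\<bar> powr ?r) \<partial>\<mu>)
        \<le> ennreal vol * (ennreal (h powr ?r) * (ennreal c * (\<integral>\<^sup>+x. ennreal (\<bar>g x\<bar> powr ?r) \<partial>\<mu>)))"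
      by (rule mult_left_mono) simp
    also have "\<dots> = ennreal (h powr ?r * c) * (ennreal vol * (\<integral>\<^sup>+x. ennreal (\<bar>g x\<bar> powr ?r) \<partial>\<mu>))"
      using c by (simp add: ennreal_mult mult_ac)
    finally have "Lp_norm p K F \<le> epowr (ennreal (h powr ?r * c) * (ennreal vol * (\<integral>\<^sup>+x. ennreal (\<bar>g x\<bar> powr ?r) \<partial>\<mu>))) (1 / ?r)"
      using False r by (simp add: Lp_norm_finite epowr_mono)
    also have "\<dots> = ennreal ((h powr ?r * c) powr (1 / ?r)) * Lp_norm p K g"
      using False r c by (subst epowr_mult) (auto simp: Lp_norm_finite)
    also have "(h powr ?r * c) powr (1 / ?r) = h * c powr (1 / ?r)"
      using r c \<open>0 \<le> h\<close> by (simp add: powr_mult powr_powr)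
    also have "ennreal (h * c powr (1 / ?r)) * Lp_norm p K g \<le> ennreal (h * c) * Lp_norm p K g"
      using powr_mono[of "1 / ?r" 1 c] r c \<open>0 \<le> h\<close>
      by (intro mult_right_mono ennreal_leI mult_left_mono) auto
    finally show ?thesis .
  qed
qed

text \<open>Evaluation at \<open>x\<close> and the mean over K are averaging operators of norm 1.
  Through them the general bound also yields domination of norms and the estimate of a constant by a
  mean.\<close>

lemma averaging_self: "averaging \<mu> (\<lambda>x \<omega>. x) 1"
  unfolding averaging_def by (auto simp: prob_space_axioms)

lemma averaging_mean: "averaging \<mu> (\<lambda>x \<omega>. \<omega>) 1"
  unfolding averaging_def by (auto simp: prob_space_axioms)

lemma averaging_segments: "averaging segments (\<lambda>x q. (1 - snd q) *\<^sub>R x + snd q *\<^sub>R fst q) 4"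
  unfolding averaging_def using nn_integral_segments_le prob_space_segments
  by (auto simp: case_prod_unfold)

lemma Lp_norm_scale_le:
  assumes "1 \<le> p" "0 \<le> h" and [measurable]: "F \<in> borel_measurable borel" "g \<in> borel_measurable borel"
    and "AE x in \<mu>. \<bar>F x\<bar> \<le> h * \<bar>g x\<bar>"
  shows "Lp_norm p K F \<le> ennreal h * Lp_norm p K g"
  using Lp_norm_averaging_le[OF averaging_self assms(1-4)] assms(5) \<open>0 \<le> h\<close>
  by (simp add: ennreal_mult[symmetric] ennreal_leI)

lemma Lp_norm_const_le:
  assumes "1 \<le> p" "0 \<le> h" and [measurable]: "g \<in> borel_measurable borel"
    and "ennreal \<bar>c\<bar> \<le> ennreal h * L1 g"
  shows "Lp_norm p K (\<lambda>x. c) \<le> ennreal h * Lp_norm p K g"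
  using Lp_norm_averaging_le[OF averaging_mean assms(1,2), of "\<lambda>x. c" g] assms(4) by simp

text \<open>A substitute for Minkowski's inequality:
  \<open>(b + c)^r \<le> 2^r * (b^r + c^r)\<close>, followed by subadditivity of the root. The root
  turns \<open>2^r\<close> into 2, so the loss is the same for every exponent.\<close>

lemma Lp_norm_add_le:
  assumes p: "1 \<le> p"
    and [measurable]: "F \<in> borel_measurable borel" "f \<in> borel_measurable borel" "g \<in> borel_measurable borel"
    and le: "AE x in \<mu>. \<bar>F x\<bar> \<le> \<bar>f x\<bar> + \<bar>g x\<bar>"
  shows "Lp_norm p K F \<le> 2 * (Lp_norm p K f + Lp_norm p K g)"
proof (cases "p = top")
  case True
  have "AE x in \<mu>. ennreal \<bar>F x\<bar> \<le> Lp_norm top K f + Lp_norm top K g"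
    using le Lp_norm_top_AE[of f] Lp_norm_top_AE[of g]
  proof eventually_elim
    case (elim x)
    then have "ennreal \<bar>F x\<bar> \<le> ennreal \<bar>f x\<bar> + ennreal \<bar>g x\<bar>"
      by (simp flip: ennreal_plus)
    also have "\<dots> \<le> Lp_norm top K f + Lp_norm top K g"
      using elim by (intro add_mono)
    finally show ?case .
  qed
  then have "Lp_norm top K F \<le> Lp_norm top K f + Lp_norm top K g"
    by (intro Lp_norm_topI) auto
  also have "\<dots> \<le> 2 * (Lp_norm top K f + Lp_norm top K g)"
    by (simp add: mult_2)
  finally show ?thesis using True by simp
next
  case False
  let ?r = "enn2real p"
  let ?I = "\<lambda>f. \<integral>\<^sup>+x. ennreal (\<bar>f x\<bar> powr ?r) \<partial>\<mu>"
  have r: "1 \<le> ?r" using enn2real_ge_1 p False by blast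
  have pw: "a powr ?r \<le> 2 powr ?r * (b powr ?r + c powr ?r)" if "0 \<le> a" "a \<le> b + c" "0 \<le> b" "0 \<le> c" for a b c
  proof -
    have "a powr ?r \<le> (2 * max b c) powr ?r"
      using that r by (intro powr_mono2) auto
    also have "\<dots> = 2 powr ?r * (max b c) powr ?r"
      using that by (simp add: powr_mult)
    also have "\<dots> \<le> 2 powr ?r * (b powr ?r + c powr ?r)"
      by (intro mult_left_mono) (auto simp: max_def)
    finally show ?thesis .
  qed
  have "?I F \<le> (\<integral>\<^sup>+x. ennreal (2 powr ?r) * (ennreal (\<bar>f x\<bar> powr ?r) + ennreal (\<bar>g x\<bar> powr ?r)) \<partial>\<mu>)"
    using le by (intro nn_integral_mono_AE, elim eventually_mono)
      (simp add: ennreal_plus[symmetric] ennreal_mult[symmetric] ennreal_leI pw del: ennreal_plus)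
  also have "\<dots> = ennreal (2 powr ?r) * (?I f + ?I g)"
    by (simp add: nn_integral_cmult nn_integral_add)
  finally have "ennreal vol * ?I F \<le> ennreal vol * (ennreal (2 powr ?r) * (?I f + ?I g))"
    by (rule mult_left_mono) simp
  also have "\<dots> = ennreal (2 powr ?r) * (ennreal vol * ?I f + ennreal vol * ?I g)"
    by (simp add: algebra_simps)
  finally have "Lp_norm p K F \<le> epowr (ennreal (2 powr ?r) * (ennreal vol * ?I f + ennreal vol * ?I g)) (1 / ?r)"
    using False r by (simp add: Lp_norm_finite epowr_mono)
  also have "\<dots> = 2 * epowr (ennreal vol * ?I f + ennreal vol * ?I g) (1 / ?r)"
    using r by (subst epowr_mult) (auto simp: powr_powr)
  also have "\<dots> \<le> 2 * (Lp_norm p K f + Lp_norm p K g)"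
    using r False by (intro mult_left_mono) (auto simp: Lp_norm_finite intro!: epowr_add_le)
  finally show ?thesis .
qed

lemma prob_UNIV [simp]: "prob UNIV = 1"
  using prob_space by simp

section \<open>The Poincare inequality\<close>

lemma weak_grad_measurable:
  assumes "weak_grad u w"
  shows "u \<in> borel_measurable borel" "w i \<in> borel_measurable borel"
  using assms borel_measurable_integrable[of \<mu> u] borel_measurable_integrable[of \<mu> "w i"]
  by (auto simp: weak_grad_def)

text \<open>The l^1 norm of the gradient: it dominates derivatives along segments coordinate by
  coordinate and compares with the seminorm of any exponent up to a numerical factor.\<close>

definition grad1 :: "(2 \<Rightarrow> real^2 \<Rightarrow> real) \<Rightarrow> real^2 \<Rightarrow> real" where
  "grad1 w x = \<bar>w 1 x\<bar> + \<bar>w 2 x\<bar>"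

lemma grad1_nonneg: "grad1 w x \<ge> 0"
  by (simp add: grad1_def)

lemma grad1_measurable [measurable]:
  assumes [measurable]: "\<And>i. w i \<in> borel_measurable M"
  shows "grad1 w \<in> borel_measurable M"
  unfolding grad1_def[abs_def] by measurable

definition segment_mean :: "(real^2 \<Rightarrow> ennreal) \<Rightarrow> real^2 \<Rightarrow> ennreal" where
  "segment_mean q x = (\<integral>\<^sup>+p. q ((1 - snd p) *\<^sub>R x + snd p *\<^sub>R fst p) \<partial>segments)"

lemma segment_mean_measurable [measurable]:
  assumes [measurable]: "q \<in> borel_measurable borel"
  shows "segment_mean q \<in> borel_measurable borel"
proof -
  interpret S: prob_space segments by (rule prob_space_segments)
  show ?thesis
    unfolding segment_mean_def[abs_def] by measurable
qed

lemma norm_diff_le_diameter: "x \<in> K \<Longrightarrow> y \<in> K \<Longrightarrow> norm (x - y) \<le> diameter K"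
  using diameter_bounded_bound[OF bounded_K] by (simp add: dist_norm)

lemma smooth_segment_bound:
  assumes "smooth \<phi>" "x \<in> K" "y \<in> K"
  shows "ennreal \<bar>\<phi> x - \<phi> y\<bar>
    \<le> ennreal (diameter K) * (\<integral>\<^sup>+t. ennreal (grad1 (\<lambda>i. partial_deriv i \<phi>) ((1 - t) *\<^sub>R x + t *\<^sub>R y)) \<partial>uniform_measure lborel {0..1})"
proof -
  let ?U = "uniform_measure lborel {0..1::real}"
  let ?\<gamma> = "\<lambda>t. (1 - t) *\<^sub>R x + t *\<^sub>R y"
  let ?d = "\<lambda>t. (y - x) $ 1 * partial_deriv 1 \<phi> (?\<gamma> t) + (y - x) $ 2 * partial_deriv 2 \<phi> (?\<gamma> t)"
  have cont: "continuous_on S (\<lambda>t. partial_deriv i \<phi> (?\<gamma> t))" for i S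
    by (rule continuous_on_compose2[OF smooth_continuous_on[OF smooth_partial_deriv[OF assms(1)], of UNIV]])
       (auto intro!: continuous_intros)
  have "(?\<gamma> has_derivative (\<lambda>h. h *\<^sub>R (y - x))) (at t)" for t
    by (auto intro!: derivative_eq_intros simp: algebra_simps)
  from has_derivative_compose[OF this smooth_has_derivative[OF assms(1)]]
  have "((\<lambda>t. \<phi> (?\<gamma> t)) has_derivative (\<lambda>h. h * ?d t)) (at t)" for t
    by (simp add: algebra_simps)
  then have D: "((\<lambda>t. \<phi> (?\<gamma> t)) has_real_derivative ?d t) (at t)" for t
    by (simp add: has_field_derivative_def mult_commute_abs)
  have contd: "continuous_on UNIV ?d"
    by (intro continuous_intros cont)
  have int: "integrable lborel (\<lambda>t. indicator {0..1} t *\<^sub>R ?d t)"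
    by (intro borel_integrable_compact compact_Icc continuous_on_subset[OF contd]) auto
  have "(\<integral>t. ?d t * indicator {0..1} t \<partial>lborel) = \<phi> (?\<gamma> 1) - \<phi> (?\<gamma> 0)"
    by (intro integral_FTC_Icc_real D) (use contd in \<open>auto simp: continuous_on_eq_continuous_at\<close>)
  then have "\<bar>\<phi> x - \<phi> y\<bar> = \<bar>\<integral>t. indicator {0..1} t *\<^sub>R ?d t \<partial>lborel\<bar>"
    by (simp add: mult.commute)
  then have "ennreal \<bar>\<phi> x - \<phi> y\<bar> \<le> (\<integral>\<^sup>+t. ennreal (norm (indicator {0..1} t *\<^sub>R ?d t)) \<partial>lborel)"
    using integral_norm_bound_ennreal[OF int] by simp
  also have "\<dots> \<le> (\<integral>\<^sup>+t. ennreal (diameter K) * ennreal (grad1 (\<lambda>i. partial_deriv i \<phi>) (?\<gamma> t)) * indicator {0..1} t \<partial>lborel)"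
  proof (rule nn_integral_mono)
    fix t :: real
    have c: "\<bar>(y - x) $ i\<bar> \<le> diameter K" for i
      using component_le_norm_cart[of "y - x" i] norm_diff_le_diameter[OF assms(3,2)] by linarith
    have "\<bar>?d t\<bar> \<le> \<bar>(y - x) $ 1\<bar> * \<bar>partial_deriv 1 \<phi> (?\<gamma> t)\<bar> + \<bar>(y - x) $ 2\<bar> * \<bar>partial_deriv 2 \<phi> (?\<gamma> t)\<bar>"
      by (rule order_trans[OF abs_triangle_ineq]) (simp add: abs_mult)
    also have "\<dots> \<le> diameter K * \<bar>partial_deriv 1 \<phi> (?\<gamma> t)\<bar> + diameter K * \<bar>partial_deriv 2 \<phi> (?\<gamma> t)\<bar>"
      by (intro add_mono mult_right_mono c) auto
    also have "\<dots> = diameter K * grad1 (\<lambda>i. partial_deriv i \<phi>) (?\<gamma> t)"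
      by (simp add: grad1_def algebra_simps)
    finally have "ennreal \<bar>?d t\<bar> \<le> ennreal (diameter K) * ennreal (grad1 (\<lambda>i. partial_deriv i \<phi>) (?\<gamma> t))"
      using diameter_ge_0[OF bounded_K] by (simp add: ennreal_mult[symmetric] grad1_nonneg ennreal_leI)
    then show "ennreal (norm (indicator {0..1} t *\<^sub>R ?d t))
        \<le> ennreal (diameter K) * ennreal (grad1 (\<lambda>i. partial_deriv i \<phi>) (?\<gamma> t)) * indicator {0..1} t"
      by (auto simp: indicator_def)
  qed
  also have "\<dots> = ennreal (diameter K) * (\<integral>\<^sup>+t. ennreal (grad1 (\<lambda>i. partial_deriv i \<phi>) (?\<gamma> t)) \<partial>?U)"
  proof -
    have [measurable]: "(\<lambda>t. ennreal (grad1 (\<lambda>i. partial_deriv i \<phi>) (?\<gamma> t))) \<in> borel_measurable borel"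
      unfolding grad1_def by (intro measurable_compose[OF _ measurable_ennreal] borel_measurable_add borel_measurable_abs
          borel_measurable_continuous_onI cont)
    show ?thesis
      by (simp add: nn_integral_uniform_measure nn_integral_cmult mult.assoc divide_ennreal_def)
  qed
  finally show ?thesis .
qed

lemma smooth_mean_bound:
  assumes "smooth \<phi>" "x \<in> K"
  shows "ennreal \<bar>\<phi> x - (\<integral>y. \<phi> y \<partial>\<mu>)\<bar>
    \<le> ennreal (diameter K) * segment_mean (\<lambda>z. ennreal (grad1 (\<lambda>i. partial_deriv i \<phi>) z)) x"
proof -
  interpret U: prob_space "uniform_measure lborel {0..1::real}" by (rule prob_space_unit)
  have [measurable_cong]: "sets (uniform_measure lborel {0..1::real}) = sets borel"
    by simp
  have [measurable]: "partial_deriv i \<phi> \<in> borel_measurable borel" for i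
    using smooth_measurable[OF smooth_partial_deriv[OF assms(1)]] .
  have int: "integrable \<mu> \<phi>"
    by (rule integrable_\<mu>_continuous[OF smooth_continuous_on[OF assms(1)]])
  then have "\<phi> x - (\<integral>y. \<phi> y \<partial>\<mu>) = (\<integral>y. \<phi> x - \<phi> y \<partial>\<mu>)"
    by simp
  then have "ennreal \<bar>\<phi> x - (\<integral>y. \<phi> y \<partial>\<mu>)\<bar> \<le> L1 (\<lambda>y. \<phi> x - \<phi> y)"
    using integral_norm_bound_ennreal[of \<mu> "\<lambda>y. \<phi> x - \<phi> y"] int by simp
  also have "\<dots> \<le> (\<integral>\<^sup>+y. ennreal (diameter K) * (\<integral>\<^sup>+t. ennreal (grad1 (\<lambda>i. partial_deriv i \<phi>)
      ((1 - t) *\<^sub>R x + t *\<^sub>R y)) \<partial>uniform_measure lborel {0..1}) \<partial>\<mu>)"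
    by (intro nn_integral_mono_AE eventually_mono[OF AE_in_K] smooth_segment_bound assms)
  also have "\<dots> = ennreal (diameter K) * (\<integral>\<^sup>+y. \<integral>\<^sup>+t. ennreal (grad1 (\<lambda>i. partial_deriv i \<phi>)
      ((1 - t) *\<^sub>R x + t *\<^sub>R y)) \<partial>uniform_measure lborel {0..1} \<partial>\<mu>)"
    by (rule nn_integral_cmult) measurable
  also have "(\<integral>\<^sup>+y. \<integral>\<^sup>+t. ennreal (grad1 (\<lambda>i. partial_deriv i \<phi>)
      ((1 - t) *\<^sub>R x + t *\<^sub>R y)) \<partial>uniform_measure lborel {0..1} \<partial>\<mu>)
      = segment_mean (\<lambda>z. ennreal (grad1 (\<lambda>i. partial_deriv i \<phi>) z)) x"
  proof -
    have "(\<lambda>p. ennreal (grad1 (\<lambda>i. partial_deriv i \<phi>) ((1 - snd p) *\<^sub>R x + snd p *\<^sub>R fst p)))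
        \<in> borel_measurable (\<mu> \<Otimes>\<^sub>M uniform_measure lborel {0..1})"
      by measurable
    from U.nn_integral_fst[OF this] show ?thesis
      unfolding segment_mean_def segments_def by simp
  qed
  finally show ?thesis .
qed

lemma nn_integral_segment_mean_le:
  "q \<in> borel_measurable borel \<Longrightarrow> (\<integral>\<^sup>+x. segment_mean q x \<partial>\<mu>) \<le> 4 * (\<integral>\<^sup>+x. q x \<partial>\<mu>)"
  unfolding segment_mean_def by (rule nn_integral_segments_le)

text \<open>The pointwise bound passes to the limit in \<open>L\<^sup>1\<close>: the excess of the left over the right side
  has integral zero. Working pointwise makes one density theorem suffice for all exponents.\<close>

lemma poincare_AE:
  assumes "weak_grad u w"
  shows "AE x in \<mu>. ennreal \<bar>u x - (\<integral>y. u y \<partial>\<mu>)\<bar>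
    \<le> ennreal (diameter K) * segment_mean (\<lambda>z. ennreal (grad1 w z)) x"
proof -
  let ?D = "ennreal (diameter K)"
  have u: "integrable \<mu> u" and w: "\<And>i. integrable \<mu> (w i)"
    using assms by (auto simp: weak_grad_def)
  have [measurable]: "u \<in> borel_measurable borel" "w i \<in> borel_measurable borel" for i
    using weak_grad_measurable[OF assms] by auto
  obtain \<phi> :: "nat \<Rightarrow> real^2 \<Rightarrow> real" where \<phi>: "\<And>n. smooth (\<phi> n)"
    and lim: "(\<lambda>n. L1 (\<lambda>x. \<phi> n x - u x)) \<longlonglongrightarrow> 0"
    "\<And>i. (\<lambda>n. L1 (\<lambda>x. partial_deriv i (\<phi> n) x - w i x)) \<longlonglongrightarrow> 0"
    by (rule weak_grad_approx[OF assms]) (rule that)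
  have [measurable]: "\<phi> n \<in> borel_measurable borel" "partial_deriv i (\<phi> n) \<in> borel_measurable borel" for n i
    using smooth_measurable[OF \<phi>] smooth_measurable[OF smooth_partial_deriv[OF \<phi>]] by auto
  \<comment> \<open>Subtraction of extended nonnegative reals is truncated at 0 and the left term is
    finite, so \<open>X\<close> vanishes exactly where the bound holds.\<close>
  define X where "X x = ennreal \<bar>u x - (\<integral>y. u y \<partial>\<mu>)\<bar> - ?D * segment_mean (\<lambda>z. ennreal (grad1 w z)) x" for x
  have [measurable]: "X \<in> borel_measurable borel"
    unfolding X_def[abs_def] by measurable
  let ?e = "\<lambda>n x. ennreal \<bar>\<phi> n x - u x\<bar>"
  let ?d = "\<lambda>n x. ennreal \<bar>partial_deriv 1 (\<phi> n) x - w 1 x\<bar> + ennreal \<bar>partial_deriv 2 (\<phi> n) x - w 2 x\<bar>"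
  have X_le: "X x \<le> ?e n x + (\<integral>\<^sup>+y. ?e n y \<partial>\<mu>) + ?D * segment_mean (?d n) x" if "x \<in> K" for n x
  proof -
    have mean: "ennreal \<bar>(\<integral>y. \<phi> n y \<partial>\<mu>) - (\<integral>y. u y \<partial>\<mu>)\<bar> \<le> (\<integral>\<^sup>+y. ?e n y \<partial>\<mu>)"
    proof -
      have i: "integrable \<mu> (\<phi> n)"
        by (rule integrable_\<mu>_continuous[OF smooth_continuous_on[OF \<phi>]])
      show ?thesis
        using integral_norm_bound_ennreal[of \<mu> "\<lambda>y. \<phi> n y - u y"] i u by simp
    qed
    have seg: "segment_mean (\<lambda>z. ennreal (grad1 (\<lambda>i. partial_deriv i (\<phi> n)) z)) x
        \<le> segment_mean (\<lambda>z. ennreal (grad1 w z)) x + segment_mean (?d n) x"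
    proof -
      have "ennreal (grad1 (\<lambda>i. partial_deriv i (\<phi> n)) z) \<le> ennreal (grad1 w z) + ?d n z" for z
        unfolding grad1_def by (intro ennreal_le_plus) auto
      then have "segment_mean (\<lambda>z. ennreal (grad1 (\<lambda>i. partial_deriv i (\<phi> n)) z)) x
        \<le> segment_mean (\<lambda>z. ennreal (grad1 w z) + ?d n z) x"
        unfolding segment_mean_def by (intro nn_integral_mono)
      also have "\<dots> = segment_mean (\<lambda>z. ennreal (grad1 w z)) x + segment_mean (?d n) x"
        unfolding segment_mean_def by (rule nn_integral_add) measurable
      finally show ?thesis .
    qed
    have "ennreal \<bar>u x - (\<integral>y. u y \<partial>\<mu>)\<bar> \<le> ?e n x + (ennreal \<bar>\<phi> n x - (\<integral>y. \<phi> n y \<partial>\<mu>)\<bar>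
        + ennreal \<bar>(\<integral>y. \<phi> n y \<partial>\<mu>) - (\<integral>y. u y \<partial>\<mu>)\<bar>)"
      by (intro ennreal_le_plus) auto
    also have "\<dots> \<le> ?e n x + (?D * (segment_mean (\<lambda>z. ennreal (grad1 w z)) x + segment_mean (?d n) x) + (\<integral>\<^sup>+y. ?e n y \<partial>\<mu>))"
      by (intro add_mono order_refl mean order_trans[OF smooth_mean_bound[OF \<phi> that]] mult_left_mono seg) auto
    also have "\<dots> = ?D * segment_mean (\<lambda>z. ennreal (grad1 w z)) x
        + (?e n x + (\<integral>\<^sup>+y. ?e n y \<partial>\<mu>) + ?D * segment_mean (?d n) x)"
      by (simp add: distrib_left ac_simps)
    finally show ?thesis
      unfolding X_def by (simp add: ennreal_minus_le_iff)
  qed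
  have "(\<integral>\<^sup>+x. X x \<partial>\<mu>) \<le> (\<integral>\<^sup>+x. ?e n x \<partial>\<mu>) + (\<integral>\<^sup>+x. ?e n x \<partial>\<mu>)
      + ?D * (4 * (L1 (\<lambda>x. partial_deriv 1 (\<phi> n) x - w 1 x) + L1 (\<lambda>x. partial_deriv 2 (\<phi> n) x - w 2 x)))" for n
  proof -
    have "(\<integral>\<^sup>+x. X x \<partial>\<mu>) \<le> (\<integral>\<^sup>+x. ?e n x + (\<integral>\<^sup>+y. ?e n y \<partial>\<mu>) + ?D * segment_mean (?d n) x \<partial>\<mu>)"
      by (intro nn_integral_mono_AE eventually_mono[OF AE_in_K] X_le)
    also have "\<dots> = (\<integral>\<^sup>+x. ?e n x \<partial>\<mu>) + (\<integral>\<^sup>+x. ?e n x \<partial>\<mu>) + ?D * (\<integral>\<^sup>+x. segment_mean (?d n) x \<partial>\<mu>)"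
    proof -
      define c where "c = (\<integral>\<^sup>+y. ?e n y \<partial>\<mu>)"
      have "(\<integral>\<^sup>+x. ?e n x + c + ?D * segment_mean (?d n) x \<partial>\<mu>)
          = (\<integral>\<^sup>+x. ?e n x + c \<partial>\<mu>) + (\<integral>\<^sup>+x. ?D * segment_mean (?d n) x \<partial>\<mu>)"
        by (rule nn_integral_add) measurable
      also have "(\<integral>\<^sup>+x. ?D * segment_mean (?d n) x \<partial>\<mu>) = ?D * (\<integral>\<^sup>+x. segment_mean (?d n) x \<partial>\<mu>)"
        by (rule nn_integral_cmult) measurable
      also have "(\<integral>\<^sup>+x. ?e n x + c \<partial>\<mu>) = (\<integral>\<^sup>+x. ?e n x \<partial>\<mu>) + (\<integral>\<^sup>+x. c \<partial>\<mu>)"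
        by (rule nn_integral_add) measurable
      finally show ?thesis
        by (simp only: nn_integral_const_\<mu> c_def)
    qed
    also have "\<dots> \<le> (\<integral>\<^sup>+x. ?e n x \<partial>\<mu>) + (\<integral>\<^sup>+x. ?e n x \<partial>\<mu>) + ?D * (4 * (\<integral>\<^sup>+x. ?d n x \<partial>\<mu>))"
      by (intro add_left_mono mult_left_mono nn_integral_segment_mean_le) auto
    finally show ?thesis
      by (simp add: nn_integral_add)
  qed
  moreover have "(\<lambda>n. (\<integral>\<^sup>+x. ?e n x \<partial>\<mu>) + (\<integral>\<^sup>+x. ?e n x \<partial>\<mu>)
      + ?D * (4 * (L1 (\<lambda>x. partial_deriv 1 (\<phi> n) x - w 1 x) + L1 (\<lambda>x. partial_deriv 2 (\<phi> n) x - w 2 x))))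
      \<longlonglongrightarrow> 0 + 0 + ?D * (4 * (0 + 0))"
    by (intro tendsto_add tendsto_mult_ennreal tendsto_const lim) auto
  ultimately have "(\<integral>\<^sup>+x. X x \<partial>\<mu>) \<le> 0 + 0 + ?D * (4 * (0 + 0))"
    by (intro LIMSEQ_le_const) auto
  then have "AE x in \<mu>. X x = 0"
    by (simp add: nn_integral_0_iff_AE)
  then show ?thesis
    by eventually_elim (auto simp: X_def diff_eq_0_iff_ennreal)
qed

lemma Lp_norm_grad1_le:
  assumes "1 \<le> p" and [measurable]: "\<And>i. w i \<in> borel_measurable borel"
  shows "Lp_norm p K (grad1 w) \<le> 2 * (Lp_norm p K (w 1) + Lp_norm p K (w 2))"
  by (intro Lp_norm_add_le assms grad1_measurable) (auto simp: grad1_def)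

lemma poincare_Lp:
  assumes "weak_grad u w" "1 \<le> p"
  shows "Lp_norm p K (\<lambda>x. u x - (\<integral>y. u y \<partial>\<mu>)) \<le> ennreal (diameter K * 4) * Lp_norm p K (grad1 w)"
proof -
  have [measurable]: "u \<in> borel_measurable borel" "w i \<in> borel_measurable borel" for i
    using weak_grad_measurable[OF assms(1)] by auto
  show ?thesis
    using poincare_AE[OF assms(1)]
    by (intro Lp_norm_averaging_le[OF averaging_segments assms(2)] diameter_ge_0 bounded_K)
       (auto simp: segment_mean_def grad1_nonneg)
qed

end

subsection \<open>Sobolev functions and weak gradients\<close>

lemma mi_deriv_simps:
  "mi_deriv (0, 0) f = f" "mi_deriv (1, 0) f = partial_deriv 1 f" "mi_deriv (0, 1) f = partial_deriv 2 f"
  "mi_deriv (Suc 0, 0) f = partial_deriv 1 f" "mi_deriv (0, Suc 0) f = partial_deriv 2 f"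
  by (simp_all add: mi_deriv_def)

lemma mi_deriv_test_functions:
  assumes "\<phi> \<in> test_functions K"
  shows "mi_deriv \<delta> \<phi> \<in> test_functions K"
proof -
  have *: "(partial_deriv i ^^ n) \<psi> \<in> test_functions K" if "\<psi> \<in> test_functions K" for i n \<psi>
    using that by (induction n) (auto intro: partial_deriv_test_functions)
  show ?thesis
    unfolding mi_deriv_def by (intro * assms)
qed

lemma test_function_bounded:
  assumes "\<phi> \<in> test_functions K"
  obtains B where "\<And>x. \<bar>\<phi> x\<bar> \<le> B"
proof -
  obtain S where S: "smooth \<phi>" "compact S" "\<And>x. x \<notin> S \<Longrightarrow> \<phi> x = 0"
    using test_functionsE[OF assms] by metis
  have "bounded (\<phi> ` S)"
    by (intro compact_imp_bounded compact_continuous_image smooth_continuous_on S)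
  then obtain B where B: "B > 0" "\<forall>x\<in>S. \<bar>\<phi> x\<bar> \<le> B"
    by (auto simp: bounded_pos)
  have "\<bar>\<phi> x\<bar> \<le> B" for x
    using B S(3)[of x] by (cases "x \<in> S") auto
  then show ?thesis using that by blast
qed

lemma test_functions_outside: "\<phi> \<in> test_functions K \<Longrightarrow> x \<notin> K \<Longrightarrow> \<phi> x = 0"
  using closure_subset[of "{x. \<phi> x \<noteq> 0}"] by (auto simp: test_functions_def)

lemma test_functions_measurable: "\<phi> \<in> test_functions K \<Longrightarrow> \<phi> \<in> borel_measurable borel"
  by (auto simp: test_functions_def intro: smooth_measurable)

lemma locally_integrable_mult_test:
  assumes "locally_integrable K f" "open K" "\<phi> \<in> test_functions K"
  shows "integrable (lebesgue_on K) (\<lambda>x. f x * \<phi> x)"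
proof -
  obtain S where S: "smooth \<phi>" "compact S" "S \<subseteq> K" "\<And>x. x \<notin> S \<Longrightarrow> \<phi> x = 0"
    using test_functionsE[OF assms(3)] by metis
  obtain B where B: "\<And>x. \<bar>\<phi> x\<bar> \<le> B"
    by (rule test_function_bounded[OF assms(3)]) (rule that)
  have "integrable lebesgue (\<lambda>x. indicator S x *\<^sub>R f x)"
    using assms(1) S by (auto simp: locally_integrable_def set_integrable_def)
  then have "integrable lebesgue (\<lambda>x. (indicator S x *\<^sub>R f x) * \<phi> x)"
    using B smooth_measurable[OF S(1)]
    by (intro integrable_mult_bounded[where B=B]) (auto intro: measurable_completion)
  moreover have "(\<lambda>x. (indicator S x *\<^sub>R f x) * \<phi> x) = (\<lambda>x. indicator K x *\<^sub>R (f x * \<phi> x))"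
    using S by (auto simp: fun_eq_iff indicator_def)
  ultimately show ?thesis
    using assms(2) by (simp add: integrable_restrict_space)
qed

definition unit_mi :: "2 \<Rightarrow> nat \<times> nat" where
  "unit_mi i = (if i = 1 then (1, 0) else (0, 1))"

lemma mi_order_unit_mi: "mi_order (unit_mi i) = 1"
  by (simp add: unit_mi_def mi_order_def)

lemma mi_deriv_unit_mi: "mi_deriv (unit_mi i) \<phi> = partial_deriv i \<phi>"
  using exhaust_2[of i] by (auto simp: unit_mi_def mi_deriv_simps)

lemma mi_order_1: "{\<delta>. mi_order \<delta> = 1} = {unit_mi 1, unit_mi 2}"
  by (auto simp: mi_order_def unit_mi_def add_is_1)

context convex_domain
begin

text \<open>The counterpart of \<open>is_weak_deriv\<close> for Borel functions integrable over
  \<open>\<mu>\<close>, kept for general multi-indices because second derivatives enter through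
  it.\<close>

definition weak_rep :: "nat \<times> nat \<Rightarrow> (real^2 \<Rightarrow> real) \<Rightarrow> (real^2 \<Rightarrow> real) \<Rightarrow> bool" where
  "weak_rep \<delta> u w \<longleftrightarrow> integrable \<mu> u \<and> integrable \<mu> w \<and>
     (\<forall>\<phi>\<in>test_functions K. (\<integral>x. u x * mi_deriv \<delta> \<phi> x \<partial>\<mu>) = (-1) ^ mi_order \<delta> * (\<integral>x. w x * \<phi> x \<partial>\<mu>))"

lemma weak_grad_iff_weak_rep: "weak_grad u w \<longleftrightarrow> (\<forall>i. weak_rep (unit_mi i) u (w i))"
  unfolding weak_grad_def weak_rep_def
  by (auto simp: mi_order_unit_mi mi_deriv_unit_mi)

lemma integral_AE_representative:
  fixes f f' \<psi> :: "real^2 \<Rightarrow> real"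
  assumes [measurable]: "f' \<in> borel_measurable borel" "\<psi> \<in> borel_measurable borel"
    and "AE x in \<mu>. f x = f' x"
  shows "(\<integral>x. f x * \<psi> x \<partial>lebesgue_on K) = vol * (\<integral>x. f' x * \<psi> x \<partial>\<mu>)"
proof -
  have ae: "AE x in \<mu>. f x * \<psi> x = f' x * \<psi> x"
    using assms(3) by eventually_elim simp
  have m: "(\<lambda>x. f' x * \<psi> x) \<in> borel_measurable borel"
    by simp
  have "(\<integral>x. f x * \<psi> x \<partial>lebesgue_on K) = (\<integral>x. f' x * \<psi> x \<partial>lebesgue_on K)"
    using measurable_lebesgue_on_AE[OF m ae] measurable_lebesgue_on_AE[OF m, of "\<lambda>x. f' x * \<psi> x"] ae
    by (intro integral_cong_AE) (auto simp: AE_lebesgue_on_K)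
  then show ?thesis
    by (simp add: integral_lebesgue_on_K)
qed

lemma weak_repI:
  assumes "is_weak_deriv K \<delta> v w" "AE x in \<mu>. v x = v' x" "AE x in \<mu>. w x = w' x"
    and v': "integrable \<mu> v'" and w': "integrable \<mu> w'"
  shows "weak_rep \<delta> v' w'"
  unfolding weak_rep_def
proof (intro conjI ballI v' w')
  fix \<phi> assume \<phi>: "\<phi> \<in> test_functions K"
  have m: "v' \<in> borel_measurable borel" "w' \<in> borel_measurable borel"
    using borel_measurable_integrable[OF v'] borel_measurable_integrable[OF w'] by auto
  have "(\<integral>x. v x * mi_deriv \<delta> \<phi> x \<partial>lebesgue_on K) = (-1) ^ mi_order \<delta> * (\<integral>x. w x * \<phi> x \<partial>lebesgue_on K)"
    using assms(1) \<phi> by (simp add: is_weak_deriv_def)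
  then have "vol * (\<integral>x. v' x * mi_deriv \<delta> \<phi> x \<partial>\<mu>) = (-1) ^ mi_order \<delta> * (vol * (\<integral>x. w' x * \<phi> x \<partial>\<mu>))"
    using integral_AE_representative[OF m(1) test_functions_measurable[OF mi_deriv_test_functions[OF \<phi>]] assms(2)]
      integral_AE_representative[OF m(2) test_functions_measurable[OF \<phi>] assms(3)]
    by metis
  then show "(\<integral>x. v' x * mi_deriv \<delta> \<phi> x \<partial>\<mu>) = (-1) ^ mi_order \<delta> * (\<integral>x. w' x * \<phi> x \<partial>\<mu>)"
    using vol_pos by simp
qed

lemma locally_integrable_representative:
  assumes f': "integrable \<mu> f'" and ae: "AE x in \<mu>. f x = f' x"
  shows "locally_integrable K f"
  unfolding locally_integrable_def
proof safe
  fix S assume S: "compact S" "S \<subseteq> K"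
  have [measurable]: "f' \<in> borel_measurable borel" "S \<in> sets borel"
    using borel_measurable_integrable[OF f'] S(1) by (auto intro: borel_compact)
  have "integrable lborel (\<lambda>x. indicator K x * f' x)"
    using f' by (simp add: integrable_\<mu>_iff)
  then have "integrable lborel (\<lambda>x. (indicator K x * f' x) * indicator S x)"
    by (rule integrable_mult_bounded[where B=1]) (auto simp: indicator_def)
  then have "integrable lborel (\<lambda>x. indicator S x *\<^sub>R f' x)"
    by (rule back_subst[of "integrable lborel"]) (use S(2) in \<open>auto simp: fun_eq_iff indicator_def\<close>)
  then have i: "integrable lebesgue (\<lambda>x. indicator S x *\<^sub>R f' x)"
    by (subst integrable_completion) auto
  have ae': "AE x in lebesgue. indicator S x *\<^sub>R f' x = indicator S x *\<^sub>R f x"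
    using ae S(2) unfolding AE_completion_iff AE_\<mu>_iff by (auto elim!: eventually_mono simp: indicator_def)
  have "(\<lambda>x. indicator S x *\<^sub>R f x) \<in> borel_measurable lebesgue"
    by (rule borel_measurable_AE[OF borel_measurable_integrable[OF i] ae'])
  then show "f absolutely_integrable_on S"
    unfolding set_integrable_def
    using integrable_cong_AE_imp[OF i _ ae'] by (simp add: eq_commute)
qed

lemma is_weak_derivI:
  assumes "weak_rep \<delta> v' w'" "AE x in \<mu>. v x = v' x" "AE x in \<mu>. w x = w' x"
  shows "is_weak_deriv K \<delta> v w"
  unfolding is_weak_deriv_def
proof (intro conjI ballI)
  have v': "integrable \<mu> v'" and w': "integrable \<mu> w'"
    using assms(1) by (auto simp: weak_rep_def)
  show "locally_integrable K v" "locally_integrable K w"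
    by (rule locally_integrable_representative v' w' assms)+
  fix \<phi> assume \<phi>: "\<phi> \<in> test_functions K"
  have m: "v' \<in> borel_measurable borel" "w' \<in> borel_measurable borel"
    using borel_measurable_integrable[OF v'] borel_measurable_integrable[OF w'] by auto
  show "(\<integral>x. v x * mi_deriv \<delta> \<phi> x \<partial>lebesgue_on K) = (-1) ^ mi_order \<delta> * (\<integral>x. w x * \<phi> x \<partial>lebesgue_on K)"
    using assms(1) \<phi>
    by (simp add: weak_rep_def integral_AE_representative[OF m(1) test_functions_measurable[OF mi_deriv_test_functions[OF \<phi>]] assms(2)]
      integral_AE_representative[OF m(2) test_functions_measurable[OF \<phi>] assms(3)])
qed

text \<open>The representative chosen by \<open>weak_deriv\<close> is only locally integrable, so uniqueness is first
  proved on the boxes inside \<open>K\<close>.\<close>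

lemma locally_integrable_AE_eq_0:
  assumes f: "locally_integrable K f"
    and 0: "\<And>\<phi>. \<phi> \<in> test_functions K \<Longrightarrow> (\<integral>x. f x * \<phi> x \<partial>lebesgue_on K) = 0"
  shows "AE x in \<mu>. f x = 0"
proof -
  have box: "AE x in lborel. x \<in> cbox l u \<longrightarrow> f x = 0" if sub: "cbox l u \<subseteq> K" for l u
  proof (cases "box l u = {}")
    \<comment> \<open>A degenerate box is no instance of the locale, but it is a null set.\<close>
    case True
    then have "AE x in lborel. x \<notin> cbox l u"
      using negligible_interval(1)[of l u]
      by (simp add: negligible_iff_null_sets null_sets_completion_iff AE_not_in)
    then show ?thesis by eventually_elim simp
  next
    case False
    interpret B: convex_domain "box l u"
      by unfold_locales (use False in auto)
    have "f absolutely_integrable_on cbox l u"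
      using f sub by (auto simp: locally_integrable_def)
    then have "f absolutely_integrable_on box l u"
      by (rule set_integrable_subset) (auto simp: box_subset_cbox)
    then have i: "integrable (lebesgue_on (box l u)) f"
      by (simp add: integrable_restrict_space set_integrable_def)
    obtain g where g[measurable]: "g \<in> borel_measurable borel" and fg: "AE x in B.\<mu>. f x = g x"
      using B.borel_representative[OF borel_measurable_integrable[OF i]] by blast
    have "(\<integral>\<^sup>+x. ennreal \<bar>g x\<bar> \<partial>lebesgue_on (box l u)) = (\<integral>\<^sup>+x. ennreal \<bar>f x\<bar> \<partial>lebesgue_on (box l u))"
      using fg by (intro nn_integral_cong_AE) (auto simp: B.AE_lebesgue_on_K elim: eventually_mono)
    also have "\<dots> < \<infinity>"
      using i by (simp add: integrable_iff_bounded)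
    finally have "ennreal B.vol * (\<integral>\<^sup>+x. ennreal \<bar>g x\<bar> \<partial>B.\<mu>) < \<infinity>"
      by (simp add: B.nn_integral_lebesgue_on_K)
    then have gi: "integrable B.\<mu> g"
      using B.vol_pos by (simp add: integrable_iff_bounded ennreal_mult_eq_top_iff less_top[symmetric])
    have "AE x in B.\<mu>. g x = 0"
    proof (rule B.AE_eq_0_if_test_integrals_0[OF gi])
      fix \<phi> assume \<phi>: "\<phi> \<in> test_functions (box l u)"
      \<comment> \<open>A test function of the box is also one of K and vanishes off the box, so its
        integral over the box is the integral over K, which is 0 by hypothesis.\<close>
      have "box l u \<subseteq> K" using sub box_subset_cbox by blast
      then have \<phi>K: "\<phi> \<in> test_functions K"
        using \<phi> test_functions_mono by blast
      have out: "\<phi> x = 0" if "x \<notin> box l u" for x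
        by (rule test_functions_outside[OF \<phi> that])
      have "B.vol * (\<integral>x. g x * \<phi> x \<partial>B.\<mu>) = (\<integral>x. f x * \<phi> x \<partial>lebesgue_on (box l u))"
        by (rule B.integral_AE_representative[symmetric]) (use g \<phi> fg in \<open>auto intro: test_functions_measurable\<close>)
      also have "\<dots> = (\<integral>x. indicator (box l u) x *\<^sub>R (f x * \<phi> x) \<partial>lebesgue)"
        by (simp add: integral_restrict_space)
      also have "(\<lambda>x. indicator (box l u) x *\<^sub>R (f x * \<phi> x)) = (\<lambda>x. indicator K x *\<^sub>R (f x * \<phi> x))"
        using out \<open>box l u \<subseteq> K\<close> by (auto simp: fun_eq_iff indicator_def)
      also have "(\<integral>x. indicator K x *\<^sub>R (f x * \<phi> x) \<partial>lebesgue) = (\<integral>x. f x * \<phi> x \<partial>lebesgue_on K)"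
        by (simp add: integral_restrict_space)
      also have "\<dots> = 0"
        by (rule 0[OF \<phi>K])
      finally show "(\<integral>x. g x * \<phi> x \<partial>B.\<mu>) = 0"
        using B.vol_pos by simp
    qed
    with fg have "AE x in B.\<mu>. f x = 0"
      by eventually_elim simp
    then have 1: "AE x in lborel. x \<in> box l u \<longrightarrow> f x = 0"
      by (simp add: B.AE_\<mu>_iff)
    \<comment> \<open>The faces are null, so the result passes to closed boxes; countably many of
      these fill K.\<close>
    have "cbox l u - box l u \<in> null_sets lebesgue"
      using negligible_frontier_interval[of l u] by (simp add: negligible_iff_null_sets)
    from AE_not_in[OF this] have "AE x in lborel. x \<notin> cbox l u - box l u"
      unfolding AE_completion_iff .
    with 1 show ?thesis
      by eventually_elim auto
  qed
  obtain D where D: "countable D" "\<And>X. X \<in> D \<Longrightarrow> X \<subseteq> K \<and> (\<exists>l u. X = cbox l u)" "\<Union>D = K"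
    using open_countable_Union_open_cbox[OF open_K] by (metis Pow_iff subsetD)
  have "AE x in lborel. x \<in> X \<longrightarrow> f x = 0" if "X \<in> D" for X
    using D(2)[OF that] box by auto
  then have "AE x in lborel. \<forall>X\<in>D. x \<in> X \<longrightarrow> f x = 0"
    by (intro AE_ball_countable[OF D(1), THEN iffD2] ballI)
  then show ?thesis
    unfolding AE_\<mu>_iff by eventually_elim (use D(3) in blast)
qed

lemma weak_deriv_unique:
  assumes "is_weak_deriv K \<delta> v w1" "is_weak_deriv K \<delta> v w2"
  shows "AE x in \<mu>. w1 x = w2 x"
proof -
  have l: "locally_integrable K w1" "locally_integrable K w2"
    using assms by (auto simp: is_weak_deriv_def)
  have "AE x in \<mu>. w1 x - w2 x = 0"
  proof (rule locally_integrable_AE_eq_0)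
    show "locally_integrable K (\<lambda>x. w1 x - w2 x)"
      using l unfolding locally_integrable_def by (auto intro: set_integral_diff)
    fix \<phi> assume \<phi>: "\<phi> \<in> test_functions K"
    have "(\<integral>x. v x * mi_deriv \<delta> \<phi> x \<partial>lebesgue_on K) = (-1) ^ mi_order \<delta> * (\<integral>x. w1 x * \<phi> x \<partial>lebesgue_on K)"
      "(\<integral>x. v x * mi_deriv \<delta> \<phi> x \<partial>lebesgue_on K) = (-1) ^ mi_order \<delta> * (\<integral>x. w2 x * \<phi> x \<partial>lebesgue_on K)"
      using assms \<phi> by (simp_all add: is_weak_deriv_def)
    then have "(\<integral>x. w1 x * \<phi> x \<partial>lebesgue_on K) = (\<integral>x. w2 x * \<phi> x \<partial>lebesgue_on K)"
      by simp
    then show "(\<integral>x. (w1 x - w2 x) * \<phi> x \<partial>lebesgue_on K) = 0"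
      using locally_integrable_mult_test[OF l(1) open_K \<phi>] locally_integrable_mult_test[OF l(2) open_K \<phi>]
      by (simp add: left_diff_distrib)
  qed
  then show ?thesis by simp
qed

text \<open>Whichever representative the choice operator returns, its norms are those of any weak
  derivative at hand.\<close>

lemma weak_deriv_AE:
  assumes "is_weak_deriv K \<delta> v w"
  shows "AE x in \<mu>. weak_deriv K \<delta> v x = w x"
  using weak_deriv_unique[OF someI[of "is_weak_deriv K \<delta> v", OF assms] assms]
  by (simp add: weak_deriv_def)

lemma Lp_space_representative:
  assumes "f \<in> Lp_space p K" "1 \<le> p"
  obtains f' where "integrable \<mu> f'" "AE x in \<mu>. f x = f' x" "Lp_norm p K f' < top"
proof -
  obtain f' where f': "f' \<in> borel_measurable borel" "AE x in \<mu>. f x = f' x"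
    using assms by (auto simp: Lp_space_def elim: borel_representative)
  then have "Lp_norm p K f' < top"
    using assms(1) Lp_norm_AE_cong[OF f'] by (simp add: Lp_space_def)
  then show ?thesis
    using that integrable_if_Lp_norm_finite f' assms(2) by blast
qed

lemma Lp_spaceI:
  assumes "f' \<in> borel_measurable borel" "AE x in \<mu>. f x = f' x" "Lp_norm p K f' < top"
  shows "f \<in> Lp_space p K"
  using measurable_lebesgue_on_AE[OF assms(1,2)] Lp_norm_AE_cong[OF assms(1,2)] assms(3)
  by (simp add: Lp_space_def)

text \<open>Here \<open>v\<close> is an arbitrary element of the Sobolev space, \<open>u\<close> a
  Borel representative of it and \<open>w\<close> Borel representatives of the chosen weak
  derivatives. Estimates are proved for \<open>u\<close> and \<open>w\<close> and transferred to the
  seminorms of \<open>v\<close>.\<close>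

definition sobolev_rep :: "ennreal \<Rightarrow> (real^2 \<Rightarrow> real) \<Rightarrow> (real^2 \<Rightarrow> real) \<Rightarrow> (2 \<Rightarrow> real^2 \<Rightarrow> real) \<Rightarrow> bool" where
  "sobolev_rep p v u w \<longleftrightarrow> weak_grad u w \<and> (AE x in \<mu>. v x = u x) \<and> Lp_norm p K u < top \<and>
     (\<forall>i. Lp_norm p K (w i) < top) \<and> (\<forall>i. AE x in \<mu>. weak_deriv K (unit_mi i) v x = w i x)"

lemma sobolev_rep_exists:
  assumes "v \<in> sobolev 1 p K" "1 \<le> p"
  obtains u w where "sobolev_rep p v u w"
proof -
  obtain u where u: "integrable \<mu> u" "AE x in \<mu>. v x = u x" "Lp_norm p K u < top"
    using assms by (auto simp: sobolev_def elim: Lp_space_representative)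
  have "\<exists>w. integrable \<mu> w \<and> Lp_norm p K w < top \<and> weak_rep (unit_mi i) u w \<and>
      (AE x in \<mu>. weak_deriv K (unit_mi i) v x = w x)" for i
  proof -
    obtain w0 where w0: "w0 \<in> Lp_space p K" "is_weak_deriv K (unit_mi i) v w0"
      using assms(1) mi_order_unit_mi[of i] unfolding sobolev_def mem_Collect_eq by (metis order_refl)
    obtain w where w: "integrable \<mu> w" "AE x in \<mu>. w0 x = w x" "Lp_norm p K w < top"
      by (rule Lp_space_representative[OF w0(1) assms(2)])
    have "AE x in \<mu>. weak_deriv K (unit_mi i) v x = w x"
      using weak_deriv_AE[OF w0(2)] w(2) by eventually_elim simp
    then show ?thesis
      using w weak_repI[OF w0(2) u(2) w(2) u(1) w(1)] by blast
  qed
  then obtain w where "\<And>i. Lp_norm p K (w i) < top" "\<And>i. weak_rep (unit_mi i) u (w i)"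
      "\<And>i. AE x in \<mu>. weak_deriv K (unit_mi i) v x = w i x"
    by metis
  then show ?thesis
    using that[of u w] u by (auto simp: sobolev_rep_def weak_grad_iff_weak_rep)
qed

lemma sobolev_repI:
  assumes "weak_grad u w" "AE x in \<mu>. v x = u x" "Lp_norm p K u < top" "\<And>i. Lp_norm p K (w i) < top"
  shows "sobolev_rep p v u w"
proof -
  have "AE x in \<mu>. weak_deriv K (unit_mi i) v x = w i x" for i
    using assms(1) by (intro weak_deriv_AE is_weak_derivI[OF _ assms(2)]) (auto simp: weak_grad_iff_weak_rep)
  then show ?thesis
    using assms by (auto simp: sobolev_rep_def)
qed

lemma sobolev_if_rep:
  assumes "sobolev_rep p v u w"
  shows "v \<in> sobolev 1 p K"
proof -
  have g: "weak_grad u w" and ae: "AE x in \<mu>. v x = u x" and fin: "Lp_norm p K u < top" "\<And>i. Lp_norm p K (w i) < top"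
    using assms by (auto simp: sobolev_rep_def)
  have vL: "v \<in> Lp_space p K"
    by (rule Lp_spaceI[OF weak_grad_measurable(1)[OF g] ae fin(1)])
  moreover have "\<exists>w\<in>Lp_space p K. is_weak_deriv K \<delta> v w" if "mi_order \<delta> \<le> 1" for \<delta>
  proof -
    consider i where "\<delta> = unit_mi i" | "\<delta> = (0, 0)"
    proof -
      have "\<delta> \<in> {\<delta>. mi_order \<delta> = 1} \<or> \<delta> = (0, 0)"
        using \<open>mi_order \<delta> \<le> 1\<close> by (cases \<delta>) (auto simp: mi_order_def)
      then show ?thesis
        using that unfolding mi_order_1 by blast
    qed
    then show ?thesis
    proof cases
      case 1
      have "w i \<in> Lp_space p K"
        by (rule Lp_spaceI[OF weak_grad_measurable(2)[OF g, of i] _ fin(2)[of i]]) simp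
      moreover have "is_weak_deriv K \<delta> v (w i)"
        using g ae unfolding 1 by (intro is_weak_derivI[of _ u "w i"]) (auto simp: weak_grad_iff_weak_rep)
      ultimately show ?thesis by blast
    next
      case 2
      \<comment> \<open>The Sobolev space also asks for a weak derivative of order 0, which is the
        function itself.\<close>
      have "weak_rep (0, 0) u u"
        using g by (auto simp: weak_rep_def weak_grad_def mi_deriv_simps mi_order_def)
      then have "is_weak_deriv K \<delta> v v"
        unfolding 2 using ae by (rule is_weak_derivI[OF _ _ ae])
      then show ?thesis using vL by blast
    qed
  qed
  ultimately show ?thesis
    by (auto simp: sobolev_def)
qed

lemma seminorm_0_rep:
  assumes "sobolev_rep p v u w"
  shows "seminorm 0 p K v = Lp_norm p K u"
  using assms by (auto simp: seminorm_def sobolev_rep_def intro!: Lp_norm_AE_cong weak_grad_measurable(1))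

lemma Lp_norm_weak_deriv_rep:
  assumes "sobolev_rep p v u w"
  shows "Lp_norm q K (weak_deriv K (unit_mi i) v) = Lp_norm q K (w i)"
  using assms by (auto simp: sobolev_rep_def intro!: Lp_norm_AE_cong weak_grad_measurable(2))

lemma seminorm_1_rep:
  assumes "sobolev_rep p v u w" "1 \<le> p"
  shows "Lp_norm p K (w i) \<le> seminorm 1 p K v"
    and "seminorm 1 p K v \<le> Lp_norm p K (w 1) + Lp_norm p K (w 2)"
proof -
  show "Lp_norm p K (w i) \<le> seminorm 1 p K v"
    using Lp_norm_le_seminorm[OF assms(2) mi_order_unit_mi[of i], of K v]
    by (simp add: Lp_norm_weak_deriv_rep[OF assms(1)])
  have "unit_mi 1 \<noteq> unit_mi 2"
    by (simp add: unit_mi_def)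
  then show "seminorm 1 p K v \<le> Lp_norm p K (w 1) + Lp_norm p K (w 2)"
    using seminorm_le_sum_Lp_norm[OF assms(2), of 1 K v] unfolding mi_order_1
    by (simp add: Lp_norm_weak_deriv_rep[OF assms(1)])
qed

lemma smooth_weak_grad:
  assumes "smooth \<phi>"
  shows "weak_grad \<phi> (\<lambda>i. partial_deriv i \<phi>)"
  unfolding weak_grad_def
proof (intro conjI allI ballI)
  show "integrable \<mu> \<phi>" "integrable \<mu> (partial_deriv i \<phi>)" for i
    by (intro integrable_\<mu>_continuous smooth_continuous_on smooth_partial_deriv assms)+
  fix \<psi> i assume \<psi>: "\<psi> \<in> test_functions K"
  have [measurable]: "\<phi> \<in> borel_measurable borel" "partial_deriv i \<phi> \<in> borel_measurable borel"
    "\<psi> \<in> borel_measurable borel" "partial_deriv i \<psi> \<in> borel_measurable borel"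
    using \<psi> assms by (auto intro: smooth_measurable smooth_partial_deriv test_functions_measurable partial_deriv_test_functions)
  have out: "\<psi> x = 0" "partial_deriv i \<psi> x = 0" if "x \<notin> K" for x
    using test_functions_outside that \<psi> partial_deriv_test_functions by blast+
  have "(\<lambda>x. indicator K x * (\<phi> x * partial_deriv i \<psi> x)) = (\<lambda>x. \<phi> x * partial_deriv i \<psi> x)"
    "(\<lambda>x. indicator K x * (partial_deriv i \<phi> x * \<psi> x)) = (\<lambda>x. partial_deriv i \<phi> x * \<psi> x)"
    using out by (auto simp: fun_eq_iff indicator_def)
  then show "(\<integral>x. \<phi> x * partial_deriv i \<psi> x \<partial>\<mu>) = - (\<integral>x. partial_deriv i \<phi> x * \<psi> x \<partial>\<mu>)"
    using integral_by_parts_test_function[OF assms \<psi>, of i] by (simp add: integral_\<mu>)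
qed

lemma weak_grad_diff:
  assumes "weak_grad u w" "weak_grad u' w'"
  shows "weak_grad (\<lambda>x. u x - u' x) (\<lambda>i x. w i x - w' i x)"
  unfolding weak_grad_def
proof (intro conjI allI ballI)
  have i: "integrable \<mu> u" "integrable \<mu> u'" "integrable \<mu> (w i)" "integrable \<mu> (w' i)" for i
    using assms by (auto simp: weak_grad_def)
  then show "integrable \<mu> (\<lambda>x. u x - u' x)" "integrable \<mu> (\<lambda>x. w i x - w' i x)" for i
    by auto
  fix \<psi> i assume \<psi>: "\<psi> \<in> test_functions K"
  have m: "integrable \<mu> (\<lambda>x. f x * \<eta> x)" if f: "integrable \<mu> f" and \<eta>: "\<eta> \<in> test_functions K" for f \<eta>
  proof -
    obtain B where "\<And>x. \<bar>\<eta> x\<bar> \<le> B"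
      by (rule test_function_bounded[OF \<eta>]) (rule that)
    then show ?thesis
      using f \<eta> test_functions_measurable by (intro integrable_mult_bounded[where B=B]) auto
  qed
  show "(\<integral>x. (u x - u' x) * partial_deriv i \<psi> x \<partial>\<mu>) = - (\<integral>x. (w i x - w' i x) * \<psi> x \<partial>\<mu>)"
    using assms \<psi> m[OF i(1)] m[OF i(2)] m[OF i(3)] m[OF i(4)] partial_deriv_test_functions[OF \<psi>]
    by (simp add: left_diff_distrib weak_grad_def)
qed

end

subsection \<open>Polar coordinates in a triangle\<close>

text \<open>The linear map is factored into one-dimensional substitutions. If
  \<open>e\<^sub>1 \<noteq> 0\<close>, first \<open>z\<close> is replaced for fixed
  \<open>y\<close>, with scale determinant over \<open>e\<^sub>1\<close>, then \<open>y\<close> for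
  fixed \<open>t\<close>, with scale \<open>e\<^sub>1\<close>; the scales multiply to the
  determinant.\<close>

lemma nn_integral_plane_affine:
  fixes Q :: "real \<Rightarrow> real \<Rightarrow> ennreal"
  assumes [measurable]: "case_prod Q \<in> borel_measurable (borel \<Otimes>\<^sub>M borel)"
    and D: "e\<^sub>1 * f\<^sub>2 - e\<^sub>2 * f\<^sub>1 \<noteq> 0"
  shows "(\<integral>\<^sup>+y. \<integral>\<^sup>+z. Q y z \<partial>lborel \<partial>lborel) = ennreal \<bar>e\<^sub>1 * f\<^sub>2 - e\<^sub>2 * f\<^sub>1\<bar> *
    (\<integral>\<^sup>+s. \<integral>\<^sup>+t. Q (a\<^sub>1 + e\<^sub>1 * s + f\<^sub>1 * t) (a\<^sub>2 + e\<^sub>2 * s + f\<^sub>2 * t) \<partial>lborel \<partial>lborel)"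
proof -
  have main: "(\<integral>\<^sup>+y. \<integral>\<^sup>+z. Q y z \<partial>lborel \<partial>lborel) = ennreal \<bar>e\<^sub>1 * f\<^sub>2 - e\<^sub>2 * f\<^sub>1\<bar> *
    (\<integral>\<^sup>+t. \<integral>\<^sup>+s. Q (a\<^sub>1 + e\<^sub>1 * s + f\<^sub>1 * t) (a\<^sub>2 + e\<^sub>2 * s + f\<^sub>2 * t) \<partial>lborel \<partial>lborel)"
    if e: "e\<^sub>1 \<noteq> 0" and D: "e\<^sub>1 * f\<^sub>2 - e\<^sub>2 * f\<^sub>1 \<noteq> 0" for e\<^sub>1 e\<^sub>2 f\<^sub>1 f\<^sub>2
  proof -
    define d where "d = (e\<^sub>1 * f\<^sub>2 - e\<^sub>2 * f\<^sub>1) / e\<^sub>1"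
    have d: "d \<noteq> 0" "e\<^sub>1 * f\<^sub>2 - e\<^sub>2 * f\<^sub>1 = d * e\<^sub>1"
      using e D by (auto simp: d_def)
    define g where "g y = a\<^sub>2 + e\<^sub>2 * ((y - a\<^sub>1) / e\<^sub>1)" for y
    have [measurable]: "g \<in> borel_measurable borel"
      unfolding g_def[abs_def] by measurable
    have "(\<integral>\<^sup>+y. \<integral>\<^sup>+z. Q y z \<partial>lborel \<partial>lborel) = (\<integral>\<^sup>+y. ennreal \<bar>d\<bar> * (\<integral>\<^sup>+t. Q y (g y + d * t) \<partial>lborel) \<partial>lborel)"
      by (intro nn_integral_cong nn_integral_real_affine d) measurable
    also have "\<dots> = ennreal \<bar>d\<bar> * (\<integral>\<^sup>+y. \<integral>\<^sup>+t. Q y (g y + d * t) \<partial>lborel \<partial>lborel)"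
      by (rule nn_integral_cmult) measurable
    also have "(\<integral>\<^sup>+y. \<integral>\<^sup>+t. Q y (g y + d * t) \<partial>lborel \<partial>lborel) = (\<integral>\<^sup>+t. \<integral>\<^sup>+y. Q y (g y + d * t) \<partial>lborel \<partial>lborel)"
      by (rule lborel_pair.Fubini'[symmetric]) measurable
    also have "\<dots> = (\<integral>\<^sup>+t. ennreal \<bar>e\<^sub>1\<bar> * (\<integral>\<^sup>+s. Q (a\<^sub>1 + e\<^sub>1 * s + f\<^sub>1 * t) (a\<^sub>2 + e\<^sub>2 * s + f\<^sub>2 * t) \<partial>lborel) \<partial>lborel)"
    proof (intro nn_integral_cong)
      fix t :: real
      have "(\<integral>\<^sup>+y. Q y (g y + d * t) \<partial>lborel)
          = ennreal \<bar>e\<^sub>1\<bar> * (\<integral>\<^sup>+s. Q ((a\<^sub>1 + f\<^sub>1 * t) + e\<^sub>1 * s) (g ((a\<^sub>1 + f\<^sub>1 * t) + e\<^sub>1 * s) + d * t) \<partial>lborel)"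
        by (rule nn_integral_real_affine[OF _ e]) measurable
      moreover have "g ((a\<^sub>1 + f\<^sub>1 * t) + e\<^sub>1 * s) + d * t = a\<^sub>2 + e\<^sub>2 * s + f\<^sub>2 * t" for s
        using e by (simp add: g_def d_def field_simps)
      ultimately show "(\<integral>\<^sup>+y. Q y (g y + d * t) \<partial>lborel)
          = ennreal \<bar>e\<^sub>1\<bar> * (\<integral>\<^sup>+s. Q (a\<^sub>1 + e\<^sub>1 * s + f\<^sub>1 * t) (a\<^sub>2 + e\<^sub>2 * s + f\<^sub>2 * t) \<partial>lborel)"
        by (simp add: ac_simps)
    qed
    also have "\<dots> = ennreal \<bar>e\<^sub>1\<bar> * (\<integral>\<^sup>+t. \<integral>\<^sup>+s. Q (a\<^sub>1 + e\<^sub>1 * s + f\<^sub>1 * t) (a\<^sub>2 + e\<^sub>2 * s + f\<^sub>2 * t) \<partial>lborel \<partial>lborel)"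
      by (rule nn_integral_cmult) measurable
    finally show ?thesis
      by (simp add: d(2) abs_mult ennreal_mult mult.assoc)
  qed
  show ?thesis
  proof (cases "e\<^sub>1 = 0")
    case False
    have "(\<integral>\<^sup>+t. \<integral>\<^sup>+s. Q (a\<^sub>1 + e\<^sub>1 * s + f\<^sub>1 * t) (a\<^sub>2 + e\<^sub>2 * s + f\<^sub>2 * t) \<partial>lborel \<partial>lborel)
      = (\<integral>\<^sup>+s. \<integral>\<^sup>+t. Q (a\<^sub>1 + e\<^sub>1 * s + f\<^sub>1 * t) (a\<^sub>2 + e\<^sub>2 * s + f\<^sub>2 * t) \<partial>lborel \<partial>lborel)"
      by (rule lborel_pair.Fubini') measurable
    with main[OF False D] show ?thesis by simp
  next
    \<comment> \<open>If \<open>e\<^sub>1\<close> vanishes, the determinant forces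
      \<open>f\<^sub>1 \<noteq> 0\<close>, and the two columns exchange their roles.\<close>
    case True
    with D have "f\<^sub>1 \<noteq> 0" "f\<^sub>1 * e\<^sub>2 - f\<^sub>2 * e\<^sub>1 \<noteq> 0" by auto
    from main[OF this] show ?thesis
      by (simp add: True add.commute add.left_commute abs_minus_commute mult.commute)
  qed
qed

definition vec2 :: "real \<Rightarrow> real \<Rightarrow> real^2" where
  "vec2 s t = (\<chi> i. if i = 1 then s else t)"

lemma vec2_nth [simp]: "vec2 s t $ 1 = s" "vec2 s t $ 2 = t"
  by (simp_all add: vec2_def)

lemma vec2_measurable [measurable]: "case_prod vec2 \<in> borel_measurable (borel \<Otimes>\<^sub>M borel)"
proof -
  have "continuous_on UNIV (\<lambda>p. (\<chi> i. if i = 1 then fst p else snd p) :: real^2)"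
  proof (rule continuous_on_vec_lambda)
    show "continuous_on UNIV (\<lambda>p::real \<times> real. if i = 1 then fst p else snd p)" for i :: 2
      by (cases "i = 1") (auto intro: continuous_intros)
  qed
  then show ?thesis
    unfolding vec2_def[abs_def] borel_prod case_prod_unfold
    by (rule borel_measurable_continuous_onI)
qed

text \<open>Both measures assign to a box the product of its side lengths, which characterises
  Lebesgue measure. It opens the way to iterated integrals on \<open>real^2\<close>.\<close>

lemma lborel_vec2: "distr (lborel \<Otimes>\<^sub>M lborel) borel (case_prod vec2) = lborel"
proof (rule lborel_eqI[symmetric])
  fix l u :: "real^2" assume le: "\<And>b. b \<in> Basis \<Longrightarrow> l \<bullet> b \<le> u \<bullet> b"
  have le': "l $ i \<le> u $ i" for i
    using le[of "axis i 1"] by (simp add: cart_eq_inner_axis axis_in_Basis_iff)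
  have Basis: "(Basis :: (real^2) set) = (\<lambda>i. axis i 1) ` UNIV"
    by (auto simp: Basis_vec_def)
  have inj: "inj (\<lambda>i::2. axis i (1::real))"
    by (auto simp: inj_on_def axis_eq_axis)
  have "case_prod vec2 -` box l u = {l $ 1<..<u $ 1} \<times> {l $ 2<..<u $ 2}"
    by (auto simp: mem_box_cart forall_2)
  then have "emeasure (distr (lborel \<Otimes>\<^sub>M lborel) borel (case_prod vec2)) (box l u)
      = emeasure lborel {l $ 1<..<u $ 1} * emeasure lborel {l $ 2<..<u $ 2}"
    by (subst emeasure_distr) (auto simp: space_pair_measure lborel.emeasure_pair_measure_Times)
  also have "\<dots> = ennreal (\<Prod>i\<in>UNIV. (u - l) $ i)"
    using le'[of 1] le'[of 2] by (simp add: UNIV_2 ennreal_mult)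
  also have "(\<Prod>i\<in>UNIV. (u - l) $ i) = (\<Prod>b\<in>Basis. (u - l) \<bullet> b)"
    unfolding Basis by (subst prod.reindex[OF inj]) (simp add: cart_eq_inner_axis)
  finally show "emeasure (distr (lborel \<Otimes>\<^sub>M lborel) borel (case_prod vec2)) (box l u) = (\<Prod>b\<in>Basis. (u - l) \<bullet> b)" .
qed simp

lemma nn_integral_lborel_vec2:
  assumes [measurable]: "q \<in> borel_measurable borel"
  shows "(\<integral>\<^sup>+x. q x \<partial>lborel) = (\<integral>\<^sup>+s. \<integral>\<^sup>+t. q (vec2 s t) \<partial>lborel \<partial>lborel)"
proof -
  have "(\<integral>\<^sup>+x. q x \<partial>lborel) = (\<integral>\<^sup>+p. q (case_prod vec2 p) \<partial>(lborel \<Otimes>\<^sub>M lborel))"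
    by (subst lborel_vec2[symmetric], subst nn_integral_distr) auto
  also have "\<dots> = (\<integral>\<^sup>+s. \<integral>\<^sup>+t. q (vec2 s t) \<partial>lborel \<partial>lborel)"
    by (subst lborel.nn_integral_fst[symmetric]) auto
  finally show ?thesis .
qed

lemma not_collinear_det:
  fixes a b c :: "real^2"
  assumes "\<not> collinear {a, b, c}"
  shows "(b - a) $ 1 * (c - b) $ 2 - (b - a) $ 2 * (c - b) $ 1 \<noteq> 0"
proof
  assume d: "(b - a) $ 1 * (c - b) $ 2 - (b - a) $ 2 * (c - b) $ 1 = 0"
  have "\<exists>u. c = b + u *\<^sub>R (a - b)" if "a \<noteq> b"
  proof (cases "a $ 1 = b $ 1")
    case True
    with that have ab: "a $ 2 \<noteq> b $ 2" by (auto simp: vec_eq_iff forall_2)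
    with d True have "c $ 1 = b $ 1" by simp
    with ab True show ?thesis
      by (intro exI[of _ "(c $ 2 - b $ 2) / (a $ 2 - b $ 2)"]) (simp add: vec_eq_iff forall_2)
  next
    case False
    have "(c $ 1 - b $ 1) * (a $ 2 - b $ 2) = (c $ 2 - b $ 2) * (a $ 1 - b $ 1)"
      using d by (simp add: algebra_simps)
    then have "(c $ 1 - b $ 1) / (a $ 1 - b $ 1) * (a $ 2 - b $ 2) = c $ 2 - b $ 2"
      using False by simp
    with False show ?thesis
      by (intro exI[of _ "(c $ 1 - b $ 1) / (a $ 1 - b $ 1)"]) (simp add: vec_eq_iff forall_2)
  qed
  then have "a = b \<or> (\<exists>u. c = u *\<^sub>R a + (1 - u) *\<^sub>R b)"
    by (auto simp: algebra_simps)
  then have "collinear {a, c, b}"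
    by (simp add: collinear_3_expand)
  with assms show False
    by (simp add: insert_commute)
qed

abbreviation unit_measure :: "real measure" where
  "unit_measure \<equiv> uniform_measure lborel {0..1}"

lemma sets_unit_measure [measurable_cong]: "sets unit_measure = sets borel"
  by simp

lemma prob_space_unit_measure: "prob_space unit_measure"
  by (rule prob_space_uniform_measure) auto

lemma nn_integral_unit_measure:
  "f \<in> borel_measurable borel \<Longrightarrow> (\<integral>\<^sup>+t. f t \<partial>unit_measure) = (\<integral>\<^sup>+t. f t * indicator {0..1} t \<partial>lborel)"
  by (simp add: nn_integral_uniform_measure divide_ennreal_def)

lemma unit_measure_density: "unit_measure = density lborel (\<lambda>t. ennreal (indicator {0..1} t))"
  unfolding uniform_measure_def by (intro density_cong) (auto simp: indicator_def)

lemma integral_unit_measure: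
  fixes f :: "real \<Rightarrow> real"
  shows "f \<in> borel_measurable borel \<Longrightarrow> (\<integral>t. f t \<partial>unit_measure) = (\<integral>t. f t * indicator {0..1} t \<partial>lborel)"
  unfolding unit_measure_density by (simp add: integral_density mult.commute)

lemma AE_unit_measure_in: "AE t in unit_measure. t \<in> {0..1}"
  by (rule AE_uniform_measureI) auto

text \<open>Polar coordinates with pole \<open>a\<close>: \<open>t\<close> selects a point of the
  opposite edge and \<open>s\<close> the fraction of the way to it. The area element is
  \<open>s\<close> times a fixed determinant.\<close>

definition polar :: "real^2 \<Rightarrow> real^2 \<Rightarrow> real^2 \<Rightarrow> real \<Rightarrow> real \<Rightarrow> real^2" where
  "polar a b c s t = a + s *\<^sub>R (linepath b c t - a)"

lemma polar_measurable [measurable]: "case_prod (polar a b c) \<in> borel_measurable (borel \<Otimes>\<^sub>M borel)"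
  unfolding polar_def linepath_def by measurable

lemma polar_alt: "polar a b c s t = a + s *\<^sub>R (b - a) + (s * t) *\<^sub>R (c - b)"
  by (simp add: polar_def linepath_def algebra_simps)

text \<open>The barycentric coordinates of the point are \<open>1 - s\<close>, \<open>s - t\<close>
  and \<open>t\<close>. They are determined uniquely by Cramer's rule, since \<open>b - a\<close>
  and \<open>c - b\<close> are independent.\<close>

lemma mem_triangle_iff:
  fixes a b c :: "real^2"
  assumes "\<not> collinear {a, b, c}"
  shows "a + s *\<^sub>R (b - a) + t *\<^sub>R (c - b) \<in> convex hull {a, b, c} \<longleftrightarrow> 0 \<le> t \<and> t \<le> s \<and> s \<le> 1"
proof
  assume "0 \<le> t \<and> t \<le> s \<and> s \<le> 1"
  then show "a + s *\<^sub>R (b - a) + t *\<^sub>R (c - b) \<in> convex hull {a, b, c}"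
    unfolding convex_hull_3 mem_Collect_eq
    by (intro exI[of _ "1 - s"] exI[of _ "s - t"] exI[of _ t]) (auto simp: algebra_simps)
next
  assume "a + s *\<^sub>R (b - a) + t *\<^sub>R (c - b) \<in> convex hull {a, b, c}"
  then obtain u v w where uvw: "0 \<le> u" "0 \<le> v" "0 \<le> w" "u + v + w = 1"
    "a + s *\<^sub>R (b - a) + t *\<^sub>R (c - b) = u *\<^sub>R a + v *\<^sub>R b + w *\<^sub>R c"
    by (auto simp: convex_hull_3)
  let ?p = "s - (v + w)" and ?q = "t - w"
  have "u = 1 - v - w" using uvw(4) by simp
  have zero: "?p * (b - a) $ i + ?q * (c - b) $ i = 0" for i
  proof -
    have "(a + s *\<^sub>R (b - a) + t *\<^sub>R (c - b)) $ i = (u *\<^sub>R a + v *\<^sub>R b + w *\<^sub>R c) $ i"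
      by (simp only: uvw(5))
    then show ?thesis
      unfolding \<open>u = 1 - v - w\<close> by (simp add: algebra_simps)
  qed
  let ?d = "(b - a) $ 1 * (c - b) $ 2 - (b - a) $ 2 * (c - b) $ 1"
  have "?p * ?d = (?p * (b - a) $ 1 + ?q * (c - b) $ 1) * (c - b) $ 2 - (?p * (b - a) $ 2 + ?q * (c - b) $ 2) * (c - b) $ 1"
    by (simp only: algebra_simps)
  then have "?p = 0"
    using not_collinear_det[OF assms] by (simp only: zero) simp
  have "?q * ?d = (b - a) $ 1 * (?p * (b - a) $ 2 + ?q * (c - b) $ 2) - (b - a) $ 2 * (?p * (b - a) $ 1 + ?q * (c - b) $ 1)"
    by (simp only: algebra_simps)
  then have "?q = 0"
    using not_collinear_det[OF assms] by (simp only: zero) simp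
  with \<open>?p = 0\<close> show "0 \<le> t \<and> t \<le> s \<and> s \<le> 1"
    using uvw by simp
qed

text \<open>An affine substitution turns the triangle into the region
  \<open>0 \<le> t \<le> s \<le> 1\<close>; rescaling \<open>t\<close> to \<open>s * t\<close> turns
  that into the unit square and produces the weight \<open>s\<close>.\<close>

lemma nn_integral_triangle:
  fixes a b c :: "real^2"
  assumes nc: "\<not> collinear {a, b, c}" and [measurable]: "q \<in> borel_measurable borel"
  shows "(\<integral>\<^sup>+x. q x * indicator (convex hull {a, b, c}) x \<partial>lborel) =
    ennreal \<bar>(b - a) $ 1 * (c - b) $ 2 - (b - a) $ 2 * (c - b) $ 1\<bar> *
    (\<integral>\<^sup>+s. \<integral>\<^sup>+t. ennreal s * q (polar a b c s t) \<partial>unit_measure \<partial>unit_measure)"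
proof -
  interpret U: prob_space unit_measure by (rule prob_space_unit_measure)
  let ?T = "convex hull {a, b, c}" and ?D = "\<bar>(b - a) $ 1 * (c - b) $ 2 - (b - a) $ 2 * (c - b) $ 1\<bar>"
  have T[measurable]: "?T \<in> sets borel"
    by (intro borel_compact compact_convex_hull finite_imp_compact) simp
  define Q where "Q x = q x * indicator ?T x" for x
  have [measurable]: "Q \<in> borel_measurable borel"
    unfolding Q_def[abs_def] by measurable
  have affine: "vec2 (a $ 1 + (b - a) $ 1 * s + (c - b) $ 1 * t) (a $ 2 + (b - a) $ 2 * s + (c - b) $ 2 * t)
      = a + s *\<^sub>R (b - a) + t *\<^sub>R (c - b)" for s t
    by (simp add: vec_eq_iff forall_2 mult.commute)
  have "(\<integral>\<^sup>+x. Q x \<partial>lborel) = (\<integral>\<^sup>+s. \<integral>\<^sup>+t. Q (vec2 s t) \<partial>lborel \<partial>lborel)"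
    by (rule nn_integral_lborel_vec2) measurable
  also have "\<dots> = ennreal ?D * (\<integral>\<^sup>+s. \<integral>\<^sup>+t. Q (a + s *\<^sub>R (b - a) + t *\<^sub>R (c - b)) \<partial>lborel \<partial>lborel)"
    by (subst nn_integral_plane_affine[where a\<^sub>1="a $ 1" and a\<^sub>2="a $ 2", OF _ not_collinear_det[OF nc]])
       (simp_all only: affine, measurable)
  also have "(\<integral>\<^sup>+s. \<integral>\<^sup>+t. Q (a + s *\<^sub>R (b - a) + t *\<^sub>R (c - b)) \<partial>lborel \<partial>lborel)
      = (\<integral>\<^sup>+s. (\<integral>\<^sup>+t. ennreal s * q (polar a b c s t) \<partial>unit_measure) * indicator {0..1} s \<partial>lborel)"
  proof (rule nn_integral_cong)
    fix s :: real
    show "(\<integral>\<^sup>+t. Q (a + s *\<^sub>R (b - a) + t *\<^sub>R (c - b)) \<partial>lborel)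
      = (\<integral>\<^sup>+t. ennreal s * q (polar a b c s t) \<partial>unit_measure) * indicator {0..1} s"
    proof (cases "0 < s \<and> s \<le> 1")
      case True
      have "(\<integral>\<^sup>+t. Q (a + s *\<^sub>R (b - a) + t *\<^sub>R (c - b)) \<partial>lborel)
         = ennreal \<bar>s\<bar> * (\<integral>\<^sup>+t. Q (a + s *\<^sub>R (b - a) + (0 + s * t) *\<^sub>R (c - b)) \<partial>lborel)"
      proof (rule nn_integral_real_affine)
        show "(\<lambda>t. Q (a + s *\<^sub>R (b - a) + t *\<^sub>R (c - b))) \<in> borel_measurable borel"
          by measurable
      qed (use True in simp)
      also have "(\<lambda>t. Q (a + s *\<^sub>R (b - a) + (0 + s * t) *\<^sub>R (c - b))) = (\<lambda>t. q (polar a b c s t) * indicator {0..1} t)"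
        using True by (auto simp: fun_eq_iff Q_def indicator_def mem_triangle_iff[OF nc] polar_alt zero_le_mult_iff)
      also have "ennreal \<bar>s\<bar> * (\<integral>\<^sup>+t. q (polar a b c s t) * indicator {0..1} t \<partial>lborel)
          = (\<integral>\<^sup>+t. ennreal s * q (polar a b c s t) \<partial>unit_measure)"
        using True by (simp add: nn_integral_cmult nn_integral_unit_measure)
      finally show ?thesis using True by simp
    next
      \<comment> \<open>Off the unit interval the integrand vanishes; at \<open>s = 0\<close> it
        survives only at the single value \<open>t = 0\<close>.\<close>
      case False
      have "(\<integral>\<^sup>+t. Q (a + s *\<^sub>R (b - a) + t *\<^sub>R (c - b)) \<partial>lborel) = (\<integral>\<^sup>+t. 0 \<partial>(lborel :: real measure))"
      proof (rule nn_integral_cong_AE)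
        show "AE t in lborel. Q (a + s *\<^sub>R (b - a) + t *\<^sub>R (c - b)) = 0"
          using AE_lborel_singleton[of 0]
          by eventually_elim (use False in \<open>auto simp: Q_def indicator_def mem_triangle_iff[OF nc]\<close>)
      qed
      then show ?thesis
        using False by (cases "s = 0") (auto simp: indicator_def)
    qed
  qed
  also have "\<dots> = (\<integral>\<^sup>+s. \<integral>\<^sup>+t. ennreal s * q (polar a b c s t) \<partial>unit_measure \<partial>unit_measure)"
    by (rule nn_integral_unit_measure[symmetric]) measurable
  finally show ?thesis
    by (simp add: Q_def)
qed

lemma nn_integral_unit_measure_id: "(\<integral>\<^sup>+s. ennreal s \<partial>unit_measure) = ennreal (1 / 2)"
proof -
  have "((\<lambda>x. x\<^sup>2 / 2) has_real_derivative x) (at x)" for x :: real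
    by (auto intro!: derivative_eq_intros)
  then have "(\<integral>\<^sup>+s. ennreal s * indicator {0..1} s \<partial>lborel) = ennreal (1\<^sup>2 / 2 - 0\<^sup>2 / 2)"
    by (intro nn_integral_FTC_Icc) (auto intro: has_field_derivative_at_within)
  then show ?thesis
    by (simp add: nn_integral_unit_measure)
qed

locale triangle =
  fixes a b c :: "real^2"
  assumes not_collinear: "\<not> collinear {a, b, c}"
begin

abbreviation K :: "(real^2) set" where "K \<equiv> open_triangle a b c"

sublocale convex_domain K
proof
  show "open K" by simp
  show "convex K"
    by (simp add: closed_triangle_def convex_interior)
  show "bounded K"
    unfolding closed_triangle_def
    by (rule bounded_subset[OF _ interior_subset]) (intro compact_imp_bounded compact_convex_hull finite_imp_compact, simp)
  show "K \<noteq> {}"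
  proof -
    have "(1/3) *\<^sub>R a + (1/3) *\<^sub>R b + (1/3) *\<^sub>R c \<in> K"
      unfolding closed_triangle_def
      by (subst interior_convex_hull_3_minimal[OF not_collinear]) (auto intro!: exI[of _ "1/3"])
    then show ?thesis by blast
  qed
qed

lemma closure_K: "closure K = closed_triangle a b c"
  using convex_closure_interior[of "closed_triangle a b c"] nonempty_K closed_triangle_def
    compact_imp_closed[OF compact_convex_hull[OF finite_imp_compact[of "{a, b, c}"]]]
  by (simp add: closure_closed)

lemma diameter_K: "diameter K = diameter (closed_triangle a b c)"
  using diameter_closure[OF bounded_K] by (simp add: closure_K)

text \<open>The set equation allows every vertex as pole. The factor 2 is the determinant divided by
  the area: the constant function 1 shows that the area is half of the determinant, because
  \<open>s\<close> has mean 1/2.\<close>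

lemma nn_integral_polar:
  assumes "{p, q, r} = {a, b, c}" and f[measurable]: "f \<in> borel_measurable borel"
  shows "(\<integral>\<^sup>+x. f x \<partial>\<mu>) = 2 * (\<integral>\<^sup>+s. \<integral>\<^sup>+t. ennreal s * f (polar p q r s t) \<partial>unit_measure \<partial>unit_measure)"
proof -
  interpret U: prob_space unit_measure by (rule prob_space_unit_measure)
  have nc: "\<not> collinear {p, q, r}"
    using not_collinear assms(1) by simp
  let ?D = "ennreal \<bar>(q - p) $ 1 * (r - q) $ 2 - (q - p) $ 2 * (r - q) $ 1\<bar>"
  have D: "?D \<noteq> 0" "?D \<noteq> top"
    using not_collinear_det[OF nc] by auto
  have ae: "AE x in lborel. x \<in> K \<longleftrightarrow> x \<in> convex hull {p, q, r}"
  proof -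
    have "frontier (convex hull {p, q, r}) \<in> null_sets lebesgue"
      using negligible_convex_frontier[OF convex_convex_hull] by (simp add: negligible_iff_null_sets)
    from AE_not_in[OF this] have "AE x in lborel. x \<notin> frontier (convex hull {p, q, r})"
      unfolding AE_completion_iff .
    then show ?thesis
      by eventually_elim (use closure_subset[of "convex hull {p, q, r}"] interior_subset[of "convex hull {p, q, r}"]
        in \<open>auto simp: frontier_def closed_triangle_def assms(1)\<close>)
  qed
  have eq: "(\<integral>\<^sup>+x. f x * indicator K x \<partial>lborel) =
      ?D * (\<integral>\<^sup>+s. \<integral>\<^sup>+t. ennreal s * f (polar p q r s t) \<partial>unit_measure \<partial>unit_measure)"
    if [measurable]: "f \<in> borel_measurable borel" for f
  proof -
    have "(\<integral>\<^sup>+x. f x * indicator K x \<partial>lborel) = (\<integral>\<^sup>+x. f x * indicator (convex hull {p, q, r}) x \<partial>lborel)"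
      using ae by (intro nn_integral_cong_AE) (auto elim!: eventually_mono simp: indicator_def)
    then show ?thesis
      by (simp only: nn_integral_triangle[OF nc that])
  qed
  have "ennreal vol = ?D * ennreal (1 / 2)"
    using eq[of "\<lambda>_. 1"] by (simp add: emeasure_K_eq U.emeasure_space_1 nn_integral_unit_measure_id)
  then have "(\<integral>\<^sup>+x. f x \<partial>\<mu>) = (?D * (\<integral>\<^sup>+s. \<integral>\<^sup>+t. ennreal s * f (polar p q r s t) \<partial>unit_measure \<partial>unit_measure)) / (?D * ennreal (1 / 2))"
    by (simp only: nn_integral_\<mu>[OF f] eq[OF f])
  also have "\<dots> = 2 * (\<integral>\<^sup>+s. \<integral>\<^sup>+t. ennreal s * f (polar p q r s t) \<partial>unit_measure \<partial>unit_measure)"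
  proof -
    have "?D * X / (?D * ennreal (1 / 2)) = 2 * X" for X
    proof -
      have half: "inverse (ennreal (1 / 2)) = 2"
        by (subst inverse_ennreal) auto
      have "?D * X / (?D * ennreal (1 / 2)) = X / ennreal (1 / 2)"
        unfolding mult.commute[of ?D] by (rule divide_mult_eq) (use D in auto)
      then show ?thesis
        unfolding divide_ennreal_def half by (simp add: mult.commute)
    qed
    then show ?thesis .
  qed
  finally show ?thesis .
qed

end

subsection \<open>Edge means and traces\<close>

lemma partial_deriv_diff:
  assumes "f differentiable (at x)" "g differentiable (at x)"
  shows "partial_deriv i (\<lambda>x. f x - g x) x = partial_deriv i f x - partial_deriv i g x"
proof -
  have "((\<lambda>x. f x - g x) has_derivative
      (\<lambda>h. frechet_derivative f (at x) h - frechet_derivative g (at x) h)) (at x)"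
    using assms by (intro has_derivative_diff) (simp_all add: frechet_derivative_works[symmetric])
  from partial_deriv_eq[OF this] show ?thesis
    by (simp add: partial_deriv_def)
qed

lemma C_k_diff: "C_k k f \<Longrightarrow> C_k k g \<Longrightarrow> C_k k (\<lambda>x. f x - g x)"
proof (induction k arbitrary: f g)
  case 0
  then show ?case by (auto intro: continuous_on_diff)
next
  case (Suc k)
  then have "partial_deriv i (\<lambda>x. f x - g x) = (\<lambda>x. partial_deriv i f x - partial_deriv i g x)" for i
    by (auto simp: partial_deriv_diff)
  with Suc show ?case
    by (auto intro: differentiable_diff)
qed

lemma smooth_diff: "smooth f \<Longrightarrow> smooth g \<Longrightarrow> smooth (\<lambda>x. f x - g x)"
  by (simp add: smooth_def C_k_diff)

lemma smooth_differentiable: "smooth f \<Longrightarrow> f differentiable (at x)"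
  using smooth_has_derivative differentiableI by blast

lemma nn_integral_lebesgue_on_unit:
  "f \<in> borel_measurable borel \<Longrightarrow> (\<integral>\<^sup>+t. f t \<partial>lebesgue_on {0..1}) = (\<integral>\<^sup>+t. f t \<partial>unit_measure)"
  by (simp add: nn_integral_restrict_space nn_integral_completion nn_integral_unit_measure)

lemma integral_lebesgue_on_unit:
  fixes f :: "real \<Rightarrow> real"
  assumes [measurable]: "f \<in> borel_measurable borel"
  shows "(\<integral>t. f t \<partial>lebesgue_on {0..1}) = (\<integral>t. f t \<partial>unit_measure)"
  by (simp add: integral_restrict_space integral_completion integral_unit_measure mult.commute)

lemma measurable_lebesgue_on_unit:
  "f \<in> borel_measurable borel \<Longrightarrow> f \<in> borel_measurable (lebesgue_on {0..1::real})"
  by (simp add: measurable_restrict_space1 measurable_completion)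

lemma tendsto_0_ennreal_le:
  fixes X Y :: "'a \<Rightarrow> ennreal"
  assumes "\<And>n. X n \<le> Y n" "(Y \<longlongrightarrow> 0) F"
  shows "(X \<longlongrightarrow> 0) F"
  by (rule tendsto_sandwich[OF _ _ tendsto_const assms(2)]) (simp_all add: assms(1))

lemma tendsto_0_ennreal_cancel:
  fixes X :: "'a \<Rightarrow> ennreal"
  assumes "0 < c" "((\<lambda>n. ennreal c * X n) \<longlongrightarrow> 0) F"
  shows "(X \<longlongrightarrow> 0) F"
proof -
  have "ennreal (1 / c) * ennreal c = 1"
    using assms(1) by (simp add: ennreal_mult[symmetric])
  then have "ennreal (1 / c) * (ennreal c * X n) = X n" for n
    by (simp add: mult.assoc[symmetric])
  moreover have "((\<lambda>n. ennreal (1 / c) * (ennreal c * X n)) \<longlongrightarrow> ennreal (1 / c) * 0) F"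
    by (intro tendsto_mult_ennreal tendsto_const assms) auto
  ultimately show ?thesis by simp
qed

lemma vec_nth_measurable [measurable]: "(\<lambda>x::real^2. x $ i) \<in> borel_measurable borel"
  by (intro borel_measurable_continuous_onI continuous_intros)

text \<open>The derivative of \<open>s\<^sup>2 \<phi>(p + s v)\<close> with respect to \<open>s\<close> is \<open>s\<close> times this expression at \<open>x = p + s v\<close>.\<close>

definition radial :: "real^2 \<Rightarrow> (real^2 \<Rightarrow> real) \<Rightarrow> real^2 \<Rightarrow> real" where
  "radial p \<phi> x = 2 * \<phi> x + (partial_deriv 1 \<phi> x * (x - p) $ 1 + partial_deriv 2 \<phi> x * (x - p) $ 2)"

lemma continuous_on_radial: "smooth \<phi> \<Longrightarrow> continuous_on S (radial p \<phi>)"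
  unfolding radial_def[abs_def]
  by (intro continuous_intros smooth_continuous_on smooth_partial_deriv)

lemma radial_measurable: "smooth \<phi> \<Longrightarrow> radial p \<phi> \<in> borel_measurable borel"
  by (intro borel_measurable_continuous_onI continuous_on_radial)

context convex_domain
begin

lemma weak_grad_rep_1:
  assumes "weak_grad u w" "AE x in \<mu>. v x = u x"
  shows "sobolev_rep 1 v u w"
proof (rule sobolev_repI[OF assms])
  have [measurable]: "u \<in> borel_measurable borel" "w i \<in> borel_measurable borel" for i
    using weak_grad_measurable[OF assms(1)] by auto
  show "Lp_norm 1 K u < top" "Lp_norm 1 K (w i) < top" for i
    using assms(1) by (auto simp: Lp_norm_1 weak_grad_def integrable_iff_bounded ennreal_mult_less_top)
qed

end

context triangle
begin

lemma edge_integrand_measurable [measurable]: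
  assumes "smooth \<phi>"
  shows "(\<lambda>t. \<phi> (linepath q r t)) \<in> borel_measurable borel"
  by (intro borel_measurable_continuous_onI continuous_on_compose2[OF smooth_continuous_on[OF assms, of UNIV]])
     (auto intro!: continuous_intros simp: linepath_def)

text \<open>For a vertex \<open>p\<close> this is the mean of the trace of \<open>u\<close> over the edge opposite \<open>p\<close> (\<open>w\<close> the weak
  gradient).\<close>

definition edge_mean :: "real^2 \<Rightarrow> (real^2 \<Rightarrow> real) \<Rightarrow> (2 \<Rightarrow> real^2 \<Rightarrow> real) \<Rightarrow> real" where
  "edge_mean p u w = (\<integral>x. u x \<partial>\<mu>) + (\<integral>x. w 1 x * (x - p) $ 1 + w 2 x * (x - p) $ 2 \<partial>\<mu>) / 2"

lemma coordinate_bound: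
  assumes "p \<in> closure K" "x \<in> K"
  shows "\<bar>(x - p) $ i\<bar> \<le> diameter K"
proof -
  have "dist x p \<le> diameter (closure K)"
    using assms bounded_K closure_subset by (intro diameter_bounded_bound) auto
  then show ?thesis
    using component_le_norm_cart[of "x - p" i] diameter_closure[OF bounded_K] by (simp add: dist_norm)
qed

lemma integrable_mult_coordinate:
  assumes "integrable \<mu> f" "p \<in> closure K"
  shows "integrable \<mu> (\<lambda>x. f x * (x - p) $ i)"
proof (rule Bochner_Integration.integrable_bound)
  show "integrable \<mu> (\<lambda>x. f x * diameter K)"
    using assms(1) by simp
  show "(\<lambda>x. f x * (x - p) $ i) \<in> borel_measurable \<mu>"
    using borel_measurable_integrable[OF assms(1)] by measurable
  show "AE x in \<mu>. norm (f x * (x - p) $ i) \<le> norm (f x * diameter K)"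
    using AE_in_K
  proof eventually_elim
    case (elim x)
    then show ?case
      using coordinate_bound[OF assms(2) elim, of i] diameter_ge_0[OF bounded_K]
      by (simp add: abs_mult mult_left_mono)
  qed
qed

lemma vertex_in_closure: "{p, q, r} = {a, b, c} \<Longrightarrow> p \<in> closure K"
proof -
  assume "{p, q, r} = {a, b, c}"
  then have "p \<in> closed_triangle a b c"
    unfolding closed_triangle_def by (intro hull_inc) auto
  then show ?thesis by (simp add: closure_K)
qed

lemma edge_mean_add:
  assumes "integrable \<mu> u" "\<And>i. integrable \<mu> (w i)" "p \<in> closure K"
  shows "edge_mean p u w = (\<integral>x. u x \<partial>\<mu>) + ((\<integral>x. w 1 x * (x - p) $ 1 \<partial>\<mu>) + (\<integral>x. w 2 x * (x - p) $ 2 \<partial>\<mu>)) / 2"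
  unfolding edge_mean_def using integrable_mult_coordinate[OF assms(2,3)]
  by (subst Bochner_Integration.integral_add) auto

text \<open>The fundamental theorem for \<open>s^2 * \<phi> (p + s v)\<close> on the unit interval.
  The weight \<open>s^2\<close> removes the contribution of the vertex, and its derivative supplies
  the factor \<open>s\<close> of the polar area element.\<close>

lemma polar_derivative:
  assumes "smooth \<phi>"
  shows "(\<integral>s. s * radial p \<phi> (polar p q r s t) \<partial>unit_measure) = \<phi> (linepath q r t)"
    and "ennreal \<bar>\<phi> (linepath q r t)\<bar> \<le> (\<integral>\<^sup>+s. ennreal s * ennreal \<bar>radial p \<phi> (polar p q r s t)\<bar> \<partial>unit_measure)"
proof -
  let ?v = "linepath q r t - p"
  define x where "x s = polar p q r s t" for s
  have x: "x s = p + s *\<^sub>R ?v" for s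
    by (simp add: x_def polar_def)
  have "(x has_derivative (\<lambda>h. h *\<^sub>R ?v)) (at s)" for s
    unfolding x[abs_def] by (auto intro!: derivative_eq_intros)
  from has_derivative_compose[OF this smooth_has_derivative[OF assms(1)]]
  have "((\<lambda>s. \<phi> (x s)) has_derivative (\<lambda>h. h * (partial_deriv 1 \<phi> (x s) * ?v $ 1 + partial_deriv 2 \<phi> (x s) * ?v $ 2))) (at s)" for s
    by (simp add: algebra_simps)
  then have d: "((\<lambda>s. \<phi> (x s)) has_real_derivative
      (partial_deriv 1 \<phi> (x s) * ?v $ 1 + partial_deriv 2 \<phi> (x s) * ?v $ 2)) (at s)" for s
    by (simp add: has_field_derivative_def mult_commute_abs)
  have "((\<lambda>s. s\<^sup>2 * \<phi> (x s)) has_real_derivative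
      2 * s * \<phi> (x s) + s\<^sup>2 * (partial_deriv 1 \<phi> (x s) * ?v $ 1 + partial_deriv 2 \<phi> (x s) * ?v $ 2)) (at s)" for s
    by (auto intro!: derivative_eq_intros d)
  moreover have "2 * s * \<phi> (x s) + s\<^sup>2 * (partial_deriv 1 \<phi> (x s) * ?v $ 1 + partial_deriv 2 \<phi> (x s) * ?v $ 2)
      = s * radial p \<phi> (x s)" for s
  proof -
    have "(x s - p) $ i = s * ?v $ i" for i
      by (simp add: x)
    then show ?thesis
      by (simp only: radial_def) (simp add: algebra_simps power2_eq_square)
  qed
  ultimately have D: "((\<lambda>s. s\<^sup>2 * \<phi> (x s)) has_real_derivative s * radial p \<phi> (x s)) (at s)" for s
    by simp
  have cx: "continuous_on UNIV x"
    unfolding x[abs_def] by (intro continuous_intros)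
  have cont: "continuous_on UNIV (\<lambda>s. s * radial p \<phi> (x s))"
    by (intro continuous_on_mult continuous_on_id continuous_on_compose2[OF continuous_on_radial[OF assms, of UNIV] cx]) auto
  then have m: "(\<lambda>s. s * radial p \<phi> (x s)) \<in> borel_measurable borel"
    by (rule borel_measurable_continuous_onI)
  have "(\<integral>s. s * radial p \<phi> (x s) * indicator {0..1} s \<partial>lborel) = 1\<^sup>2 * \<phi> (x 1) - 0\<^sup>2 * \<phi> (x 0)"
    by (intro integral_FTC_Icc_real D) (use cont in \<open>auto simp: continuous_on_eq_continuous_at\<close>)
  moreover have "x 1 = linepath q r t"
    by (simp add: x)
  ultimately have eq: "(\<integral>s. s * radial p \<phi> (x s) \<partial>unit_measure) = \<phi> (linepath q r t)"
    by (simp add: integral_unit_measure[OF m])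
  then show "(\<integral>s. s * radial p \<phi> (polar p q r s t) \<partial>unit_measure) = \<phi> (linepath q r t)"
    by (simp only: x_def)
  have "integrable lborel (\<lambda>s. indicator {0..1} s *\<^sub>R (s * radial p \<phi> (x s)))"
    by (intro borel_integrable_compact compact_Icc continuous_on_subset[OF cont]) auto
  then have "integrable unit_measure (\<lambda>s. s * radial p \<phi> (x s))"
    unfolding unit_measure_density using m by (subst integrable_density) auto
  from integral_norm_bound_ennreal[OF this]
  have "ennreal \<bar>\<phi> (linepath q r t)\<bar> \<le> (\<integral>\<^sup>+s. ennreal \<bar>s * radial p \<phi> (x s)\<bar> \<partial>unit_measure)"
    by (simp add: eq)
  also have "\<dots> = (\<integral>\<^sup>+s. ennreal s * ennreal \<bar>radial p \<phi> (x s)\<bar> \<partial>unit_measure)"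
    by (intro nn_integral_cong_AE eventually_mono[OF AE_unit_measure_in]) (simp add: abs_mult ennreal_mult)
  finally show "ennreal \<bar>\<phi> (linepath q r t)\<bar> \<le> (\<integral>\<^sup>+s. ennreal s * ennreal \<bar>radial p \<phi> (polar p q r s t)\<bar> \<partial>unit_measure)"
    by (simp only: x_def)
qed

text \<open>The polar formula as an equality of measures, which carries over integrability and
  signed integrals as well. The \<open>max 0\<close> makes the density nonnegative for all real
  \<open>s\<close>; on the unit interval it changes nothing.\<close>

lemma \<mu>_eq_distr_polar:
  assumes "{p, q, r} = {a, b, c}"
  shows "\<mu> = distr (density (unit_measure \<Otimes>\<^sub>M unit_measure) (\<lambda>x. ennreal (2 * max 0 (fst x)))) borel (case_prod (polar p q r))"
proof (rule measure_eqI)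
  interpret U: prob_space unit_measure by (rule prob_space_unit_measure)
  fix A assume "A \<in> sets \<mu>"
  then have [measurable]: "A \<in> sets borel" by simp
  have "emeasure \<mu> A = (\<integral>\<^sup>+x. indicator A x \<partial>\<mu>)"
    using \<open>A \<in> sets \<mu>\<close> by (rule nn_integral_indicator[symmetric])
  also have "\<dots> = 2 * (\<integral>\<^sup>+s. \<integral>\<^sup>+t. ennreal s * indicator A (polar p q r s t) \<partial>unit_measure \<partial>unit_measure)"
    by (rule nn_integral_polar[OF assms]) measurable
  also have "\<dots> = (\<integral>\<^sup>+s. 2 * (\<integral>\<^sup>+t. ennreal s * indicator A (polar p q r s t) \<partial>unit_measure) \<partial>unit_measure)"
    by (rule nn_integral_cmult[symmetric]) measurable
  also have "\<dots> = (\<integral>\<^sup>+s. \<integral>\<^sup>+t. ennreal (2 * max 0 s) * indicator A (polar p q r s t) \<partial>unit_measure \<partial>unit_measure)"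
  proof (rule nn_integral_cong)
    fix s :: real
    have "2 * ennreal s = ennreal (2 * max 0 s)"
      by (auto simp: ennreal_mult max_def ennreal_neg)
    then show "2 * (\<integral>\<^sup>+t. ennreal s * indicator A (polar p q r s t) \<partial>unit_measure)
      = (\<integral>\<^sup>+t. ennreal (2 * max 0 s) * indicator A (polar p q r s t) \<partial>unit_measure)"
      by (subst nn_integral_cmult[symmetric]) (auto simp: mult.assoc[symmetric])
  qed
  also have "\<dots> = (\<integral>\<^sup>+x. ennreal (2 * max 0 (fst x)) * indicator A (case_prod (polar p q r) x) \<partial>(unit_measure \<Otimes>\<^sub>M unit_measure))"
    by (subst U.nn_integral_fst[symmetric]) auto
  also have "\<dots> = emeasure (density (unit_measure \<Otimes>\<^sub>M unit_measure) (\<lambda>x. ennreal (2 * max 0 (fst x)))) (case_prod (polar p q r) -` A)"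
  proof -
    have m: "case_prod (polar p q r) -` A \<in> sets (unit_measure \<Otimes>\<^sub>M unit_measure)"
      using measurable_sets[of "case_prod (polar p q r)" "unit_measure \<Otimes>\<^sub>M unit_measure" borel A]
      by (simp add: space_pair_measure)
    show ?thesis
      by (subst emeasure_density[OF _ m]) (auto intro!: nn_integral_cong simp: indicator_def)
  qed
  also have "\<dots> = emeasure (distr (density (unit_measure \<Otimes>\<^sub>M unit_measure) (\<lambda>x. ennreal (2 * max 0 (fst x)))) borel (case_prod (polar p q r))) A"
    by (subst emeasure_distr) (auto simp: space_pair_measure)
  finally show "emeasure \<mu> A = emeasure (distr (density (unit_measure \<Otimes>\<^sub>M unit_measure) (\<lambda>x. ennreal (2 * max 0 (fst x)))) borel (case_prod (polar p q r))) A" .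
qed simp

lemma integral_radial:
  fixes g\<^sub>0 g\<^sub>1 g\<^sub>2 :: "'b \<Rightarrow> real"
  assumes "integrable M g\<^sub>0" "integrable M g\<^sub>1" "integrable M g\<^sub>2"
  shows "(\<integral>x. 2 * g\<^sub>0 x + (g\<^sub>1 x + g\<^sub>2 x) \<partial>M) = 2 * integral\<^sup>L M g\<^sub>0 + (integral\<^sup>L M g\<^sub>1 + integral\<^sup>L M g\<^sub>2)"
  using assms by simp

text \<open>The mean of \<open>radial\<close> is computed twice: integration along the rays gives
  twice the mean over the opposite edge, and expanding the definition gives
  \<open>2 * edge_mean\<close>.\<close>

lemma smooth_edge_mean:
  assumes pqr: "{p, q, r} = {a, b, c}" and \<phi>: "smooth \<phi>"
  shows "(\<integral>t. \<phi> (linepath q r t) \<partial>lebesgue_on {0..1}) = edge_mean p \<phi> (\<lambda>i. partial_deriv i \<phi>)"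
proof -
  interpret U: prob_space unit_measure by (rule prob_space_unit_measure)
  interpret UU: pair_sigma_finite unit_measure unit_measure ..
  have i: "integrable \<mu> \<phi>" "integrable \<mu> (partial_deriv i \<phi>)" for i
    by (intro integrable_\<mu>_continuous smooth_continuous_on smooth_partial_deriv \<phi>)+
  note ic = integrable_mult_coordinate[OF i(2) vertex_in_closure[OF pqr]]
  have iR: "integrable \<mu> (radial p \<phi>)"
    by (rule integrable_\<mu>_continuous[OF continuous_on_radial[OF \<phi>]])
  have [measurable]: "radial p \<phi> \<in> borel_measurable borel"
    by (rule radial_measurable[OF \<phi>])
  let ?k = "\<lambda>x. 2 * max 0 (fst x) * radial p \<phi> (case_prod (polar p q r) x)"
  have int: "integrable (unit_measure \<Otimes>\<^sub>M unit_measure) ?k"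
    using iR unfolding \<mu>_eq_distr_polar[OF pqr]
    by (subst (asm) integrable_distr_eq, measurable, subst (asm) integrable_density) auto
  have "(\<integral>x. radial p \<phi> x \<partial>\<mu>) = (\<integral>x. ?k x \<partial>(unit_measure \<Otimes>\<^sub>M unit_measure))"
    unfolding \<mu>_eq_distr_polar[OF pqr]
    by (subst integral_distr, measurable, subst integral_density) auto
  also have "\<dots> = (\<integral>t. \<integral>s. 2 * max 0 s * radial p \<phi> (polar p q r s t) \<partial>unit_measure \<partial>unit_measure)"
    using UU.integral_snd[of "\<lambda>s t. 2 * max 0 s * radial p \<phi> (polar p q r s t)"] int
    by (simp add: case_prod_unfold)
  also have "\<dots> = (\<integral>t. 2 * \<phi> (linepath q r t) \<partial>unit_measure)"
  proof (rule Bochner_Integration.integral_cong[OF refl])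
    fix t
    have "(\<integral>s. 2 * max 0 s * radial p \<phi> (polar p q r s t) \<partial>unit_measure)
        = (\<integral>s. 2 * (s * radial p \<phi> (polar p q r s t)) \<partial>unit_measure)"
    proof (rule integral_cong_AE)
      show "AE s in unit_measure. 2 * max 0 s * radial p \<phi> (polar p q r s t) = 2 * (s * radial p \<phi> (polar p q r s t))"
        using AE_unit_measure_in by eventually_elim auto
    qed measurable
    also have "\<dots> = 2 * \<phi> (linepath q r t)"
      using polar_derivative(1)[OF \<phi>, of p q r t] by simp
    finally show "(\<integral>s. 2 * max 0 s * radial p \<phi> (polar p q r s t) \<partial>unit_measure) = 2 * \<phi> (linepath q r t)" .
  qed
  finally have "(\<integral>x. radial p \<phi> x \<partial>\<mu>) = 2 * (\<integral>t. \<phi> (linepath q r t) \<partial>unit_measure)"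
    by simp
  moreover have "(\<integral>x. radial p \<phi> x \<partial>\<mu>) = 2 * edge_mean p \<phi> (\<lambda>i. partial_deriv i \<phi>)"
    unfolding radial_def edge_mean_add[OF i vertex_in_closure[OF pqr]] integral_radial[OF i(1) ic ic]
    by simp
  ultimately show ?thesis
    using edge_integrand_measurable[OF \<phi>] by (simp add: integral_lebesgue_on_unit)
qed

text \<open>The ray formula with absolute values inside, and coordinates of \<open>x - p\<close>
  bounded by the diameter. It turns L^1 convergence of functions and gradients into L^1 convergence
  on each edge.\<close>

lemma smooth_trace_inequality:
  assumes pqr: "{p, q, r} = {a, b, c}" and \<phi>: "smooth \<phi>"
  shows "(\<integral>\<^sup>+t. ennreal \<bar>\<phi> (linepath q r t)\<bar> \<partial>lebesgue_on {0..1})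
    \<le> L1 \<phi> + ennreal (diameter K) *
       (L1 (partial_deriv 1 \<phi>) + L1 (partial_deriv 2 \<phi>))"
proof -
  interpret U: prob_space unit_measure by (rule prob_space_unit_measure)
  interpret UU: pair_sigma_finite unit_measure unit_measure ..
  have [measurable]: "radial p \<phi> \<in> borel_measurable borel"
    by (rule radial_measurable[OF \<phi>])
  have [measurable]: "\<phi> \<in> borel_measurable borel" "partial_deriv i \<phi> \<in> borel_measurable borel" for i
    using smooth_measurable[OF \<phi>] smooth_measurable[OF smooth_partial_deriv[OF \<phi>]] by auto
  have "2 * (\<integral>\<^sup>+t. ennreal \<bar>\<phi> (linepath q r t)\<bar> \<partial>lebesgue_on {0..1}) = 2 * (\<integral>\<^sup>+t. ennreal \<bar>\<phi> (linepath q r t)\<bar> \<partial>unit_measure)"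
    using edge_integrand_measurable[OF \<phi>] by (simp add: nn_integral_lebesgue_on_unit)
  also have "\<dots> \<le> 2 * (\<integral>\<^sup>+t. \<integral>\<^sup>+s. ennreal s * ennreal \<bar>radial p \<phi> (polar p q r s t)\<bar> \<partial>unit_measure \<partial>unit_measure)"
    by (intro mult_left_mono nn_integral_mono polar_derivative(2)[OF \<phi>]) auto
  also have "\<dots> = 2 * (\<integral>\<^sup>+s. \<integral>\<^sup>+t. ennreal s * ennreal \<bar>radial p \<phi> (polar p q r s t)\<bar> \<partial>unit_measure \<partial>unit_measure)"
    by (subst UU.Fubini') auto
  also have "\<dots> = L1 (radial p \<phi>)"
    by (rule nn_integral_polar[OF pqr, symmetric]) measurable
  also have "\<dots> \<le> (\<integral>\<^sup>+x. 2 * (ennreal \<bar>\<phi> x\<bar> + ennreal (diameter K) * (ennreal \<bar>partial_deriv 1 \<phi> x\<bar> + ennreal \<bar>partial_deriv 2 \<phi> x\<bar>)) \<partial>\<mu>)"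
  proof (intro nn_integral_mono_AE eventually_mono[OF AE_in_K])
    fix x assume x: "x \<in> K"
    note cb = coordinate_bound[OF vertex_in_closure[OF pqr] x]
    have D: "diameter K \<ge> 0" by (rule diameter_ge_0[OF bounded_K])
    \<comment> \<open>The factor 2 is given away so that it can be cancelled together with the 2 in
      front of the function values.\<close>
    have "\<bar>partial_deriv i \<phi> x * (x - p) $ i\<bar> \<le> 2 * (diameter K * \<bar>partial_deriv i \<phi> x\<bar>)" for i
    proof -
      have "\<bar>partial_deriv i \<phi> x * (x - p) $ i\<bar> \<le> \<bar>partial_deriv i \<phi> x\<bar> * diameter K"
        unfolding abs_mult by (intro mult_left_mono cb) auto
      also have "\<dots> \<le> 2 * (diameter K * \<bar>partial_deriv i \<phi> x\<bar>)"
        using D by simp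
      finally show ?thesis .
    qed
    from this[of 1] this[of 2]
    have "\<bar>radial p \<phi> x\<bar> \<le> 2 * (\<bar>\<phi> x\<bar> + diameter K * (\<bar>partial_deriv 1 \<phi> x\<bar> + \<bar>partial_deriv 2 \<phi> x\<bar>))"
      unfolding distrib_left radial_def by linarith
    then have "ennreal \<bar>radial p \<phi> x\<bar> \<le> ennreal (2 * (\<bar>\<phi> x\<bar> + diameter K * (\<bar>partial_deriv 1 \<phi> x\<bar> + \<bar>partial_deriv 2 \<phi> x\<bar>)))"
      by (rule ennreal_leI)
    also have "\<dots> = 2 * (ennreal \<bar>\<phi> x\<bar> + ennreal (diameter K) * (ennreal \<bar>partial_deriv 1 \<phi> x\<bar> + ennreal \<bar>partial_deriv 2 \<phi> x\<bar>))"
      using D by (simp add: ennreal_mult)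
    finally show "ennreal \<bar>radial p \<phi> x\<bar> \<le> 2 * (ennreal \<bar>\<phi> x\<bar> + ennreal (diameter K) * (ennreal \<bar>partial_deriv 1 \<phi> x\<bar> + ennreal \<bar>partial_deriv 2 \<phi> x\<bar>))" .
  qed
  also have "\<dots> = 2 * (L1 \<phi> + ennreal (diameter K) *
       (L1 (partial_deriv 1 \<phi>) + L1 (partial_deriv 2 \<phi>)))"
    by (simp add: nn_integral_cmult nn_integral_add)
  finally show ?thesis
    by (subst (asm) ennreal_mult_le_mult_iff) auto
qed

text \<open>Since \<open>x - p\<close> is bounded on K, \<open>edge_mean\<close> is continuous under
  L^1 convergence of function and gradient; this carries the smooth formula to Sobolev
  functions.\<close>

lemma edge_mean_tendsto:
  assumes u: "integrable \<mu> u" and w: "\<And>i. integrable \<mu> (w i)" and p: "p \<in> closure K"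
    and \<phi>: "\<And>n. smooth (\<phi> n)"
    and lim: "(\<lambda>n. L1 (\<lambda>x. \<phi> n x - u x)) \<longlonglongrightarrow> 0"
      "\<And>i. (\<lambda>n. L1 (\<lambda>x. partial_deriv i (\<phi> n) x - w i x)) \<longlonglongrightarrow> 0"
  shows "(\<lambda>n. edge_mean p (\<phi> n) (\<lambda>i. partial_deriv i (\<phi> n))) \<longlonglongrightarrow> edge_mean p u w"
proof -
  have i: "integrable \<mu> (\<phi> n)" "integrable \<mu> (partial_deriv i (\<phi> n))" for n i
    by (intro integrable_\<mu>_continuous smooth_continuous_on smooth_partial_deriv \<phi>)+
  have 1: "(\<lambda>n. \<integral>x. \<phi> n x \<partial>\<mu>) \<longlonglongrightarrow> (\<integral>x. u x \<partial>\<mu>)"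
    by (rule tendsto_L1_int[OF i(1) u]) (use lim(1) in simp)
  have 2: "(\<lambda>n. \<integral>x. partial_deriv i (\<phi> n) x * (x - p) $ i \<partial>\<mu>) \<longlonglongrightarrow> (\<integral>x. w i x * (x - p) $ i \<partial>\<mu>)" for i
  proof (rule tendsto_L1_int)
    have [measurable]: "w i \<in> borel_measurable borel" "partial_deriv i (\<phi> n) \<in> borel_measurable borel" for n
      using borel_measurable_integrable[OF w[of i]] borel_measurable_integrable[OF i(2)[of i n]] by auto
    have "(\<integral>\<^sup>+x. ennreal (norm (partial_deriv i (\<phi> n) x * (x - p) $ i - w i x * (x - p) $ i)) \<partial>\<mu>)
        \<le> (\<integral>\<^sup>+x. ennreal (diameter K) * ennreal \<bar>partial_deriv i (\<phi> n) x - w i x\<bar> \<partial>\<mu>)" for n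
    proof (intro nn_integral_mono_AE eventually_mono[OF AE_in_K])
      fix x assume x: "x \<in> K"
      have "norm (partial_deriv i (\<phi> n) x * (x - p) $ i - w i x * (x - p) $ i)
          = \<bar>(x - p) $ i\<bar> * \<bar>partial_deriv i (\<phi> n) x - w i x\<bar>"
        unfolding left_diff_distrib[symmetric] by (simp only: real_norm_def abs_mult mult.commute)
      also have "\<dots> \<le> diameter K * \<bar>partial_deriv i (\<phi> n) x - w i x\<bar>"
        by (intro mult_right_mono coordinate_bound p x) auto
      finally show "ennreal (norm (partial_deriv i (\<phi> n) x * (x - p) $ i - w i x * (x - p) $ i))
          \<le> ennreal (diameter K) * ennreal \<bar>partial_deriv i (\<phi> n) x - w i x\<bar>"
        using diameter_ge_0[OF bounded_K] by (simp add: ennreal_mult[symmetric] ennreal_leI)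
    qed
    then have le: "(\<integral>\<^sup>+x. ennreal (norm (partial_deriv i (\<phi> n) x * (x - p) $ i - w i x * (x - p) $ i)) \<partial>\<mu>)
        \<le> ennreal (diameter K) * L1 (\<lambda>x. partial_deriv i (\<phi> n) x - w i x)" for n
      by (simp add: nn_integral_cmult)
    have "(\<lambda>n. ennreal (diameter K) * L1 (\<lambda>x. partial_deriv i (\<phi> n) x - w i x)) \<longlonglongrightarrow> ennreal (diameter K) * 0"
      by (intro tendsto_mult_ennreal tendsto_const lim) auto
    then have "(\<lambda>n. ennreal (diameter K) * L1 (\<lambda>x. partial_deriv i (\<phi> n) x - w i x)) \<longlonglongrightarrow> 0"
      by simp
    then show "(\<lambda>n. \<integral>\<^sup>+x. ennreal (norm (partial_deriv i (\<phi> n) x * (x - p) $ i - w i x * (x - p) $ i)) \<partial>\<mu>) \<longlonglongrightarrow> 0"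
      by (rule tendsto_0_ennreal_le[OF le])
  qed (intro integrable_mult_coordinate i w p)+
  have "(\<lambda>n. (\<integral>x. \<phi> n x \<partial>\<mu>) + ((\<integral>x. partial_deriv 1 (\<phi> n) x * (x - p) $ 1 \<partial>\<mu>) + (\<integral>x. partial_deriv 2 (\<phi> n) x * (x - p) $ 2 \<partial>\<mu>)) / 2)
      \<longlonglongrightarrow> (\<integral>x. u x \<partial>\<mu>) + ((\<integral>x. w 1 x * (x - p) $ 1 \<partial>\<mu>) + (\<integral>x. w 2 x * (x - p) $ 2 \<partial>\<mu>)) / 2"
    by (intro tendsto_intros 1 2) auto
  then show ?thesis
    by (simp only: edge_mean_add[OF u w p] edge_mean_add[OF i p])
qed

end

text \<open>A rapidly Cauchy sequence converges almost everywhere, because its increments have a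
  summable L^1 bound. The limit is written as \<open>lim\<close> of the values, an explicit function
  of the point, rather than as an anonymous element of L^1.\<close>

lemma L1_limit:
  fixes f :: "nat \<Rightarrow> 'a \<Rightarrow> real"
  assumes [measurable]: "\<And>n. f n \<in> borel_measurable M" and "0 \<le> C"
    and le: "\<And>k m. k \<le> m \<Longrightarrow> (\<integral>\<^sup>+x. ennreal \<bar>f m x - f k x\<bar> \<partial>M) \<le> ennreal (C * (1 / 2) ^ k)"
  shows "(\<lambda>k. \<integral>\<^sup>+x. ennreal \<bar>f k x - lim (\<lambda>n. f n x)\<bar> \<partial>M) \<longlonglongrightarrow> 0"
proof -
  have sums: "(\<lambda>k. C * (1 / 2) ^ k) sums (C * 2)"
    using sums_mult[OF geometric_sums[of "1 / 2 :: real"], of C] by simp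
  have "(\<integral>\<^sup>+x. (\<Sum>k. ennreal \<bar>f (Suc k) x - f k x\<bar>) \<partial>M) = (\<Sum>k. \<integral>\<^sup>+x. ennreal \<bar>f (Suc k) x - f k x\<bar> \<partial>M)"
    by (rule nn_integral_suminf) measurable
  also have "\<dots> \<le> (\<Sum>k. ennreal (C * (1 / 2) ^ k))"
    by (intro suminf_le le summableI) simp
  also have "\<dots> < \<infinity>"
    using sums \<open>0 \<le> C\<close> by (subst suminf_ennreal2) (auto simp: sums_iff)
  finally have "AE x in M. (\<Sum>k. ennreal \<bar>f (Suc k) x - f k x\<bar>) \<noteq> \<infinity>"
    by (intro nn_integral_noteq_infinite) auto
  then have conv: "AE x in M. (\<lambda>n. f n x) \<longlonglongrightarrow> lim (\<lambda>n. f n x)"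
  proof eventually_elim
    case (elim x)
    then have "summable (\<lambda>k. \<bar>f (Suc k) x - f k x\<bar>)"
      by (intro summable_suminf_not_top) auto
    then have "summable (\<lambda>k. f (Suc k) x - f k x)"
      by (rule summable_rabs_cancel)
    moreover have "(\<Sum>i<n. f (Suc i) x - f i x) = f n x - f 0 x" for n
      by (rule sum_lessThan_telescope)
    ultimately have "convergent (\<lambda>n. f n x - f 0 x)"
      by (simp add: summable_iff_convergent)
    then have "convergent (\<lambda>n. f n x)"
      using convergent_add_const_right_iff[of "\<lambda>n. f n x" "- f 0 x"] by simp
    then show ?case
      by (simp add: convergent_LIMSEQ_iff)
  qed
  have "(\<integral>\<^sup>+x. ennreal \<bar>f k x - lim (\<lambda>n. f n x)\<bar> \<partial>M) \<le> ennreal (C * (1 / 2) ^ k)" for k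
  proof -
    \<comment> \<open>Fatou's lemma carries the Cauchy estimate from \<open>f m\<close> to the
      limit.\<close>
    have "(\<integral>\<^sup>+x. ennreal \<bar>f k x - lim (\<lambda>n. f n x)\<bar> \<partial>M) = (\<integral>\<^sup>+x. liminf (\<lambda>m. ennreal \<bar>f m x - f k x\<bar>) \<partial>M)"
    proof (rule nn_integral_cong_AE)
      show "AE x in M. ennreal \<bar>f k x - lim (\<lambda>n. f n x)\<bar> = liminf (\<lambda>m. ennreal \<bar>f m x - f k x\<bar>)"
        using conv
      proof eventually_elim
        case (elim x)
        have "(\<lambda>m. ennreal \<bar>f m x - f k x\<bar>) \<longlonglongrightarrow> ennreal \<bar>lim (\<lambda>n. f n x) - f k x\<bar>"
          by (intro tendsto_intros tendsto_ennrealI elim)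
        from lim_imp_Liminf[OF trivial_limit_sequentially this] show ?case
          by (simp add: abs_minus_commute)
      qed
    qed
    also have "\<dots> \<le> liminf (\<lambda>m. \<integral>\<^sup>+x. ennreal \<bar>f m x - f k x\<bar> \<partial>M)"
      by (rule nn_integral_liminf) measurable
    also have "\<dots> \<le> limsup (\<lambda>m. \<integral>\<^sup>+x. ennreal \<bar>f m x - f k x\<bar> \<partial>M)"
      by (rule Liminf_le_Limsup) simp
    also have "\<dots> \<le> ennreal (C * (1 / 2) ^ k)"
      by (rule Limsup_bounded) (auto intro!: eventually_sequentiallyI[of k] le)
    finally show ?thesis .
  qed
  moreover have "(\<lambda>k. ennreal (C * (1 / 2) ^ k)) \<longlonglongrightarrow> 0"
    using tendsto_ennrealI[OF summable_LIMSEQ_zero[OF sums_summable[OF sums]]] by simp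
  ultimately show ?thesis
    by (rule tendsto_0_ennreal_le)
qed

section \<open>Affine polynomials\<close>

definition affine_fun :: "real \<Rightarrow> real \<Rightarrow> real \<Rightarrow> real^2 \<Rightarrow> real" where
  "affine_fun \<alpha> \<beta> \<gamma> x = \<alpha> + \<beta> * x $ 1 + \<gamma> * x $ 2"

lemma affine_polys_eq: "q \<in> affine_polys \<longleftrightarrow> (\<exists>\<alpha> \<beta> \<gamma>. q = affine_fun \<alpha> \<beta> \<gamma>)"
  by (simp add: affine_polys_def affine_fun_def[abs_def])

lemma affine_fun_has_derivative: "(affine_fun \<alpha> \<beta> \<gamma> has_derivative (\<lambda>h. \<beta> * h $ 1 + \<gamma> * h $ 2)) (at x)"
  unfolding affine_fun_def[abs_def]
  by (auto intro!: derivative_eq_intros bounded_linear_imp_has_derivative bounded_linear_vec_nth)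

lemma partial_deriv_affine_fun:
  "partial_deriv i (affine_fun \<alpha> \<beta> \<gamma>) = (\<lambda>x. if i = 1 then \<beta> else \<gamma>)"
  using exhaust_2[of i] by (auto simp: fun_eq_iff partial_deriv_eq[OF affine_fun_has_derivative] axis_def)

lemma smooth_affine_fun: "smooth (affine_fun \<alpha> \<beta> \<gamma>)"
proof -
  have "C_k k (affine_fun \<alpha> \<beta> \<gamma>)" for k \<alpha> \<beta> \<gamma>
  proof (induction k arbitrary: \<alpha> \<beta> \<gamma>)
    case 0
    show ?case
      unfolding C_k.simps affine_fun_def by (intro continuous_intros)
  next
    case (Suc k)
    have "partial_deriv i (affine_fun \<alpha> \<beta> \<gamma>) = affine_fun (if i = 1 then \<beta> else \<gamma>) 0 0" for i
      unfolding partial_deriv_affine_fun by (simp add: affine_fun_def[abs_def])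
    moreover have "affine_fun \<alpha> \<beta> \<gamma> differentiable (at x)" for x
      by (rule differentiableI[OF affine_fun_has_derivative])
    ultimately show ?case
      using Suc by auto
  qed
  then show ?thesis by (simp add: smooth_def)
qed

text \<open>The degenerate denominators obey the bound as well: for \<open>y = 0\<close> the premise
  forces \<open>x = 0\<close> and \<open>0 / 0 = 0\<close>, and division by \<open>top\<close> gives
  0. Hence the suprema of quotients can be bounded without showing that the first seminorm of a
  nonzero function is positive.\<close>

lemma divide_le_ennrealI: "x \<le> c * y \<Longrightarrow> x / y \<le> c" for x y c :: ennreal
proof (cases "y = 0 \<or> y = top")
  case True
  assume "x \<le> c * y"
  with True show ?thesis by (auto simp: le_zero_eq)
next
  case False
  assume "x \<le> c * y"
  then have "x / y \<le> c * y / y"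
    by (rule divide_right_mono_ennreal)
  with False show ?thesis
    by (simp add: mult_divide_eq_ennreal)
qed

context triangle
begin

text \<open>Translates the convergences in the definition of a trace into L^1 convergence over
  \<open>\<mu>\<close> and back.\<close>

lemma seminorm_smooth_diff:
  assumes g: "weak_grad u w" and ae: "AE x in \<mu>. v x = u x" and \<phi>: "smooth \<phi>"
  defines "d \<equiv> (\<lambda>i. L1 (\<lambda>x. partial_deriv i \<phi> x - w i x))"
  shows "seminorm 0 1 K (\<lambda>x. \<phi> x - v x) = ennreal vol * L1 (\<lambda>x. \<phi> x - u x)"
    and "ennreal vol * d i \<le> seminorm 1 1 K (\<lambda>x. \<phi> x - v x)"
    and "seminorm 1 1 K (\<lambda>x. \<phi> x - v x) \<le> ennreal vol * (d 1 + d 2)"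
proof -
  have g': "weak_grad (\<lambda>x. \<phi> x - u x) (\<lambda>i x. partial_deriv i \<phi> x - w i x)"
    by (rule weak_grad_diff[OF smooth_weak_grad[OF \<phi>] g])
  have ae': "AE x in \<mu>. \<phi> x - v x = \<phi> x - u x"
    using ae by eventually_elim simp
  note rep = weak_grad_rep_1[OF g' ae']
  note N = Lp_norm_1[OF weak_grad_measurable(1)[OF g']] Lp_norm_1[OF weak_grad_measurable(2)[OF g']]
  show "seminorm 0 1 K (\<lambda>x. \<phi> x - v x) = ennreal vol * L1 (\<lambda>x. \<phi> x - u x)"
    using seminorm_0_rep[OF rep] N(1) by simp
  show "ennreal vol * d i \<le> seminorm 1 1 K (\<lambda>x. \<phi> x - v x)"
    using seminorm_1_rep(1)[OF rep order_refl, of i] N(2)[of i] by (simp add: d_def)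
  show "seminorm 1 1 K (\<lambda>x. \<phi> x - v x) \<le> ennreal vol * (d 1 + d 2)"
    using seminorm_1_rep(2)[OF rep order_refl] N(2)[of 1] N(2)[of 2] by (simp add: d_def distrib_left)
qed

lemma edge_distinct:
  assumes "{p, q, r} = {a, b, c}"
  shows "dist q r > 0"
proof -
  have "\<not> collinear {p, q, r}"
    using not_collinear assms by simp
  then have "q \<noteq> r"
    by (auto simp: insert_commute)
  then show ?thesis by simp
qed

text \<open>Along the smooth functions that witness the trace, edge means converge to the edge mean
  of \<open>g\<close> and, by the smooth formula, to \<open>edge_mean\<close> of \<open>u\<close>
  and \<open>w\<close>. The value is therefore the same for every trace, in particular for the
  chosen one.\<close>

lemma trace_mean:
  assumes tr: "is_trace a b c v g" and g: "weak_grad u w" and ae: "AE x in \<mu>. v x = u x"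
    and pqr: "{p, q, r} = {a, b, c}" "(q, r) \<in> edges a b c"
  shows "(\<integral>t. g (linepath q r t) \<partial>lebesgue_on {0..1}) = edge_mean p u w"
proof -
  let ?L = "lebesgue_on {0..1::real}" and ?\<gamma> = "linepath q r"
  obtain \<phi> :: "nat \<Rightarrow> real^2 \<Rightarrow> real" where \<phi>: "\<And>n. smooth (\<phi> n)"
    and lim: "(\<lambda>n. seminorm 0 1 K (\<lambda>x. \<phi> n x - v x)) \<longlonglongrightarrow> 0"
      "(\<lambda>n. seminorm 1 1 K (\<lambda>x. \<phi> n x - v x)) \<longlonglongrightarrow> 0"
      "(\<lambda>n. edge_L1_norm (q, r) (\<lambda>x. \<phi> n x - g x)) \<longlonglongrightarrow> 0"
    using tr pqr(2) unfolding is_trace_def by blast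
  have m: "(\<lambda>t. g (?\<gamma> t)) \<in> borel_measurable ?L"
    using tr pqr(2) by (auto simp: is_trace_def edge_measurable_def)
  have u: "integrable \<mu> u" and w: "\<And>i. integrable \<mu> (w i)"
    using g by (auto simp: weak_grad_def)
  have 0: "(\<lambda>n. L1 (\<lambda>x. \<phi> n x - u x)) \<longlonglongrightarrow> 0"
    by (rule tendsto_0_ennreal_cancel[OF vol_pos lim(1)[unfolded seminorm_smooth_diff(1)[OF g ae \<phi>]]])
  have 1: "(\<lambda>n. L1 (\<lambda>x. partial_deriv i (\<phi> n) x - w i x)) \<longlonglongrightarrow> 0" for i
    by (rule tendsto_0_ennreal_cancel[OF vol_pos tendsto_0_ennreal_le[OF seminorm_smooth_diff(2)[OF g ae \<phi>] lim(2)]])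
  have L1: "(\<lambda>n. \<integral>\<^sup>+t. ennreal \<bar>\<phi> n (?\<gamma> t) - g (?\<gamma> t)\<bar> \<partial>?L) \<longlonglongrightarrow> 0"
    by (rule tendsto_0_ennreal_cancel[OF edge_distinct[OF pqr(1)] lim(3)[unfolded edge_L1_norm_def fst_conv snd_conv]])
  have i\<phi>: "integrable ?L (\<lambda>t. \<phi> n (?\<gamma> t))" for n
  proof -
    have "L1 (\<phi> n) + ennreal (diameter K) *
       (L1 (partial_deriv 1 (\<phi> n)) + L1 (partial_deriv 2 (\<phi> n))) < \<infinity>"
      using smooth_weak_grad[OF \<phi>[of n]] by (auto simp: weak_grad_def integrable_iff_bounded ennreal_mult_less_top)
    then show ?thesis
      using smooth_trace_inequality[OF pqr(1) \<phi>[of n]] measurable_lebesgue_on_unit[OF edge_integrand_measurable[OF \<phi>]]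
      by (auto simp: integrable_iff_bounded intro: le_less_trans)
  qed
  have ig: "integrable ?L (\<lambda>t. g (?\<gamma> t))"
  proof -
    have "\<forall>\<^sub>F n in sequentially. (\<integral>\<^sup>+t. ennreal \<bar>\<phi> n (?\<gamma> t) - g (?\<gamma> t)\<bar> \<partial>?L) < 1"
      by (rule order_tendstoD(2)[OF L1]) simp
    then obtain n where n: "(\<integral>\<^sup>+t. ennreal \<bar>\<phi> n (?\<gamma> t) - g (?\<gamma> t)\<bar> \<partial>?L) < 1"
      by (auto simp: eventually_sequentially)
    have "integrable ?L (\<lambda>t. \<phi> n (?\<gamma> t) - g (?\<gamma> t))"
      using n m measurable_lebesgue_on_unit[OF edge_integrand_measurable[OF \<phi>[of n], of q r]]
      by (auto simp: integrable_iff_bounded intro: less_trans)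
    from Bochner_Integration.integrable_diff[OF i\<phi>[of n] this] show ?thesis by simp
  qed
  have "(\<lambda>n. \<integral>t. \<phi> n (?\<gamma> t) \<partial>?L) \<longlonglongrightarrow> (\<integral>t. g (?\<gamma> t) \<partial>?L)"
    by (rule tendsto_L1_int[OF i\<phi> ig]) (use L1 in simp)
  moreover have "(\<lambda>n. \<integral>t. \<phi> n (?\<gamma> t) \<partial>?L) \<longlonglongrightarrow> edge_mean p u w"
    unfolding smooth_edge_mean[OF pqr(1) \<phi>]
    by (rule edge_mean_tendsto[OF u w vertex_in_closure[OF pqr(1)] \<phi> 0 1])
  ultimately show ?thesis
    by (rule LIMSEQ_unique)
qed

lemma edges_cases:
  assumes "e \<in> edges a b c"
  obtains p q r where "e = (q, r)" "{p, q, r} = {a, b, c}"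
  using assms that[of b c a] that[of c a b] that[of a b c] by (auto simp: edges_def insert_commute)

text \<open>A subsequence of the smooth approximations with errors below \<open>(1 / 2)^k\<close> is
  rapidly Cauchy on each edge by the trace inequality applied to differences.\<close>

lemma trace_exists:
  assumes g: "weak_grad u w" and ae: "AE x in \<mu>. v x = u x"
  obtains g where "is_trace a b c v g"
proof -
  obtain \<phi> :: "nat \<Rightarrow> real^2 \<Rightarrow> real" where \<phi>: "\<And>n. smooth (\<phi> n)"
    and lim: "(\<lambda>n. L1 (\<lambda>x. \<phi> n x - u x)) \<longlonglongrightarrow> 0"
    "\<And>i. (\<lambda>n. L1 (\<lambda>x. partial_deriv i (\<phi> n) x - w i x)) \<longlonglongrightarrow> 0"
    by (rule weak_grad_approx[OF g]) (rule that)
  define X where "X \<psi> = L1 (\<lambda>x. \<psi> x - u x) + (L1 (\<lambda>x. partial_deriv 1 \<psi> x - w 1 x)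
    + L1 (\<lambda>x. partial_deriv 2 \<psi> x - w 2 x))" for \<psi> :: "real^2 \<Rightarrow> real"
  have "(\<lambda>n. X (\<phi> n)) \<longlonglongrightarrow> 0 + (0 + 0)"
    unfolding X_def by (intro tendsto_add lim)
  then have "\<exists>n. X (\<phi> n) < ennreal ((1 / 2) ^ k)" for k
    using order_tendstoD(2)[of "\<lambda>n. X (\<phi> n)" 0 sequentially "ennreal ((1 / 2) ^ k)"]
    by (auto simp: eventually_sequentially)
  then obtain N where N: "\<And>k. X (\<phi> (N k)) < ennreal ((1 / 2) ^ k)"
    by metis
  define \<psi> where "\<psi> k = \<phi> (N k)" for k
  have \<psi>: "smooth (\<psi> k)" and X: "X (\<psi> k) \<le> ennreal ((1 / 2) ^ k)" for k
    using \<phi> N[of k] by (auto simp: \<psi>_def)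
  have X0: "(\<lambda>k. X (\<psi> k)) \<longlonglongrightarrow> 0"
    using tendsto_0_ennreal_le[OF X] tendsto_ennrealI[OF LIMSEQ_realpow_zero[of "1 / 2"]] by simp
  \<comment> \<open>A pointwise limit on the whole plane serves all three edges at once, so limits
    on separate edges need not be glued at the vertices.\<close>
  define h where "h x = lim (\<lambda>k. \<psi> k x)" for x
  have [measurable]: "u \<in> borel_measurable borel" "w i \<in> borel_measurable borel" for i
    using weak_grad_measurable[OF g] by auto
  have [measurable]: "\<psi> k \<in> borel_measurable borel" "partial_deriv i (\<psi> k) \<in> borel_measurable borel" for i k
    using smooth_measurable[OF \<psi>] smooth_measurable[OF smooth_partial_deriv[OF \<psi>]] by auto
  have D: "diameter K \<ge> 0" by (rule diameter_ge_0[OF bounded_K])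
  have cauchy: "(\<integral>\<^sup>+t. ennreal \<bar>\<psi> m (linepath q r t) - \<psi> k (linepath q r t)\<bar> \<partial>lebesgue_on {0..1})
      \<le> ennreal (2 * (1 + diameter K) * (1 / 2) ^ k)" if pqr: "{p, q, r} = {a, b, c}" and "k \<le> m" for p q r k m
  proof -
    let ?\<eta> = "\<lambda>x. \<psi> m x - \<psi> k x"
    have pd: "partial_deriv i ?\<eta> x = partial_deriv i (\<psi> m) x - partial_deriv i (\<psi> k) x" for i x
      by (intro partial_deriv_diff smooth_differentiable \<psi>)
    have tri: "L1 (\<lambda>x. f x - f' x) \<le> L1 (\<lambda>x. f x - f'' x) + L1 (\<lambda>x. f' x - f'' x)"
      if [measurable]: "f \<in> borel_measurable borel" "f' \<in> borel_measurable borel" "f'' \<in> borel_measurable borel"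
      for f f' f'' :: "real^2 \<Rightarrow> real"
    proof -
      have "L1 (\<lambda>x. f x - f' x) \<le> (\<integral>\<^sup>+x. ennreal \<bar>f x - f'' x\<bar> + ennreal \<bar>f' x - f'' x\<bar> \<partial>\<mu>)"
        by (intro nn_integral_mono) (simp flip: ennreal_plus)
      then show ?thesis by (simp add: nn_integral_add)
    qed
    have pow: "(1 / 2 :: real) ^ m \<le> (1 / 2) ^ k"
      using \<open>k \<le> m\<close> by (intro power_decreasing) auto
    let ?A = "L1 ?\<eta>"
    let ?B = "L1 (partial_deriv 1 ?\<eta>) + L1 (partial_deriv 2 ?\<eta>)"
    have "(\<integral>\<^sup>+t. ennreal \<bar>?\<eta> (linepath q r t)\<bar> \<partial>lebesgue_on {0..1}) \<le> ?A + ennreal (diameter K) * ?B"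
      by (rule smooth_trace_inequality[OF pqr smooth_diff[OF \<psi> \<psi>]])
    also have "\<dots> \<le> ennreal (1 + diameter K) * (?A + ?B)"
      using D by (simp add: distrib_left distrib_right add_increasing2 add_mono ac_simps)
    also have "?A + ?B \<le> X (\<psi> m) + X (\<psi> k)"
    proof -
      have "?A + ?B \<le> (L1 (\<lambda>x. \<psi> m x - u x) + L1 (\<lambda>x. \<psi> k x - u x))
        + ((L1 (\<lambda>x. partial_deriv 1 (\<psi> m) x - w 1 x) + L1 (\<lambda>x. partial_deriv 1 (\<psi> k) x - w 1 x))
        + (L1 (\<lambda>x. partial_deriv 2 (\<psi> m) x - w 2 x) + L1 (\<lambda>x. partial_deriv 2 (\<psi> k) x - w 2 x)))"
        unfolding pd by (intro add_mono tri) auto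
      then show ?thesis
        by (simp add: X_def ac_simps)
    qed
    also have "X (\<psi> m) + X (\<psi> k) \<le> ennreal ((1 / 2) ^ k) + ennreal ((1 / 2) ^ k)"
      by (intro add_mono order_trans[OF X[of m] ennreal_leI[OF pow]] X)
    also have "ennreal (1 + diameter K) * (ennreal ((1 / 2) ^ k) + ennreal ((1 / 2) ^ k)) = ennreal (2 * (1 + diameter K) * (1 / 2) ^ k)"
      using D by (simp add: ennreal_mult[symmetric] ennreal_plus[symmetric] algebra_simps del: ennreal_plus)
    finally show ?thesis by (simp add: mult_left_mono)
  qed
  have "is_trace a b c v h"
    unfolding is_trace_def
  proof (intro conjI exI[of _ \<psi>] allI ballI)
    show "v \<in> sobolev 1 1 K"
      by (rule sobolev_if_rep[OF weak_grad_rep_1[OF g ae]])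
    show "smooth (\<psi> k)" for k by (rule \<psi>)
    show "(\<lambda>k. seminorm 0 1 K (\<lambda>x. \<psi> k x - v x)) \<longlonglongrightarrow> 0"
    proof (rule tendsto_0_ennreal_le)
      show "seminorm 0 1 K (\<lambda>x. \<psi> k x - v x) \<le> ennreal vol * X (\<psi> k)" for k
        unfolding seminorm_smooth_diff(1)[OF g ae \<psi>] X_def by (intro mult_left_mono add_increasing2) auto
      show "(\<lambda>k. ennreal vol * X (\<psi> k)) \<longlonglongrightarrow> 0"
        using tendsto_mult_ennreal[OF tendsto_const X0, of "ennreal vol"] by simp
    qed
    show "(\<lambda>k. seminorm 1 1 K (\<lambda>x. \<psi> k x - v x)) \<longlonglongrightarrow> 0"
    proof (rule tendsto_0_ennreal_le)
      show "seminorm 1 1 K (\<lambda>x. \<psi> k x - v x) \<le> ennreal vol * X (\<psi> k)" for k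
        unfolding X_def by (intro order_trans[OF seminorm_smooth_diff(3)[OF g ae \<psi>]] mult_left_mono
            add_increasing[OF zero_le order_refl] zero_le)
      show "(\<lambda>k. ennreal vol * X (\<psi> k)) \<longlonglongrightarrow> 0"
        using tendsto_mult_ennreal[OF tendsto_const X0, of "ennreal vol"] by simp
    qed
    fix e assume "e \<in> edges a b c"
    then obtain p q r where e: "e = (q, r)" and pqr: "{p, q, r} = {a, b, c}"
      by (rule edges_cases)
    have m: "(\<lambda>t. \<psi> k (linepath q r t)) \<in> borel_measurable (lebesgue_on {0..1})" for k
      by (rule measurable_lebesgue_on_unit[OF edge_integrand_measurable[OF \<psi>]])
    show "edge_measurable e h"
      unfolding edge_measurable_def e fst_conv snd_conv h_def by (rule borel_measurable_lim_metric[OF m])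
    have "(\<lambda>k. \<integral>\<^sup>+t. ennreal \<bar>\<psi> k (linepath q r t) - h (linepath q r t)\<bar> \<partial>lebesgue_on {0..1}) \<longlonglongrightarrow> 0"
      unfolding h_def by (rule L1_limit[OF m _ cauchy[OF pqr]]) (use D in auto)
    from tendsto_mult_ennreal[OF tendsto_const this, of "ennreal (dist q r)"]
    show "(\<lambda>k. edge_L1_norm e (\<lambda>x. \<psi> k x - h x)) \<longlonglongrightarrow> 0"
      by (simp add: edge_L1_norm_def e)
  qed
  then show ?thesis by (rule that)
qed

lemma edge_integrals_eq_0_iff:
  assumes g: "weak_grad u w" and ae: "AE x in \<mu>. v x = u x"
  shows "(\<forall>e\<in>edges a b c. edge_integral e (boundary_trace a b c v) = 0) \<longleftrightarrow>
    edge_mean a u w = 0 \<and> edge_mean b u w = 0 \<and> edge_mean c u w = 0"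
proof -
  obtain t where "is_trace a b c v t"
    by (rule trace_exists[OF g ae])
  then have tr: "is_trace a b c v (boundary_trace a b c v)"
    unfolding boundary_trace_def using someI[of "is_trace a b c v" t] by simp
  have "edge_integral (q, r) (boundary_trace a b c v) = 0 \<longleftrightarrow> edge_mean p u w = 0"
    if "{p, q, r} = {a, b, c}" "(q, r) \<in> edges a b c" for p q r
    using trace_mean[OF tr g ae that] edge_distinct[OF that(1)] by (auto simp: edge_integral_def)
  from this[of a b c] this[of b c a] this[of c a b] show ?thesis
    by (auto simp: edges_def insert_commute)
qed

text \<open>In the difference the factors \<open>x - p\<close> and \<open>x - q\<close> combine to
  the constant \<open>q - p\<close>, and only the mean of the gradient survives.\<close>

lemma edge_mean_diff:
  assumes "weak_grad u w" "p \<in> closure K" "q \<in> closure K"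
  shows "edge_mean p u w - edge_mean q u w
    = ((\<integral>x. w 1 x \<partial>\<mu>) * (q - p) $ 1 + (\<integral>x. w 2 x \<partial>\<mu>) * (q - p) $ 2) / 2"
proof -
  have u: "integrable \<mu> u" and w: "\<And>i. integrable \<mu> (w i)"
    using assms(1) by (auto simp: weak_grad_def)
  have "(\<integral>x. w i x * (x - p) $ i \<partial>\<mu>) - (\<integral>x. w i x * (x - q) $ i \<partial>\<mu>) = (\<integral>x. w i x \<partial>\<mu>) * (q - p) $ i" for i
  proof -
    have "(\<integral>x. w i x * (x - p) $ i \<partial>\<mu>) - (\<integral>x. w i x * (x - q) $ i \<partial>\<mu>)
        = (\<integral>x. w i x * (x - p) $ i - w i x * (x - q) $ i \<partial>\<mu>)"
      by (rule Bochner_Integration.integral_diff[symmetric]) (intro integrable_mult_coordinate w assms)+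
    also have "\<dots> = (\<integral>x. w i x * (q - p) $ i \<partial>\<mu>)"
      by (simp add: algebra_simps)
    finally show ?thesis by simp
  qed
  from this[of 1] this[of 2] show ?thesis
    unfolding edge_mean_add[OF u w assms(2)] edge_mean_add[OF u w assms(3)] by (simp add: field_simps)
qed

lemma vertices_in_closure: "a \<in> closure K" "b \<in> closure K" "c \<in> closure K"
  using vertex_in_closure[of a b c] vertex_in_closure[of b c a] vertex_in_closure[of c a b]
  by (auto simp: insert_commute)

text \<open>Equal edge means make the mean gradient orthogonal to \<open>b - a\<close> and to
  \<open>c - b\<close>, which are independent.\<close>

lemma gradient_mean_eq_0:
  assumes g: "weak_grad u w" and 0: "edge_mean a u w = 0" "edge_mean b u w = 0" "edge_mean c u w = 0"
  shows "(\<integral>x. w i x \<partial>\<mu>) = 0"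
proof -
  define m where "m i = (\<integral>x. w i x \<partial>\<mu>)" for i
  let ?d = "(b - a) $ 1 * (c - b) $ 2 - (b - a) $ 2 * (c - b) $ 1"
  have 1: "m 1 * (b - a) $ 1 + m 2 * (b - a) $ 2 = 0" "m 1 * (c - b) $ 1 + m 2 * (c - b) $ 2 = 0"
    using edge_mean_diff[OF g vertices_in_closure(1,2)] edge_mean_diff[OF g vertices_in_closure(2,3)] 0
    by (simp_all add: m_def)
  \<comment> \<open>Cramer's rule, written out as polynomial identities.\<close>
  have "m 1 * ?d = (m 1 * (b - a) $ 1 + m 2 * (b - a) $ 2) * (c - b) $ 2 - (m 1 * (c - b) $ 1 + m 2 * (c - b) $ 2) * (b - a) $ 2"
    "m 2 * ?d = (m 1 * (c - b) $ 1 + m 2 * (c - b) $ 2) * (b - a) $ 1 - (m 1 * (b - a) $ 1 + m 2 * (b - a) $ 2) * (c - b) $ 1"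
    by (simp_all only: algebra_simps)
  then have "m 1 = 0" "m 2 = 0"
    using not_collinear_det[OF not_collinear] by (simp_all only: 1) simp_all
  then show ?thesis
    using exhaust_2[of i] by (auto simp: m_def)
qed

subsection \<open>The Crouzeix--Raviart interpolation\<close>

lemma weak_grad_minus_affine:
  assumes "weak_grad u w"
  shows "weak_grad (\<lambda>x. u x - affine_fun \<alpha> \<beta> \<gamma> x) (\<lambda>i x. w i x - (if i = 1 then \<beta> else \<gamma>))"
  using weak_grad_diff[OF assms smooth_weak_grad[OF smooth_affine_fun, of \<alpha> \<beta> \<gamma>]]
  by (simp add: partial_deriv_affine_fun)

text \<open>Vanishing of the three edge means forces the error to have a gradient of mean zero,
  which fixes \<open>\<beta>\<close> and \<open>\<gamma>\<close>. Conversely, with these values the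
  three edge means of the error agree, and the constant \<open>\<alpha>\<close> shifts all of them
  to 0. This is existence and uniqueness at once, as the definite description demands.\<close>

lemma CR_interp_eq:
  assumes g: "weak_grad u w" and ae: "AE x in \<mu>. v x = u x"
  defines "\<beta> \<equiv> \<integral>x. w 1 x \<partial>\<mu>" and "\<gamma> \<equiv> \<integral>x. w 2 x \<partial>\<mu>"
  obtains \<alpha> where "CR_interp a b c v = affine_fun \<alpha> \<beta> \<gamma>"
    "\<forall>e\<in>edges a b c. edge_integral e (boundary_trace a b c (\<lambda>x. v x - affine_fun \<alpha> \<beta> \<gamma> x)) = 0"
proof -
  let ?w = "\<lambda>\<beta> \<gamma> i x. w i x - (if i = (1::2) then \<beta> else \<gamma>)"
  let ?m = "\<lambda>p \<alpha> \<beta> \<gamma>. edge_mean p (\<lambda>x. u x - affine_fun \<alpha> \<beta> \<gamma> x) (?w \<beta> \<gamma>)"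
  let ?E = "\<lambda>q. \<forall>e\<in>edges a b c. edge_integral e (boundary_trace a b c (\<lambda>x. v x - q x)) = 0"
  have w: "integrable \<mu> (w i)" for i
    using g by (simp add: weak_grad_def)
  have E: "?E (affine_fun \<alpha> \<beta> \<gamma>) \<longleftrightarrow> ?m a \<alpha> \<beta> \<gamma> = 0 \<and> ?m b \<alpha> \<beta> \<gamma> = 0 \<and> ?m c \<alpha> \<beta> \<gamma> = 0" for \<alpha> \<beta> \<gamma>
    by (rule edge_integrals_eq_0_iff[OF weak_grad_minus_affine[OF g]]) (use ae in \<open>auto elim: eventually_mono\<close>)
  \<comment> \<open>A constant changes every edge mean by the same amount and leaves the gradient
    alone.\<close>
  have shift: "?m p \<alpha> \<beta> \<gamma> = ?m p 0 \<beta> \<gamma> - \<alpha>" for p \<alpha> \<beta> \<gamma>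
  proof -
    have "integrable \<mu> (\<lambda>x. u x - affine_fun 0 \<beta> \<gamma> x)"
      using weak_grad_minus_affine[OF g, of 0 \<beta> \<gamma>] by (simp add: weak_grad_def)
    then have "(\<integral>x. (u x - affine_fun 0 \<beta> \<gamma> x) - \<alpha> \<partial>\<mu>) = (\<integral>x. u x - affine_fun 0 \<beta> \<gamma> x \<partial>\<mu>) - \<alpha>"
      by simp
    moreover have "(u x - affine_fun 0 \<beta> \<gamma> x) - \<alpha> = u x - affine_fun \<alpha> \<beta> \<gamma> x" for x
      by (simp add: affine_fun_def)
    ultimately show ?thesis
      by (simp add: edge_mean_def)
  qed
  have mean: "(\<integral>x. ?w \<beta>' \<gamma>' i x \<partial>\<mu>) = (\<integral>x. w i x \<partial>\<mu>) - (if i = 1 then \<beta>' else \<gamma>')" for i \<beta>' \<gamma>'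
    using w[of i] by simp
  define \<alpha> where "\<alpha> = ?m a 0 \<beta> \<gamma>"
  have mean0: "(\<integral>x. ?w \<beta> \<gamma> i x \<partial>\<mu>) = 0" for i
    using exhaust_2[of i] unfolding mean \<beta>_def \<gamma>_def by auto
  have "?m p \<alpha> \<beta> \<gamma> = ?m a \<alpha> \<beta> \<gamma>" if "p \<in> closure K" for p
    using edge_mean_diff[OF weak_grad_minus_affine[OF g] that vertices_in_closure(1), of \<alpha> \<beta> \<gamma>]
    unfolding mean0 by simp
  moreover have "?m a \<alpha> \<beta> \<gamma> = 0"
    unfolding shift[of a \<alpha>] by (simp add: \<alpha>_def)
  ultimately have ex: "?E (affine_fun \<alpha> \<beta> \<gamma>)"
    unfolding E using vertices_in_closure by simp
  have "q = affine_fun \<alpha> \<beta> \<gamma>" if q0: "q \<in> affine_polys" and qE: "?E q" for q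
  proof -
    obtain \<alpha>' \<beta>' \<gamma>' where q: "q = affine_fun \<alpha>' \<beta>' \<gamma>'"
      using q0 by (auto simp: affine_polys_eq)
    have z: "?m a \<alpha>' \<beta>' \<gamma>' = 0" "?m b \<alpha>' \<beta>' \<gamma>' = 0" "?m c \<alpha>' \<beta>' \<gamma>' = 0"
      using qE unfolding q E by auto
    note gz = gradient_mean_eq_0[OF weak_grad_minus_affine[OF g] z]
    have "\<beta>' = \<beta>"
      using gz[of 1] unfolding mean \<beta>_def by simp
    moreover have "\<gamma>' = \<gamma>"
      using gz[of 2] unfolding mean \<gamma>_def by simp
    moreover have "\<alpha>' = ?m a 0 \<beta>' \<gamma>'"
      using z(1) unfolding shift[of a \<alpha>'] by simp
    ultimately show ?thesis
      by (simp only: q \<alpha>_def)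
  qed
  then have "CR_interp a b c v = affine_fun \<alpha> \<beta> \<gamma>"
    unfolding CR_interp_def using ex by (intro the_equality) (auto simp: affine_polys_eq)
  then show ?thesis
    using that ex by blast
qed

lemma Lp_norm_1_finite: "1 \<le> p \<Longrightarrow> Lp_norm p K (\<lambda>x. 1) < top"
proof (cases "p = top")
  case True
  have "Lp_norm top K (\<lambda>x. 1) \<le> 1"
    by (rule Lp_norm_topI) auto
  then show ?thesis
    using True by (simp add: order.strict_trans1)
next
  case False
  then show ?thesis
    by (simp add: Lp_norm_finite epowr_def ennreal_mult_less_top)
qed

lemma Lp_norm_smooth_finite:
  assumes "smooth \<phi>" "1 \<le> p"
  shows "Lp_norm p K \<phi> < top"
proof -
  have "bounded (\<phi> ` closure K)"
    by (intro compact_imp_bounded compact_continuous_image smooth_continuous_on assms)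
       (simp add: compact_closure bounded_K)
  then obtain B where B: "B > 0" "\<forall>x\<in>closure K. \<bar>\<phi> x\<bar> \<le> B"
    by (auto simp: bounded_pos)
  have "AE x in \<mu>. \<bar>\<phi> x\<bar> \<le> B * \<bar>1\<bar>"
    using AE_in_K by eventually_elim (use B closure_subset[of K] in auto)
  then have "Lp_norm p K \<phi> \<le> ennreal B * Lp_norm p K (\<lambda>x. 1)"
    using B smooth_measurable[OF assms(1)] by (intro Lp_norm_scale_le assms) auto
  also have "\<dots> < top"
    using Lp_norm_1_finite[OF assms(2)] by (simp add: ennreal_mult_less_top)
  finally show ?thesis .
qed

lemma Lp_norm_diff_le:
  assumes "1 \<le> p" "f \<in> borel_measurable borel" "g \<in> borel_measurable borel"
  shows "Lp_norm p K (\<lambda>x. f x - g x) \<le> 2 * (Lp_norm p K f + Lp_norm p K g)"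
  using assms by (intro Lp_norm_add_le) auto

text \<open>The error inherits an explicit gradient, \<open>w\<close> minus its mean. Its norms are
  finite because affine functions are bounded on K.\<close>

lemma sobolev_rep_minus_CR:
  assumes rep: "sobolev_rep p v u w" and p: "1 \<le> p"
  obtains \<alpha> where "sobolev_rep p (\<lambda>x. v x - CR_interp a b c v x)
      (\<lambda>x. u x - affine_fun \<alpha> (\<integral>x. w 1 x \<partial>\<mu>) (\<integral>x. w 2 x \<partial>\<mu>) x) (\<lambda>i x. w i x - (\<integral>y. w i y \<partial>\<mu>))"
    "(\<lambda>x. v x - CR_interp a b c v x) \<in> E_space p a b c"
proof -
  have g: "weak_grad u w" and ae: "AE x in \<mu>. v x = u x" and fin: "Lp_norm p K u < top" "\<And>i. Lp_norm p K (w i) < top"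
    using rep by (auto simp: sobolev_rep_def)
  let ?\<beta> = "\<integral>x. w 1 x \<partial>\<mu>" and ?\<gamma> = "\<integral>x. w 2 x \<partial>\<mu>"
  obtain \<alpha> where CR: "CR_interp a b c v = affine_fun \<alpha> ?\<beta> ?\<gamma>"
    and E: "\<forall>e\<in>edges a b c. edge_integral e (boundary_trace a b c (\<lambda>x. v x - affine_fun \<alpha> ?\<beta> ?\<gamma> x)) = 0"
    by (rule CR_interp_eq[OF g ae])
  have m: "(\<lambda>i x. w i x - (if i = 1 then ?\<beta> else ?\<gamma>)) = (\<lambda>i x. w i x - (\<integral>y. w i y \<partial>\<mu>))"
    using exhaust_2 by (auto simp: fun_eq_iff)
  have c: "smooth (\<lambda>x. k)" for k
    using smooth_affine_fun[of k 0 0] by (simp add: affine_fun_def[abs_def])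
  have "sobolev_rep p (\<lambda>x. v x - CR_interp a b c v x)
      (\<lambda>x. u x - affine_fun \<alpha> ?\<beta> ?\<gamma> x) (\<lambda>i x. w i x - (\<integral>y. w i y \<partial>\<mu>))"
  proof (rule sobolev_repI)
    show "weak_grad (\<lambda>x. u x - affine_fun \<alpha> ?\<beta> ?\<gamma> x) (\<lambda>i x. w i x - (\<integral>y. w i y \<partial>\<mu>))"
      using weak_grad_minus_affine[OF g, of \<alpha> ?\<beta> ?\<gamma>] unfolding m .
    show "AE x in \<mu>. v x - CR_interp a b c v x = u x - affine_fun \<alpha> ?\<beta> ?\<gamma> x"
      using ae unfolding CR by eventually_elim simp
    have "Lp_norm p K (\<lambda>x. u x - affine_fun \<alpha> ?\<beta> ?\<gamma> x) \<le> 2 * (Lp_norm p K u + Lp_norm p K (affine_fun \<alpha> ?\<beta> ?\<gamma>))"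
      by (rule Lp_norm_diff_le[OF p weak_grad_measurable(1)[OF g] smooth_measurable[OF smooth_affine_fun]])
    also have "\<dots> < top"
      using fin(1) Lp_norm_smooth_finite[OF smooth_affine_fun p] by (simp add: ennreal_mult_less_top)
    finally show "Lp_norm p K (\<lambda>x. u x - affine_fun \<alpha> ?\<beta> ?\<gamma> x) < top" .
    fix i
    have "Lp_norm p K (\<lambda>x. w i x - (\<integral>y. w i y \<partial>\<mu>)) \<le> 2 * (Lp_norm p K (w i) + Lp_norm p K (\<lambda>x. \<integral>y. w i y \<partial>\<mu>))"
      by (rule Lp_norm_diff_le[OF p weak_grad_measurable(2)[OF g] smooth_measurable[OF c]])
    also have "\<dots> < top"
      using fin(2) Lp_norm_smooth_finite[OF c p] by (simp add: ennreal_mult_less_top)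
    finally show "Lp_norm p K (\<lambda>x. w i x - (\<integral>y. w i y \<partial>\<mu>)) < top" .
  qed
  moreover from sobolev_if_rep[OF this] have "(\<lambda>x. v x - CR_interp a b c v x) \<in> E_space p a b c"
    using E by (simp add: E_space_def CR)
  ultimately show ?thesis
    by (rule that)
qed

section \<open>The estimates on a triangle, with explicit constants\<close>

abbreviation diam :: real where "diam \<equiv> diameter (closed_triangle a b c)"

lemma diam_nonneg: "diam \<ge> 0"
  using diameter_ge_0[OF bounded_K] by (simp add: diameter_K)

text \<open>The 4 is the factor 2 of the triangle inequality times the number of partial
  derivatives.\<close>

lemma Lp_norm_grad1_le_seminorm:
  assumes "sobolev_rep p v u w" "1 \<le> p"
  shows "Lp_norm p K (grad1 w) \<le> 4 * seminorm 1 p K v"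
proof -
  have "Lp_norm p K (grad1 w) \<le> 2 * (Lp_norm p K (w 1) + Lp_norm p K (w 2))"
    using assms weak_grad_measurable(2) by (intro Lp_norm_grad1_le) (auto simp: sobolev_rep_def)
  also have "\<dots> \<le> 2 * (seminorm 1 p K v + seminorm 1 p K v)"
    by (intro mult_left_mono add_mono seminorm_1_rep(1)[OF assms]) auto
  also have "\<dots> = 4 * seminorm 1 p K v"
    by (simp add: mult_2[symmetric] mult.assoc[symmetric])
  finally show ?thesis .
qed

lemma poincare_mean_zero:
  assumes "weak_grad u w" "1 \<le> p" "(\<integral>x. u x \<partial>\<mu>) = 0"
  shows "Lp_norm p K u \<le> ennreal (4 * diam) * Lp_norm p K (grad1 w)"
  using poincare_Lp[OF assms(1,2)] assms(3) by (simp add: diameter_K mult.commute)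

lemma Phi_estimate:
  assumes "v \<in> Phi_space p a b c" "1 \<le> p"
  shows "seminorm 0 p K v \<le> ennreal (16 * diam) * seminorm 1 p K v"
proof -
  have "v \<in> sobolev 1 p K" and 0: "(\<integral>x. v x \<partial>lebesgue_on K) = 0"
    using assms(1) by (auto simp: Phi_space_def)
  then obtain u w where rep: "sobolev_rep p v u w"
    using sobolev_rep_exists assms(2) by blast
  then have g: "weak_grad u w" and ae: "AE x in \<mu>. v x = u x"
    by (auto simp: sobolev_rep_def)
  have "vol * (\<integral>x. u x \<partial>\<mu>) = 0"
    using integral_AE_representative[OF weak_grad_measurable(1)[OF g] borel_measurable_const ae, of 1] 0 by simp
  then have "(\<integral>x. u x \<partial>\<mu>) = 0"
    using vol_pos by simp
  then have "Lp_norm p K u \<le> ennreal (4 * diam) * Lp_norm p K (grad1 w)"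
    by (rule poincare_mean_zero[OF g assms(2)])
  also have "\<dots> \<le> ennreal (4 * diam) * (4 * seminorm 1 p K v)"
    by (intro mult_left_mono Lp_norm_grad1_le_seminorm[OF rep assms(2)]) auto
  also have "\<dots> = ennreal (16 * diam) * seminorm 1 p K v"
    using diam_nonneg by (simp add: ennreal_mult mult_ac numeral_mult_ennreal[symmetric])
  finally show ?thesis
    by (simp add: seminorm_0_rep[OF rep])
qed

text \<open>One vanishing edge mean expresses the mean of \<open>u\<close> by the gradient. The
  factor 1/2 in \<open>edge_mean\<close> is given away.\<close>

lemma mean_le_gradient:
  assumes g: "weak_grad u w" and 0: "edge_mean a u w = 0"
  shows "ennreal \<bar>\<integral>x. u x \<partial>\<mu>\<bar> \<le> ennreal diam * L1 (grad1 w)"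
proof -
  have w: "integrable \<mu> (w i)" for i
    using g by (simp add: weak_grad_def)
  let ?f = "\<lambda>x. w 1 x * (x - a) $ 1 + w 2 x * (x - a) $ 2"
  have f: "integrable \<mu> ?f"
    by (intro Bochner_Integration.integrable_add integrable_mult_coordinate w vertices_in_closure)
  have "\<bar>\<integral>x. u x \<partial>\<mu>\<bar> \<le> \<bar>\<integral>x. ?f x \<partial>\<mu>\<bar>"
    using 0 by (simp add: edge_mean_def)
  then have "ennreal \<bar>\<integral>x. u x \<partial>\<mu>\<bar> \<le> (\<integral>\<^sup>+x. ennreal (norm (?f x)) \<partial>\<mu>)"
    using integral_norm_bound_ennreal[OF f] by (auto intro: order_trans[OF ennreal_leI])
  also have "\<dots> \<le> (\<integral>\<^sup>+x. ennreal diam * ennreal \<bar>grad1 w x\<bar> \<partial>\<mu>)"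
  proof (intro nn_integral_mono_AE eventually_mono[OF AE_in_K])
    fix x assume x: "x \<in> K"
    have c: "\<bar>(x - a) $ i\<bar> \<le> diam" for i
      using coordinate_bound[OF vertices_in_closure(1) x] by (simp add: diameter_K)
    have "\<bar>?f x\<bar> \<le> \<bar>w 1 x\<bar> * \<bar>(x - a) $ 1\<bar> + \<bar>w 2 x\<bar> * \<bar>(x - a) $ 2\<bar>"
      by (rule order_trans[OF abs_triangle_ineq]) (simp add: abs_mult)
    also have "\<dots> \<le> \<bar>w 1 x\<bar> * diam + \<bar>w 2 x\<bar> * diam"
      by (intro add_mono mult_left_mono c) auto
    also have "\<dots> = diam * \<bar>grad1 w x\<bar>"
      by (simp add: grad1_def algebra_simps)
    finally show "ennreal (norm (?f x)) \<le> ennreal diam * ennreal \<bar>grad1 w x\<bar>"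
      using diam_nonneg by (simp add: ennreal_mult[symmetric] ennreal_leI)
  qed
  also have "\<dots> = ennreal diam * L1 (grad1 w)"
    using weak_grad_measurable(2)[OF g] by (intro nn_integral_cmult) simp
  finally show ?thesis .
qed

text \<open>Splits \<open>u\<close> into its deviation from the mean, with constant 4, and the mean
  itself, with constant 1. The factor 2 of the triangle inequality and the factor 4 for
  \<open>grad1\<close> give \<open>2 * (4 + 1) * 4 = 40\<close>.\<close>

lemma E_estimate:
  assumes "v \<in> E_space p a b c" "1 \<le> p"
  shows "seminorm 0 p K v \<le> ennreal (40 * diam) * seminorm 1 p K v"
proof -
  have "v \<in> sobolev 1 p K" and E: "\<forall>e\<in>edges a b c. edge_integral e (boundary_trace a b c v) = 0"
    using assms(1) by (auto simp: E_space_def)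
  then obtain u w where rep: "sobolev_rep p v u w"
    using sobolev_rep_exists assms(2) by blast
  then have g: "weak_grad u w" and ae: "AE x in \<mu>. v x = u x"
    by (auto simp: sobolev_rep_def)
  have [measurable]: "u \<in> borel_measurable borel" "w i \<in> borel_measurable borel" for i
    using weak_grad_measurable[OF g] by auto
  have 0: "edge_mean a u w = 0"
    using E edge_integrals_eq_0_iff[OF g ae] by simp
  let ?m = "\<integral>x. u x \<partial>\<mu>" and ?G = "Lp_norm p K (grad1 w)"
  have "Lp_norm p K u \<le> 2 * (Lp_norm p K (\<lambda>x. u x - ?m) + Lp_norm p K (\<lambda>x. ?m))"
    using assms(2) by (intro Lp_norm_add_le) auto
  also have "\<dots> \<le> 2 * (ennreal (4 * diam) * ?G + ennreal diam * ?G)"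
  proof (intro mult_left_mono add_mono)
    show "Lp_norm p K (\<lambda>x. u x - ?m) \<le> ennreal (4 * diam) * ?G"
      using poincare_Lp[OF g assms(2)] by (simp add: diameter_K mult.commute)
    show "Lp_norm p K (\<lambda>x. ?m) \<le> ennreal diam * ?G"
      by (rule Lp_norm_const_le[OF assms(2) diam_nonneg _ mean_le_gradient[OF g 0]]) measurable
  qed simp
  also have "\<dots> = ennreal (10 * diam) * ?G"
  proof -
    have "ennreal (4 * diam) * ?G + ennreal diam * ?G = ennreal (5 * diam) * ?G"
      using diam_nonneg by (simp add: distrib_right[symmetric] ennreal_plus[symmetric] del: ennreal_plus)
    moreover have "2 * ennreal (5 * diam) = ennreal (10 * diam)"
      using diam_nonneg by (simp add: ennreal_mult mult.assoc[symmetric])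
    ultimately show ?thesis
      by (simp add: mult.assoc[symmetric])
  qed
  also have "\<dots> \<le> ennreal (10 * diam) * (4 * seminorm 1 p K v)"
    by (intro mult_left_mono Lp_norm_grad1_le_seminorm[OF rep assms(2)]) auto
  also have "\<dots> = ennreal (40 * diam) * seminorm 1 p K v"
    using diam_nonneg by (simp add: ennreal_mult mult_ac numeral_mult_ennreal[symmetric])
  finally show ?thesis
    by (simp add: seminorm_0_rep[OF rep])
qed

text \<open>Subtracting the mean is bounded on every L^p, as the mean is by Jensen. Each of the two
  partial derivatives contributes a factor 4.\<close>

lemma CR_seminorm_1_le:
  assumes "v \<in> sobolev 1 p K" "1 \<le> p"
  shows "seminorm 1 p K (\<lambda>x. v x - CR_interp a b c v x) \<le> 8 * seminorm 1 p K v"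
proof -
  obtain u w where rep: "sobolev_rep p v u w"
    using sobolev_rep_exists assms by blast
  then have g: "weak_grad u w"
    by (simp add: sobolev_rep_def)
  have [measurable]: "w i \<in> borel_measurable borel" for i
    using weak_grad_measurable[OF g] by auto
  obtain \<alpha> where rep': "sobolev_rep p (\<lambda>x. v x - CR_interp a b c v x)
      (\<lambda>x. u x - affine_fun \<alpha> (\<integral>x. w 1 x \<partial>\<mu>) (\<integral>x. w 2 x \<partial>\<mu>) x) (\<lambda>i x. w i x - (\<integral>y. w i y \<partial>\<mu>))"
    by (rule sobolev_rep_minus_CR[OF rep assms(2)])
  have "Lp_norm p K (\<lambda>x. w i x - (\<integral>y. w i y \<partial>\<mu>)) \<le> 4 * seminorm 1 p K v" for i
  proof -
    have "ennreal \<bar>\<integral>y. w i y \<partial>\<mu>\<bar> \<le> ennreal 1 * L1 (w i)"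
      using integral_norm_bound_ennreal[of \<mu> "w i"] g by (simp add: weak_grad_def)
    then have "Lp_norm p K (\<lambda>x. \<integral>y. w i y \<partial>\<mu>) \<le> ennreal 1 * Lp_norm p K (w i)"
      by (intro Lp_norm_const_le[OF assms(2)]) auto
    then have m: "Lp_norm p K (\<lambda>x. \<integral>y. w i y \<partial>\<mu>) \<le> Lp_norm p K (w i)"
      by simp
    have "Lp_norm p K (\<lambda>x. w i x - (\<integral>y. w i y \<partial>\<mu>)) \<le> 2 * (Lp_norm p K (w i) + Lp_norm p K (\<lambda>x. \<integral>y. w i y \<partial>\<mu>))"
      by (rule Lp_norm_diff_le[OF assms(2)]) auto
    also have "\<dots> \<le> 2 * (seminorm 1 p K v + seminorm 1 p K v)"
      by (intro mult_left_mono add_mono order_trans[OF m] seminorm_1_rep(1)[OF rep assms(2)]) auto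
    also have "\<dots> = 4 * seminorm 1 p K v"
      by (simp add: mult_2[symmetric] mult.assoc[symmetric])
    finally show ?thesis .
  qed
  from this[of 1] this[of 2]
  have "seminorm 1 p K (\<lambda>x. v x - CR_interp a b c v x) \<le> 4 * seminorm 1 p K v + 4 * seminorm 1 p K v"
    by (intro order_trans[OF seminorm_1_rep(2)[OF rep' assms(2)]] add_mono)
  also have "\<dots> = 8 * seminorm 1 p K v"
    by (simp add: distrib_right[symmetric])
  finally show ?thesis .
qed

text \<open>The weak gradient of \<open>u\<close>, tested with
  \<open>partial_deriv j \<phi>\<close>, is compared with the second weak derivative of
  \<open>u\<close>, tested with \<open>\<phi>\<close>. The comparison says that the latter is the
  weak derivative of \<open>w i\<close> in direction \<open>j\<close>.\<close>

lemma second_derivatives: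
  assumes v: "v \<in> sobolev 2 p K" "1 \<le> p" and rep: "sobolev_rep p v u w"
  obtains W where "weak_grad (w i) W" "\<And>j. Lp_norm p K (W j) \<le> seminorm 2 p K v"
proof -
  have g: "weak_grad u w" and ae: "AE x in \<mu>. v x = u x"
    using rep by (auto simp: sobolev_rep_def)
  have "\<exists>W. weak_rep (unit_mi j) (w i) W \<and> Lp_norm p K W \<le> seminorm 2 p K v" for j
  proof -
    define \<delta> where "\<delta> = (fst (unit_mi i) + fst (unit_mi j), snd (unit_mi i) + snd (unit_mi j))"
    have \<delta>: "mi_order \<delta> = 2"
      using mi_order_unit_mi[of i] mi_order_unit_mi[of j] by (simp add: \<delta>_def mi_order_def)
    have deriv: "mi_deriv \<delta> \<phi> = partial_deriv i (partial_deriv j \<phi>)" if "smooth \<phi>" for \<phi>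
    proof -
      \<comment> \<open>A multi-index differentiates in the second variable first, so the case
        \<open>i = 2\<close>, \<open>j = 1\<close> depends on the symmetry.\<close>
      have "partial_deriv 1 (partial_deriv 2 \<phi>) = partial_deriv 2 (partial_deriv 1 \<phi>)"
        using partial_deriv_commute[OF that] by blast
      then show ?thesis
        using exhaust_2[of i] exhaust_2[of j]
        by (auto simp: \<delta>_def unit_mi_def mi_deriv_def numeral_2_eq_2)
    qed
    obtain W0 where W0: "W0 \<in> Lp_space p K" "is_weak_deriv K \<delta> v W0"
      using v(1) \<delta> unfolding sobolev_def mem_Collect_eq by (metis order_refl)
    obtain W where W: "integrable \<mu> W" "AE x in \<mu>. W0 x = W x" "Lp_norm p K W < top"
      by (rule Lp_space_representative[OF W0(1) v(2)])
    have "weak_rep \<delta> u W"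
      using g by (intro weak_repI[OF W0(2) ae W(2) _ W(1)]) (simp add: weak_grad_def)
    then have uW: "(\<integral>x. u x * mi_deriv \<delta> \<phi> x \<partial>\<mu>) = (\<integral>x. W x * \<phi> x \<partial>\<mu>)" if "\<phi> \<in> test_functions K" for \<phi>
      using that \<delta> by (simp add: weak_rep_def)
    have "weak_rep (unit_mi j) (w i) W"
      unfolding weak_rep_def
    proof (intro conjI ballI W(1))
      show "integrable \<mu> (w i)"
        using g by (simp add: weak_grad_def)
      fix \<phi> assume \<phi>: "\<phi> \<in> test_functions K"
      then have "smooth \<phi>" by (simp add: test_functions_def)
      have "(\<integral>x. u x * partial_deriv i (partial_deriv j \<phi>) x \<partial>\<mu>) = - (\<integral>x. w i x * partial_deriv j \<phi> x \<partial>\<mu>)"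
        using g partial_deriv_test_functions[OF \<phi>] by (simp add: weak_grad_def)
      then show "(\<integral>x. w i x * mi_deriv (unit_mi j) \<phi> x \<partial>\<mu>) = (-1) ^ mi_order (unit_mi j) * (\<integral>x. W x * \<phi> x \<partial>\<mu>)"
        using uW[OF \<phi>] by (simp add: deriv[OF \<open>smooth \<phi>\<close>] mi_deriv_unit_mi mi_order_unit_mi)
    qed
    moreover have "Lp_norm p K W \<le> seminorm 2 p K v"
    proof -
      have "AE x in \<mu>. weak_deriv K \<delta> v x = W x"
        using weak_deriv_AE[OF W0(2)] W(2) by eventually_elim simp
      then have "Lp_norm p K (weak_deriv K \<delta> v) = Lp_norm p K W"
        using borel_measurable_integrable[OF W(1)] by (intro Lp_norm_AE_cong) auto
      then show ?thesis
        using Lp_norm_le_seminorm[OF v(2) \<delta>, of K v] by simp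
    qed
    ultimately show ?thesis by blast
  qed
  then obtain W where "\<And>j. weak_rep (unit_mi j) (w i) (W j)" "\<And>j. Lp_norm p K (W j) \<le> seminorm 2 p K v"
    by metis
  then show ?thesis
    using that[of W] by (simp add: weak_grad_iff_weak_rep)
qed

lemma sobolev_2_subset: "sobolev 2 p K \<subseteq> sobolev 1 p K"
  by (auto simp: sobolev_def)

text \<open>Each component of the gradient of the error is \<open>w i\<close> minus its mean, so the
  Poincare inequality applies to it directly. The constant 32 is 4 from Poincare, 4 for
  \<open>grad1\<close> and 2 for the number of components.\<close>

lemma CR_seminorm_1_le_seminorm_2:
  assumes v: "v \<in> sobolev 2 p K" and p: "1 \<le> p"
  shows "seminorm 1 p K (\<lambda>x. v x - CR_interp a b c v x) \<le> ennreal (32 * diam) * seminorm 2 p K v"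
proof -
  obtain u w where rep: "sobolev_rep p v u w"
    using sobolev_rep_exists v sobolev_2_subset p by blast
  then have g: "weak_grad u w"
    by (simp add: sobolev_rep_def)
  obtain \<alpha> where rep': "sobolev_rep p (\<lambda>x. v x - CR_interp a b c v x)
      (\<lambda>x. u x - affine_fun \<alpha> (\<integral>x. w 1 x \<partial>\<mu>) (\<integral>x. w 2 x \<partial>\<mu>) x) (\<lambda>i x. w i x - (\<integral>y. w i y \<partial>\<mu>))"
    by (rule sobolev_rep_minus_CR[OF rep p])
  let ?S = "seminorm 2 p K v"
  have "Lp_norm p K (\<lambda>x. w i x - (\<integral>y. w i y \<partial>\<mu>)) \<le> ennreal (16 * diam) * ?S" for i
  proof -
    obtain W where W: "weak_grad (w i) W" "\<And>j. Lp_norm p K (W j) \<le> ?S"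
      by (rule second_derivatives[OF v p rep, of i]) (rule that)
    have "Lp_norm p K (\<lambda>x. w i x - (\<integral>y. w i y \<partial>\<mu>)) \<le> ennreal (4 * diam) * Lp_norm p K (grad1 W)"
      using poincare_Lp[OF W(1) p] by (simp add: diameter_K mult.commute)
    also have "\<dots> \<le> ennreal (4 * diam) * (2 * (?S + ?S))"
      by (intro mult_left_mono order_trans[OF Lp_norm_grad1_le[OF p weak_grad_measurable(2)[OF W(1)]]] add_mono W(2)) auto
    also have "2 * (?S + ?S) = 4 * ?S"
      by (simp add: mult_2[symmetric] mult.assoc[symmetric])
    also have "ennreal (4 * diam) * (4 * ?S) = ennreal (16 * diam) * ?S"
      using diam_nonneg by (simp add: ennreal_mult mult_ac numeral_mult_ennreal[symmetric])
    finally show ?thesis .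
  qed
  from this[of 1] this[of 2]
  have "seminorm 1 p K (\<lambda>x. v x - CR_interp a b c v x) \<le> ennreal (16 * diam) * ?S + ennreal (16 * diam) * ?S"
    by (intro order_trans[OF seminorm_1_rep(2)[OF rep' p]] add_mono)
  also have "\<dots> = ennreal (32 * diam) * ?S"
    using diam_nonneg by (simp add: distrib_right[symmetric] ennreal_plus[symmetric] del: ennreal_plus)
  finally show ?thesis .
qed

lemma CR_in_E_space:
  assumes "v \<in> sobolev 1 p K" "1 \<le> p"
  shows "(\<lambda>x. v x - CR_interp a b c v x) \<in> E_space p a b c"
proof -
  obtain u w where "sobolev_rep p v u w"
    using sobolev_rep_exists assms by blast
  then show ?thesis
    using sobolev_rep_minus_CR assms(2) by blast
qed

end

theorem theorem4p6:
  fixes p :: ennreal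
  assumes "1 \<le> p"
  shows "\<exists>C::real. C \<ge> 0 \<and> (\<forall>a b c :: real^2. \<not> collinear {a, b, c} \<longrightarrow>
    (let K = open_triangle a b c; h = diameter (closed_triangle a b c); I = CR_interp a b c in
       (SUP u \<in> Phi_space p a b c - ae_zero a b c. seminorm 0 p K u / seminorm 1 p K u)
          \<le> ennreal (C * h) \<and>
       (SUP u \<in> E_space p a b c - ae_zero a b c. seminorm 0 p K u / seminorm 1 p K u)
          \<le> ennreal (C * h) \<and>
       (\<forall>v \<in> sobolev 1 p K.
          seminorm 0 p K (\<lambda>x. v x - I v x) \<le> ennreal (2 * C * h) * seminorm 1 p K v) \<and>
       (\<forall>v \<in> sobolev 2 p K.
          seminorm 0 p K (\<lambda>x. v x - I v x)
            \<le> ennreal (C * h) * seminorm 1 p K (\<lambda>x. v x - I v x) \<and>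
          ennreal (C * h) * seminorm 1 p K (\<lambda>x. v x - I v x)
            \<le> ennreal (C\<^sup>2 * h\<^sup>2) * seminorm 2 p K v)))"
proof (intro exI[of _ 160] conjI allI impI)
  fix a b c :: "real^2"
  assume "\<not> collinear {a, b, c}"
  then interpret triangle a b c by unfold_locales
  let ?h = "diameter (closed_triangle a b c)" and ?I = "CR_interp a b c"
  \<comment> \<open>The value 160 is dictated by the first interpolation estimate, where
    \<open>40 * 8 = 2 * 160\<close>; the constants 16, 40 and 32 of the other estimates are
    smaller.\<close>
  have mono: "ennreal (k * ?h) * x \<le> ennreal (160 * ?h) * x" if "k \<le> 160" for k x
    using diam_nonneg that by (intro mult_right_mono ennreal_leI) auto
  have Phi: "(SUP u \<in> Phi_space p a b c - ae_zero a b c. seminorm 0 p K u / seminorm 1 p K u) \<le> ennreal (160 * ?h)"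
    by (intro SUP_least divide_le_ennrealI order_trans[OF Phi_estimate[OF _ assms] mono]) auto
  have E: "(SUP u \<in> E_space p a b c - ae_zero a b c. seminorm 0 p K u / seminorm 1 p K u) \<le> ennreal (160 * ?h)"
    by (intro SUP_least divide_le_ennrealI order_trans[OF E_estimate[OF _ assms] mono]) auto
  have CR1: "seminorm 0 p K (\<lambda>x. v x - ?I v x) \<le> ennreal (2 * 160 * ?h) * seminorm 1 p K v" if v: "v \<in> sobolev 1 p K" for v
  proof -
    have "seminorm 0 p K (\<lambda>x. v x - ?I v x) \<le> ennreal (40 * ?h) * seminorm 1 p K (\<lambda>x. v x - ?I v x)"
      by (rule E_estimate[OF CR_in_E_space[OF v assms] assms])
    also have "\<dots> \<le> ennreal (40 * ?h) * (8 * seminorm 1 p K v)"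
      by (intro mult_left_mono CR_seminorm_1_le[OF v assms]) auto
    also have "\<dots> = ennreal (2 * 160 * ?h) * seminorm 1 p K v"
      using diam_nonneg ennreal_mult[of "40 * ?h" 8] by (simp add: mult.assoc[symmetric])
    finally show ?thesis .
  qed
  have CR2: "seminorm 0 p K (\<lambda>x. v x - ?I v x) \<le> ennreal (160 * ?h) * seminorm 1 p K (\<lambda>x. v x - ?I v x)"
    if v: "v \<in> sobolev 2 p K" for v
    using v sobolev_2_subset
    by (intro order_trans[OF E_estimate[OF CR_in_E_space[OF _ assms] assms] mono]) auto
  have CR3: "ennreal (160 * ?h) * seminorm 1 p K (\<lambda>x. v x - ?I v x) \<le> ennreal (160\<^sup>2 * ?h\<^sup>2) * seminorm 2 p K v"
    if v: "v \<in> sobolev 2 p K" for v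
  proof -
    have "ennreal (160 * ?h) * seminorm 1 p K (\<lambda>x. v x - ?I v x) \<le> ennreal (160 * ?h) * (ennreal (160 * ?h) * seminorm 2 p K v)"
      by (intro mult_left_mono order_trans[OF CR_seminorm_1_le_seminorm_2[OF v assms] mono]) auto
    also have "\<dots> = ennreal ((160 * ?h) * (160 * ?h)) * seminorm 2 p K v"
      using diam_nonneg by (subst ennreal_mult) (auto simp: mult.assoc)
    also have "(160 * ?h) * (160 * ?h) = 160\<^sup>2 * ?h\<^sup>2"
      by (simp add: power2_eq_square)
    finally show ?thesis .
  qed
  show "let K = open_triangle a b c; h = diameter (closed_triangle a b c); I = CR_interp a b c in
       (SUP u \<in> Phi_space p a b c - ae_zero a b c. seminorm 0 p K u / seminorm 1 p K u)
          \<le> ennreal (160 * h) \<and>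
       (SUP u \<in> E_space p a b c - ae_zero a b c. seminorm 0 p K u / seminorm 1 p K u)
          \<le> ennreal (160 * h) \<and>
       (\<forall>v \<in> sobolev 1 p K.
          seminorm 0 p K (\<lambda>x. v x - I v x) \<le> ennreal (2 * 160 * h) * seminorm 1 p K v) \<and>
       (\<forall>v \<in> sobolev 2 p K.
          seminorm 0 p K (\<lambda>x. v x - I v x)
            \<le> ennreal (160 * h) * seminorm 1 p K (\<lambda>x. v x - I v x) \<and>
          ennreal (160 * h) * seminorm 1 p K (\<lambda>x. v x - I v x)
            \<le> ennreal (160\<^sup>2 * h\<^sup>2) * seminorm 2 p K v)"
    unfolding Let_def by (intro conjI ballI Phi E CR1 CR2 CR3)
qed simp

end
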